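(* Let $D\ge1$ be an integer and write $[a,b]=\{k\in\mathbb Z\mid a\le k\le b\}$. Let $X$ be the simplicial complex with vertex set $[0,D+3]$ consisting of all simplices $\sigma\subseteq[0,D+3]$ such that $[1,D+1]\not\subseteq\sigma$ and $\{D+2,D+3\}\not\subseteq\sigma$. Let $U_0$ be the full subcomplex of $X$ spanned by $[0,D+1]\cup\{D+3\}$ and, for $i\in[1,D+1]$, let $U_i$ be the full subcomplex of $X$ spanned by $[0,D+2]\setminus\{i\}$. Let $A$ be the subcomplex of $X$ of all simplices not containing the vertex $0$. Filter $X$ by $X^m=\emptyset$ for $m<-2D$, $X^m=A$ for $-2D\le m<0$, $X^{2j}=X^{2j+1}=A\cup U_0\cup\dots\cup U_j$ for $0\le j\le D+1$, and $X^m=X$ for $m\ge 2D+2$. Equip each $U_i$ with the induced filtration $U_i^m=U_i\cap X^m$, and let $\mathcal U=(U_i)_{i\in[0,D+1]}$ be the resulting filtered cover of $X$, with Mayer-Vietoris spectral sequence $E$. Then $\mathcal U$ is a $1$-acyclic cover of $X$, and $$H_D(X)\cong\frac{t^{-2D}\mathbf k[t]}{t^{2D+2}\mathbf k[t]},\qquad E^\infty_{D,0}\cong\frac{t^{-2D}\mathbf k[t]}{t^{2}\mathbf k[t]};$$ these two modules are $\eta$-interleaved for $\eta=2D$, but not for any $\eta<2D$ ($\eta\in\mathbb N_0$).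
   Context: Modules and interleavings. Let $\mathbf k$ be a field and let $\mathbf k[t]$ be graded by degree. A $\mathbf k[t]$-module means a $\mathbb Z$-graded module $M=\bigoplus_{j\in\mathbb Z}M^j$ with $tM^j\subseteq M^{j+1}$; isomorphisms preserve degree. For $\eta\in\mathbb N_0$, an $\eta$-morphism $f:M\to N$ is a $\mathbf k[t]$-linear map with $f(M^j)\subseteq N^{j+\eta}$ for all $j$. Let $\mathrm{id}_\eta:M\to M$ be $m\mapsto t^\eta m$. $M\overset{\eta}{\sim}N$ ($\eta$-interleaved) means there are $\eta$-morphisms $\phi:M\to N$, $\psi:N\to M$ with $\phi\psi=\mathrm{id}_{2\eta}$ and $\psi\phi=\mathrm{id}_{2\eta}$. $t^a\mathbf k[t]$ denotes the free module on one generator of degree $a\in\mathbb Z$ (inside $\mathbf k[t,t^{-1}]$). Filtered complexes. A $\mathbb Z$-filtered simplicial complex is a simplicial complex $X$ with an increasing family of subcomplexes $(X^j)_{j\in\mathbb Z}$ with empty intersection and union $X$. For a filtered cover $\mathcal U=(U_i)_{i\in\Lambda}$ by filtered subcomplexes (with $X^j=\bigcup_iU_i^j$ for all $j$) and nonempty finite $I\subseteq\Lambda$, $U_I=\bigcap_{i\in I}U_i$ is filtered by $U_I^j=\bigcap_{i\in I}U_i^j$. Persistent homology is $H_q(X)=\bigoplus_jH_q(X^j;\mathbf k)$ with $t$ acting by inclusion-induced maps. $\mathcal U$ is $\varepsilon$-acyclic if for each nonempty finite $I\subseteq\Lambda$ with $U_I\ne\emptyset$ there is $a\in\mathbb Z$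 with $H_0(U_I)\overset{\varepsilon}{\sim}t^a\mathbf k[t]$ and $H_q(U_I)\overset{\varepsilon}{\sim}0$ for $q\ne0$. Mayer-Vietoris spectral sequence. Let $E^0_{p,q}=\bigoplus_{|I|=p+1}C_q(U_I)$, where $C_q(U_I)$ is the free $\mathbf k[t]$-module on the $q$-simplices $(\sigma,I)$, $\sigma\in U_I$, in degree $\deg(\sigma,I)=\min\{j\mid\sigma\in U_I^j\}$. After totally ordering the vertices of $X$ and the index set $\Lambda$, put $\partial^0(\sigma,I)=\sum_{k=0}^q(-1)^kt^{\deg(\sigma,I)-\deg(\sigma_k,I)}(\sigma_k,I)$ and $\partial^1(\sigma,I)=\sum_{l=0}^p(-1)^lt^{\deg(\sigma,I)-\deg(\sigma,I_l)}(\sigma,I_l)$, where $\sigma_k$, $I_l$ are obtained by deleting the $k$-th vertex of $\sigma$, resp. the $l$-th element of $I$. (These commute; replace $\partial^0$ by $(-1)^p\partial^0$ to get an anticommuting double complex.) $(E^r,d^r)$ is the spectral sequence of this first-quadrant double complex obtained by first taking homology with respect to $\partial^0$ (i.e. from filtering the total complex by $p$), with $d^r:E^r_{p,q}\to E^r_{p-r,q+r-1}$, so $E^1_{p,q}=\bigoplus_{|I|=p+1}H_q(U_I)$; $E^\infty$ is its limit page. *)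

theory Defs
  imports
    "HOL-Algebra.AbelCoset"
    "HOL-Algebra.Module"
    "HOL-Computational_Algebra.Polynomial"
    "HOL-Library.Poly_Mapping"
begin

hide_const (open) Polynomial.smult

section \<open>Modules, quotients and graded modules over k[t]\<close>

text \<open>
  Modules are records of HOL-Algebra. Their ring fields \<open>mult\<close> and \<open>one\<close> play no role for
  modules and are left \<open>undefined\<close>.
\<close>

definition free_module :: "'b set \<Rightarrow> ('r::comm_ring_1, 'b \<Rightarrow>\<^sub>0 'r) module" where
  "free_module B =
    \<lparr>carrier = {x. Poly_Mapping.keys x \<subseteq> B}, monoid.mult = undefined, one = undefined,
     zero = 0, add = (+), smult = (\<lambda>a. Poly_Mapping.map ((*) a))\<rparr>"

definition linear_extension ::
    "('b \<Rightarrow> ('c \<Rightarrow>\<^sub>0 'r)) \<Rightarrow> ('b \<Rightarrow>\<^sub>0 'r) \<Rightarrow> ('c \<Rightarrow>\<^sub>0 'r::comm_ring_1)" where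
  "linear_extension f x =
    (\<Sum>b\<in>Poly_Mapping.keys x. Poly_Mapping.map ((*) (Poly_Mapping.lookup x b)) (f b))"

definition quotient_module :: "('r, 'm, 'z) module_scheme \<Rightarrow> 'm set \<Rightarrow> ('r, 'm set) module" where
  "quotient_module M N =
    \<lparr>carrier = a_rcosets\<^bsub>M\<^esub> N, monoid.mult = undefined, one = undefined,
     zero = N, add = (<+>\<^bsub>M\<^esub>),
     smult = (\<lambda>a S. \<Union>x\<in>S. N +>\<^bsub>M\<^esub> (a \<odot>\<^bsub>M\<^esub> x))\<rparr>"

text \<open>
  The graded \<open>k[t]\<close>-module \<open>M = \<Oplus>\<^sub>j M\<^sup>j\<close>: a module over \<open>'k poly\<close> together with its
  homogeneous components \<open>grade M j = M\<^sup>j\<close>; \<open>t\<close> is \<open>monom 1 1\<close>.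
\<close>

record ('k, 'm) gmodule = "('k poly, 'm) module" +
  grade :: "int \<Rightarrow> 'm set"

definition graded_submodule :: "('k::zero, 'm) gmodule \<Rightarrow> 'm set \<Rightarrow> ('k, 'm) gmodule" where
  "graded_submodule M S = M\<lparr>carrier := S, grade := (\<lambda>j. grade M j \<inter> S)\<rparr>"

definition graded_quotient :: "('k::zero, 'm) gmodule \<Rightarrow> 'm set \<Rightarrow> ('k, 'm set) gmodule" where
  "graded_quotient M N = module.extend (quotient_module M N)
    (gmodule.fields (\<lambda>j. (\<lambda>x. N +>\<^bsub>M\<^esub> x) ` grade M j))"

definition free_gmodule ::
    "'b set \<Rightarrow> ('b \<Rightarrow> int) \<Rightarrow> ('k::field, 'b \<Rightarrow>\<^sub>0 'k poly) gmodule" where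
  "free_gmodule B deg = module.extend (free_module B)
    (gmodule.fields (\<lambda>j. {x. Poly_Mapping.keys x \<subseteq> B \<and>
       (\<forall>b\<in>Poly_Mapping.keys x. \<exists>c n. Poly_Mapping.lookup x b = monom c n \<and> deg b + int n = j)}))"

definition zero_gmodule :: "'k::field itself \<Rightarrow> ('k, unit) gmodule" where
  "zero_gmodule k =
    \<lparr>carrier = {()}, monoid.mult = undefined, one = undefined, zero = (), add = (\<lambda>_ _. ()),
     smult = (\<lambda>_ _. ()), grade = (\<lambda>_. {()})\<rparr>"

text \<open>
  The Laurent polynomial ring \<open>k[t,t\<^sup>-\<^sup>1]\<close> is the group algebra \<open>int \<Rightarrow>\<^sub>0 'k\<close>, whose product is
  convolution.
\<close>

definition laurent_of_poly :: "'k::field poly \<Rightarrow> (int \<Rightarrow>\<^sub>0 'k)" where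
  "laurent_of_poly p = (\<Sum>i\<le>Polynomial.degree p. Poly_Mapping.single (int i) (coeff p i))"

definition shifted_free :: "'k::field itself \<Rightarrow> int \<Rightarrow> ('k, int \<Rightarrow>\<^sub>0 'k) gmodule" where
  "shifted_free k a =
    \<lparr>carrier = {x. Poly_Mapping.keys x \<subseteq> {a..}}, monoid.mult = undefined, one = undefined,
     zero = 0, add = (+), smult = (\<lambda>p x. laurent_of_poly p * x),
     grade = (\<lambda>j. {x. Poly_Mapping.keys x \<subseteq> {a..} \<inter> {j}})\<rparr>"

text \<open>\<open>t\<^sup>a k[t] / t\<^sup>b k[t]\<close>, for \<open>a \<le> b\<close>\<close>

definition interval_module ::
    "'k::field itself \<Rightarrow> int \<Rightarrow> int \<Rightarrow> ('k, (int \<Rightarrow>\<^sub>0 'k) set) gmodule" where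
  "interval_module k a b = graded_quotient (shifted_free k a) (carrier (shifted_free k b))"

definition eta_morphism ::
    "nat \<Rightarrow> ('k::field, 'm) gmodule \<Rightarrow> ('k, 'n) gmodule \<Rightarrow> ('m \<Rightarrow> 'n) \<Rightarrow> bool" where
  "eta_morphism \<eta> M N f \<longleftrightarrow>
     f \<in> carrier M \<rightarrow> carrier N \<and>
     (\<forall>x\<in>carrier M. \<forall>y\<in>carrier M. f (x \<oplus>\<^bsub>M\<^esub> y) = f x \<oplus>\<^bsub>N\<^esub> f y) \<and>
     (\<forall>p. \<forall>x\<in>carrier M. f (p \<odot>\<^bsub>M\<^esub> x) = p \<odot>\<^bsub>N\<^esub> f x) \<and>
     (\<forall>j. f ` grade M j \<subseteq> grade N (j + int \<eta>))"

definition gmodule_iso :: "('k::field, 'm) gmodule \<Rightarrow> ('k, 'n) gmodule \<Rightarrow> bool" (infix \<open>\<cong>\<^sub>g\<close> 50) where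
  "M \<cong>\<^sub>g N \<longleftrightarrow> (\<exists>f. eta_morphism 0 M N f \<and> bij_betw f (carrier M) (carrier N) \<and>
     (\<forall>j. f ` grade M j = grade N j))"

definition interleaved :: "nat \<Rightarrow> ('k::field, 'm) gmodule \<Rightarrow> ('k, 'n) gmodule \<Rightarrow> bool" where
  "interleaved \<eta> M N \<longleftrightarrow>
     (\<exists>\<phi> \<psi>. eta_morphism \<eta> M N \<phi> \<and> eta_morphism \<eta> N M \<psi> \<and>
        (\<forall>y\<in>carrier N. \<phi> (\<psi> y) = monom 1 (2 * \<eta>) \<odot>\<^bsub>N\<^esub> y) \<and>
        (\<forall>x\<in>carrier M. \<psi> (\<phi> x) = monom 1 (2 * \<eta>) \<odot>\<^bsub>M\<^esub> x))"

text \<open>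
  The graded \<open>k[t]\<close>-module \<open>\<Oplus>\<^sub>j V\<^sub>j\<close> of a sequence of vector spaces \<open>V\<^sub>j\<close> with linear maps
  \<open>\<phi>\<^sub>j : V\<^sub>j \<rightarrow> V\<^sub>j\<^sub>+\<^sub>1\<close>; \<open>t\<close> acts as \<open>t_action \<phi>\<close>.
\<close>

definition t_action :: "(int \<Rightarrow> 'm \<Rightarrow> 'm) \<Rightarrow> (int \<Rightarrow> 'm) \<Rightarrow> (int \<Rightarrow> 'm)" where
  "t_action \<phi> f = (\<lambda>j. \<phi> (j - 1) (f (j - 1)))"

definition persistence_module ::
    "(int \<Rightarrow> ('k::field, 'm) module) \<Rightarrow> (int \<Rightarrow> 'm \<Rightarrow> 'm) \<Rightarrow> ('k, int \<Rightarrow> 'm) gmodule" where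
  "persistence_module V \<phi> =
    (let C = {f. (\<forall>j. f j \<in> carrier (V j)) \<and> finite {j. f j \<noteq> \<zero>\<^bsub>V j\<^esub>}} in
     \<lparr>carrier = C, monoid.mult = undefined, one = undefined,
      zero = (\<lambda>j. \<zero>\<^bsub>V j\<^esub>),
      add = (\<lambda>f g j. f j \<oplus>\<^bsub>V j\<^esub> g j),
      smult = (\<lambda>p f j. \<Oplus>\<^bsub>V j\<^esub>i\<in>{..Polynomial.degree p}. coeff p i \<odot>\<^bsub>V j\<^esub> (t_action \<phi> ^^ i) f j),
      grade = (\<lambda>j. {f \<in> C. \<forall>i. i \<noteq> j \<longrightarrow> f i = \<zero>\<^bsub>V i\<^esub>})\<rparr>)"

section \<open>Simplicial homology\<close>

definition simplicial_complex :: "'v set set \<Rightarrow> bool" where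
  "simplicial_complex K \<longleftrightarrow>
     (\<forall>\<sigma>\<in>K. finite \<sigma> \<and> \<sigma> \<noteq> {} \<and> (\<forall>\<tau>. \<tau> \<subseteq> \<sigma> \<and> \<tau> \<noteq> {} \<longrightarrow> \<tau> \<in> K))"

definition delete_nth :: "nat \<Rightarrow> 'v::linorder set \<Rightarrow> 'v set" where
  "delete_nth k \<sigma> = \<sigma> - {sorted_list_of_set \<sigma> ! k}"

text \<open>There is no empty simplex, so the boundary of a vertex is 0 (no augmentation).\<close>

definition simplex_boundary :: "'v::linorder set \<Rightarrow> ('v set \<Rightarrow>\<^sub>0 'k::field)" where
  "simplex_boundary \<sigma> =
     (if card \<sigma> \<le> 1 then 0
      else \<Sum>k<card \<sigma>. Poly_Mapping.single (delete_nth k \<sigma>) ((- 1) ^ k))"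

definition chains :: "nat \<Rightarrow> 'v::linorder set set \<Rightarrow> ('v set \<Rightarrow>\<^sub>0 'k::field) set" where
  "chains q K = {c. Poly_Mapping.keys c \<subseteq> {\<sigma> \<in> K. card \<sigma> = q + 1}}"

definition cycles :: "nat \<Rightarrow> 'v::linorder set set \<Rightarrow> ('v set \<Rightarrow>\<^sub>0 'k::field) set" where
  "cycles q K = {c \<in> chains q K. linear_extension simplex_boundary c = 0}"

definition boundaries :: "nat \<Rightarrow> 'v::linorder set set \<Rightarrow> ('v set \<Rightarrow>\<^sub>0 'k::field) set" where
  "boundaries q K = linear_extension simplex_boundary ` chains (q + 1) K"

definition homology_space ::
    "nat \<Rightarrow> 'v::linorder set set \<Rightarrow> ('k::field, ('v set \<Rightarrow>\<^sub>0 'k) set) module" where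
  "homology_space q K = quotient_module ((free_module UNIV)\<lparr>carrier := cycles q K\<rparr>) (boundaries q K)"

text \<open>The map \<open>H\<^sub>q(K) \<rightarrow> H\<^sub>q(L)\<close> induced by \<open>K \<subseteq> L\<close>, for any \<open>K\<close>, on homology classes as cosets.\<close>

definition induced_map ::
    "nat \<Rightarrow> 'v::linorder set set \<Rightarrow> ('v set \<Rightarrow>\<^sub>0 'k::field) set \<Rightarrow> ('v set \<Rightarrow>\<^sub>0 'k) set" where
  "induced_map q L S = {b + z | b z. b \<in> boundaries q L \<and> z \<in> S}"

section \<open>Filtered complexes, persistent homology, covers\<close>

text \<open>
  A filtered complex is given by \<open>j \<mapsto> X\<^sup>j\<close>; the complex itself is the union \<open>total X\<close>.
\<close>

definition total :: "(int \<Rightarrow> 'v set set) \<Rightarrow> 'v set set" where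
  "total X = (\<Union>j. X j)"

definition filtered_complex :: "(int \<Rightarrow> 'v set set) \<Rightarrow> bool" where
  "filtered_complex X \<longleftrightarrow> (\<forall>j. simplicial_complex (X j)) \<and> mono X \<and> (\<Inter>j. X j) = {}"

definition persistent_homology ::
    "'k::field itself \<Rightarrow> nat \<Rightarrow> (int \<Rightarrow> 'v::linorder set set) \<Rightarrow>
      ('k, int \<Rightarrow> ('v set \<Rightarrow>\<^sub>0 'k) set) gmodule" where
  "persistent_homology k q X =
     persistence_module (\<lambda>j. homology_space q (X j)) (\<lambda>j. induced_map q (X (j + 1)))"

definition filtered_cover ::
    "(int \<Rightarrow> 'v set set) \<Rightarrow> 'i set \<Rightarrow> ('i \<Rightarrow> int \<Rightarrow> 'v set set) \<Rightarrow> bool" where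
  "filtered_cover X \<Lambda> U \<longleftrightarrow>
     filtered_complex X \<and> (\<forall>i\<in>\<Lambda>. filtered_complex (U i)) \<and> (\<forall>j. X j = (\<Union>i\<in>\<Lambda>. U i j))"

definition cover_inter :: "('i \<Rightarrow> int \<Rightarrow> 'v set set) \<Rightarrow> 'i set \<Rightarrow> int \<Rightarrow> 'v set set" where
  "cover_inter U I = (\<lambda>j. \<Inter>i\<in>I. U i j)"

definition acyclic_cover ::
    "'k::field itself \<Rightarrow> nat \<Rightarrow> (int \<Rightarrow> 'v::linorder set set) \<Rightarrow> 'i set \<Rightarrow>
      ('i \<Rightarrow> int \<Rightarrow> 'v set set) \<Rightarrow> bool" where
  "acyclic_cover k \<epsilon> X \<Lambda> U \<longleftrightarrow>
     filtered_cover X \<Lambda> U \<and>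
     (\<forall>I. I \<subseteq> \<Lambda> \<and> finite I \<and> I \<noteq> {} \<and> total (cover_inter U I) \<noteq> {} \<longrightarrow>
        (\<exists>a. interleaved \<epsilon> (persistent_homology k 0 (cover_inter U I)) (shifted_free k a)) \<and>
        (\<forall>q>0. interleaved \<epsilon> (persistent_homology k q (cover_inter U I)) (zero_gmodule k)))"

section \<open>The Mayer-Vietoris spectral sequence\<close>

definition mv_basis ::
    "'i set \<Rightarrow> ('i \<Rightarrow> int \<Rightarrow> 'v set set) \<Rightarrow> int \<Rightarrow> int \<Rightarrow> ('v set \<times> 'i set) set" where
  "mv_basis \<Lambda> U p q =
     {(\<sigma>, I). 0 \<le> p \<and> 0 \<le> q \<and> I \<subseteq> \<Lambda> \<and> int (card I) = p + 1 \<and>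
        \<sigma> \<in> total (cover_inter U I) \<and> int (card \<sigma>) = q + 1}"

definition mv_degree :: "('i \<Rightarrow> int \<Rightarrow> 'v set set) \<Rightarrow> 'v set \<times> 'i set \<Rightarrow> int" where
  "mv_degree U = (\<lambda>(\<sigma>, I). LEAST j. \<sigma> \<in> cover_inter U I j)"

definition mv_complex ::
    "'k::field itself \<Rightarrow> 'i set \<Rightarrow> ('i \<Rightarrow> int \<Rightarrow> 'v set set) \<Rightarrow>
      ('k, 'v set \<times> 'i set \<Rightarrow>\<^sub>0 'k poly) gmodule" where
  "mv_complex k \<Lambda> U = free_gmodule (\<Union>p q. mv_basis \<Lambda> U p q) (mv_degree U)"

definition mv_d0 ::
    "('i \<Rightarrow> int \<Rightarrow> 'v::linorder set set) \<Rightarrow> 'v set \<times> 'i set \<Rightarrow>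
      ('v set \<times> 'i set \<Rightarrow>\<^sub>0 'k::field poly)" where
  "mv_d0 U = (\<lambda>(\<sigma>, I).
     if card \<sigma> \<le> 1 then 0
     else \<Sum>k<card \<sigma>. Poly_Mapping.single (delete_nth k \<sigma>, I)
       (monom ((- 1) ^ k) (nat (mv_degree U (\<sigma>, I) - mv_degree U (delete_nth k \<sigma>, I)))))"

definition mv_d1 ::
    "('i::linorder \<Rightarrow> int \<Rightarrow> 'v set set) \<Rightarrow> 'v set \<times> 'i set \<Rightarrow>
      ('v set \<times> 'i set \<Rightarrow>\<^sub>0 'k::field poly)" where
  "mv_d1 U = (\<lambda>(\<sigma>, I).
     if card I \<le> 1 then 0
     else \<Sum>l<card I. Poly_Mapping.single (\<sigma>, delete_nth l I)
       (monom ((- 1) ^ l) (nat (mv_degree U (\<sigma>, I) - mv_degree U (\<sigma>, delete_nth l I)))))"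

text \<open>The differential \<open>(-1)\<^sup>p \<partial>\<^sup>0 + \<partial>\<^sup>1\<close> of the total complex, with \<open>p = |I| - 1\<close>\<close>

definition mv_differential ::
    "('i::linorder \<Rightarrow> int \<Rightarrow> 'v::linorder set set) \<Rightarrow>
      ('v set \<times> 'i set \<Rightarrow>\<^sub>0 'k::field poly) \<Rightarrow> ('v set \<times> 'i set \<Rightarrow>\<^sub>0 'k poly)" where
  "mv_differential U = linear_extension
     (\<lambda>(\<sigma>, I). Poly_Mapping.map ((*) ((- 1) ^ (card I - 1))) (mv_d0 U (\<sigma>, I)) + mv_d1 U (\<sigma>, I))"

text \<open>\<open>F\<^sub>p T\<^sub>n = \<Oplus>\<^sub>i\<^sub>\<le>\<^sub>p E\<^sup>0\<^sub>i\<^sub>,\<^sub>n\<^sub>-\<^sub>i\<close>\<close>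

definition mv_filt ::
    "'i set \<Rightarrow> ('i \<Rightarrow> int \<Rightarrow> 'v set set) \<Rightarrow> int \<Rightarrow> int \<Rightarrow> ('v set \<times> 'i set \<Rightarrow>\<^sub>0 'k::field poly) set" where
  "mv_filt \<Lambda> U p n = {x. Poly_Mapping.keys x \<subseteq> (\<Union>i\<in>{..p}. mv_basis \<Lambda> U i (n - i))}"

text \<open>
  The pages of the spectral sequence of the filtered total complex \<open>(T, d)\<close>:
  \<open>E\<^sup>r\<^sub>p\<^sub>,\<^sub>q = Z\<^sup>r\<^sub>p\<^sub>,\<^sub>q / (Z\<^sup>r\<^sup>-\<^sup>1\<^sub>p\<^sub>-\<^sub>1\<^sub>,\<^sub>q\<^sub>+\<^sub>1 + d Z\<^sup>r\<^sup>-\<^sup>1\<^sub>p\<^sub>+\<^sub>r\<^sub>-\<^sub>1\<^sub>,\<^sub>q\<^sub>-\<^sub>r\<^sub>+\<^sub>2)\<close> with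
  \<open>Z\<^sup>r\<^sub>p\<^sub>,\<^sub>q = {x \<in> F\<^sub>p T\<^sub>p\<^sub>+\<^sub>q. d x \<in> F\<^sub>p\<^sub>-\<^sub>r T\<^sub>p\<^sub>+\<^sub>q\<^sub>-\<^sub>1}\<close>; the differential of a page is induced by \<open>d\<close>.
\<close>

definition mv_Z ::
    "'i::linorder set \<Rightarrow> ('i \<Rightarrow> int \<Rightarrow> 'v::linorder set set) \<Rightarrow> int \<Rightarrow> int \<Rightarrow> int \<Rightarrow>
      ('v set \<times> 'i set \<Rightarrow>\<^sub>0 'k::field poly) set" where
  "mv_Z \<Lambda> U r p q =
     {x \<in> mv_filt \<Lambda> U p (p + q). mv_differential U x \<in> mv_filt \<Lambda> U (p - r) (p + q - 1)}"

definition mv_B ::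
    "'i::linorder set \<Rightarrow> ('i \<Rightarrow> int \<Rightarrow> 'v::linorder set set) \<Rightarrow> int \<Rightarrow> int \<Rightarrow> int \<Rightarrow>
      ('v set \<times> 'i set \<Rightarrow>\<^sub>0 'k::field poly) set" where
  "mv_B \<Lambda> U r p q =
     {x + mv_differential U y | x y.
        x \<in> mv_Z \<Lambda> U (r - 1) (p - 1) (q + 1) \<and> y \<in> mv_Z \<Lambda> U (r - 1) (p + r - 1) (q - r + 2)}"

definition mv_page ::
    "'k::field itself \<Rightarrow> 'i::linorder set \<Rightarrow> ('i \<Rightarrow> int \<Rightarrow> 'v::linorder set set) \<Rightarrow>
      nat \<Rightarrow> int \<Rightarrow> int \<Rightarrow> ('k, ('v set \<times> 'i set \<Rightarrow>\<^sub>0 'k poly) set) gmodule" where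
  "mv_page k \<Lambda> U r p q =
     graded_quotient (graded_submodule (mv_complex k \<Lambda> U) (mv_Z \<Lambda> U (int r) p q))
       (mv_B \<Lambda> U (int r) p q)"

definition mv_limit ::
    "'k::field itself \<Rightarrow> 'i::linorder set \<Rightarrow> ('i \<Rightarrow> int \<Rightarrow> 'v::linorder set set) \<Rightarrow>
      int \<Rightarrow> int \<Rightarrow> ('k, ('v set \<times> 'i set \<Rightarrow>\<^sub>0 'k poly) set) gmodule" where
  "mv_limit k \<Lambda> U p q = (THE E. \<exists>r\<^sub>0. \<forall>r\<ge>r\<^sub>0. mv_page k \<Lambda> U r p q = E)"

text \<open>The double complex is in the first quadrant, so the limit exists.\<close>

lemma mv_filt_neg: "p < 0 \<Longrightarrow> mv_filt \<Lambda> U p n = {0}"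
proof -
  assume "p < 0"
  then have "(\<Union>i\<in>{..p}. mv_basis \<Lambda> U i (n - i)) = {}"
    by (auto simp: mv_basis_def)
  then show ?thesis by (auto simp: mv_filt_def)
qed

lemma mv_filt_top:
  assumes "n \<le> p" shows "mv_filt \<Lambda> U p n = mv_filt \<Lambda> U n n"
proof -
  have "(\<Union>i\<in>{..p}. mv_basis \<Lambda> U i (n - i)) = (\<Union>i\<in>{..n}. mv_basis \<Lambda> U i (n - i))"
    using assms by (auto simp: mv_basis_def)
  then show ?thesis by (simp only: mv_filt_def)
qed

lemma mv_Z_stable:
  assumes "p < s" "p < s'"
  shows "mv_Z \<Lambda> U s p q = mv_Z \<Lambda> U s' p q"
  using assms by (simp add: mv_Z_def mv_filt_neg)

lemma mv_Z_stable_top: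
  assumes "q + 2 \<le> s"
  shows "mv_Z \<Lambda> U (s - 1) (p + s - 1) (q - s + 2)
    = {x \<in> mv_filt \<Lambda> U (p + q + 1) (p + q + 1). mv_differential U x \<in> mv_filt \<Lambda> U p (p + q)}"
proof -
  have "(p + s - 1) + (q - s + 2) = p + q + 1" "p + q + 1 - 1 = p + q" "p + s - 1 - (s - 1) = p"
    by simp_all
  then show ?thesis
    using assms by (simp only: mv_Z_def) (subst mv_filt_top[of "p + q + 1" "p + s - 1"], simp_all)
qed

lemma mv_B_stable:
  assumes "0 \<le> p" "q + 2 \<le> s" "p < s" "q + 2 \<le> s'" "p < s'"
  shows "mv_B \<Lambda> U s p q = mv_B \<Lambda> U s' p q"
  unfolding mv_B_def mv_Z_stable_top[OF assms(2)] mv_Z_stable_top[OF assms(4)]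
  by (subst mv_Z_stable[of "p - 1" "s - 1" "s' - 1"]) (use assms in simp_all)

lemma mv_page_stable:
  assumes "0 \<le> p" "0 \<le> q" "p + q + 2 \<le> int r"
  shows "mv_page k \<Lambda> U r p q = mv_page k \<Lambda> U (nat (p + q + 2)) p q"
  unfolding mv_page_def
  by (subst mv_Z_stable[of p "int r" "p + q + 2"], use assms in simp, use assms in simp,
      subst mv_B_stable[of p q "int r" "p + q + 2"]) (use assms in simp_all)

lemma mv_limit_eq:
  assumes "0 \<le> p" "0 \<le> q" "p + q + 2 \<le> int r"
  shows "mv_limit k \<Lambda> U p q = mv_page k \<Lambda> U r p q"
  unfolding mv_limit_def
proof (rule the_equality)
  show "\<exists>r\<^sub>0. \<forall>r'\<ge>r\<^sub>0. mv_page k \<Lambda> U r' p q = mv_page k \<Lambda> U r p q"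
  proof (intro exI allI impI)
    fix r' assume "r \<le> r'"
    then show "mv_page k \<Lambda> U r' p q = mv_page k \<Lambda> U r p q"
      using assms mv_page_stable[of p q r k \<Lambda> U] mv_page_stable[of p q r' k \<Lambda> U] by simp
  qed
next
  fix E assume "\<exists>r\<^sub>0. \<forall>r\<ge>r\<^sub>0. mv_page k \<Lambda> U r p q = E"
  then obtain r0 where "\<forall>r\<ge>r0. mv_page k \<Lambda> U r p q = E" by blast
  then have "mv_page k \<Lambda> U (max r0 r) p q = E" by simp
  then show "E = mv_page k \<Lambda> U r p q"
    using assms mv_page_stable[of p q r k \<Lambda> U] mv_page_stable[of p q "max r0 r" k \<Lambda> U] by simp
qed

section \<open>The example\<close>

definition full_subcomplex :: "'v set set \<Rightarrow> 'v set \<Rightarrow> 'v set set" where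
  "full_subcomplex K S = {\<sigma> \<in> K. \<sigma> \<subseteq> S}"

definition ex_X :: "nat \<Rightarrow> nat set set" where
  "ex_X D = {\<sigma>. \<sigma> \<noteq> {} \<and> \<sigma> \<subseteq> {0..D + 3} \<and> \<not> {1..D + 1} \<subseteq> \<sigma> \<and> \<not> {D + 2, D + 3} \<subseteq> \<sigma>}"

definition ex_U :: "nat \<Rightarrow> nat \<Rightarrow> nat set set" where
  "ex_U D i = full_subcomplex (ex_X D)
     (if i = 0 then {0..D + 1} \<union> {D + 3} else {0..D + 2} - {i})"

definition ex_A :: "nat \<Rightarrow> nat set set" where
  "ex_A D = {\<sigma> \<in> ex_X D. 0 \<notin> \<sigma>}"

definition ex_X_filt :: "nat \<Rightarrow> int \<Rightarrow> nat set set" where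
  "ex_X_filt D m =
     (if m < - 2 * int D then {}
      else if m < 0 then ex_A D
      else if m < 2 * int D + 2 then ex_A D \<union> (\<Union>i\<in>{0..nat (m div 2)}. ex_U D i)
      else ex_X D)"

text \<open>The description \<open>A \<union> U\<^sub>0 \<union> \<dots> \<union> U\<^sub>j\<close> also applies to \<open>j = D + 1\<close>.\<close>

lemma ex_X_filt_even_odd:
  assumes "j \<le> D + 1" "m \<in> {2 * int j, 2 * int j + 1}"
  shows "ex_X_filt D m = ex_A D \<union> (\<Union>i\<in>{0..j}. ex_U D i)"
proof (cases "j = D + 1")
  case False
  have "nat (m div 2) = j" "m < 2 * int D + 2" "\<not> m < 0" using assms False by auto
  then show ?thesis by (auto simp: ex_X_filt_def)
next
  case True
  have "\<sigma> \<in> (\<Union>i\<in>{0..D + 1}. ex_U D i)" if s: "\<sigma> \<in> ex_X D" for \<sigma>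
  proof (cases "D + 3 \<in> \<sigma>")
    case d3: True
    have "x \<in> {0..D + 1} \<union> {D + 3}" if "x \<in> \<sigma>" for x
    proof -
      have "x \<noteq> D + 2" "x \<le> D + 3" using s d3 that by (auto simp: ex_X_def)
      then show ?thesis by auto
    qed
    then have "\<sigma> \<subseteq> {0..D + 1} \<union> {D + 3}" by (rule subsetI)
    then have "\<sigma> \<in> ex_U D 0" using s by (simp add: ex_U_def full_subcomplex_def)
    then show ?thesis by auto
  next
    case d3: False
    have "\<not> {1..D + 1} \<subseteq> \<sigma>" using s by (simp add: ex_X_def)
    then obtain i where i: "i \<in> {1..D + 1}" "i \<notin> \<sigma>" by blast
    have "x \<in> {0..D + 2} - {i}" if "x \<in> \<sigma>" for x
    proof -
      have "x \<noteq> D + 3" "x \<le> D + 3" using s d3 that by (auto simp: ex_X_def)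
      then show ?thesis using i that by auto
    qed
    then have "\<sigma> \<subseteq> {0..D + 2} - {i}" by (rule subsetI)
    then have "\<sigma> \<in> ex_U D i" using s i by (simp add: ex_U_def full_subcomplex_def)
    then show ?thesis using i by auto
  qed
  then have "ex_X D = ex_A D \<union> (\<Union>i\<in>{0..D + 1}. ex_U D i)"
    by (auto simp: ex_A_def ex_U_def full_subcomplex_def)
  then show ?thesis using assms True by (auto simp: ex_X_filt_def)
qed

definition ex_U_filt :: "nat \<Rightarrow> nat \<Rightarrow> int \<Rightarrow> nat set set" where
  "ex_U_filt D i m = ex_U D i \<inter> ex_X_filt D m"

end

theory Submission
  imports Defs
begin

text \<open>
  The complex \<open>X\<close> is a cone with apex \<open>0\<close> over the sphere \<open>A\<close> of dimension \<open>D\<close>, which is the suspension of the boundary of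
  the simplex \<open>{1..D + 1}\<close> with suspension points \<open>D + 2\<close> and \<open>D + 3\<close>. The filtration adds the cone over the half with
  \<open>D + 3\<close> in degree 0 and then the cones over the \<open>D + 1\<close> facets with \<open>D + 2\<close> one by one, in steps of 2. The sphere dies
  only with the last facet, in degree \<open>2 * D + 2\<close>. To see this, one follows the coefficient of a cycle at the last facet
  \<open>ex_facet D (D + 1)\<close>: it vanishes on boundaries before that degree (\<open>ex_boundary_lookup_facet\<close>), and a cycle on which
  it vanishes is a boundary (\<open>ex_cycle_is_boundary\<close>). This determines \<open>H\<^sub>D(X)\<close> (\<open>ex_persistent_homology\<close>).

  Each intersection \<open>U\<^sub>I\<close> has a vertex from which every simplex can be coned off at most two degrees after its birth
  (\<open>ex_apex\<close>); the cone operator then yields the interleavings with a free module and with 0 (\<open>cone_off\<close>,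
  \<open>acyclic_by_cone\<close>).

  The spectral sequence forgets the class earlier. As \<open>E\<^sup>\<infinity>\<close> in position \<open>(D, 0)\<close> is the homology of the total complex
  modulo lower filtration, only the components of a cycle at vertices of \<open>(D + 1)\<close>-fold intersections matter. One of these
  intersections, \<open>U\<^sub>1 \<inter> \<dots> \<inter> U\<^bsub>D + 1\<^esub>\<close>, consists of \<open>D + 2\<close>, born in degree \<open>- 2 * D\<close>, of \<open>0\<close>, born in degree 0, and of
  the edge between them, born in degree 2. The coefficient at \<open>D + 2\<close> is thus defined modulo \<open>t\<^bsup>2D + 2\<^esup>\<close>
  (\<open>ex_coefficient_boundary\<close>), and it determines the class (\<open>ex_kernel\<close>): the other components can be removed by boundaries,
  using the augmentation of the columns. That it takes all values is shown by a cycle in degree \<open>- 2 * D\<close>, obtained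
  from a combinatorial duality between index sets and simplices (\<open>dual_chain_cycle\<close>, \<open>ex_generator\<close>). Hence \<open>E\<^sup>\<infinity>\<close> is an
  interval module that ends in degree 2 (\<open>ex_limit_page\<close>).

  Both modules begin in the same degree, and their ends differ by \<open>2 * D\<close>. Multiplication by \<open>t\<^bsup>2D\<^esup>\<close> interleaves them,
  and for smaller \<open>\<eta>\<close> some element of the longer interval would have to survive a detour through degrees in which the
  shorter one has ended (\<open>interval_modules_not_interleaved\<close>).
\<close>

abbreviation (input) lookup :: "('b \<Rightarrow>\<^sub>0 'r::zero) \<Rightarrow> 'b \<Rightarrow> 'r" where "lookup \<equiv> Poly_Mapping.lookup"
abbreviation (input) keys :: "('b \<Rightarrow>\<^sub>0 'r::zero) \<Rightarrow> 'b set" where "keys \<equiv> Poly_Mapping.keys"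
abbreviation (input) single :: "'b \<Rightarrow> 'r \<Rightarrow> ('b \<Rightarrow>\<^sub>0 'r::zero)" where "single \<equiv> Poly_Mapping.single"

section \<open>Signs and linear extension\<close>

text \<open>For \<open>v \<in> S\<close> this is the sign of the face \<open>S - {v}\<close> in the boundary of \<open>S\<close>; for \<open>v \<notin> S\<close> it is the sign
  that moves \<open>v\<close> to its place in \<open>insert v S\<close>. Using one function for both makes the sign rules of
  faces and of cones instances of the two lemmas on inserting and removing a vertex.\<close>

definition position_sign :: "'a::linorder \<Rightarrow> 'a set \<Rightarrow> 'r::comm_ring_1" where
  "position_sign v S = (- 1) ^ card {u \<in> S. u < v}"

lemma position_sign_square [simp]: "position_sign v S * position_sign v S = (1 :: 'r::comm_ring_1)"
  by (simp add: position_sign_def flip: power_mult_distrib)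

lemma position_sign_insert:
  assumes "finite S" "v \<notin> S"
  shows "position_sign u (insert v S) =
    (if v < u then - position_sign u S else (position_sign u S :: 'r::comm_ring_1))"
proof -
  have "{x \<in> insert v S. x < u} = (if v < u then insert v {x \<in> S. x < u} else {x \<in> S. x < u})"
    by auto
  then show ?thesis using assms by (simp add: position_sign_def)
qed

lemma position_sign_remove:
  assumes "finite S" "v \<in> S"
  shows "position_sign u (S - {v}) =
    (if v < u then - position_sign u S else (position_sign u S :: 'r::comm_ring_1))"
proof -
  have "insert v (S - {v}) = S" using assms by auto
  then show ?thesis using position_sign_insert[of "S - {v}" v u, where 'r = 'r] assms(1) by auto
qed

lemma sum_delete_nth:
  fixes f :: "nat \<Rightarrow> 'a::linorder set \<Rightarrow> 'b::comm_monoid_add"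
  assumes "finite S"
  shows "(\<Sum>k<card S. f k (delete_nth k S)) = (\<Sum>v\<in>S. f (card {u \<in> S. u < v}) (S - {v}))"
proof -
  let ?xs = "sorted_list_of_set S"
  have xs: "set ?xs = S" "distinct ?xs" "sorted ?xs" "length ?xs = card S"
    using assms by simp_all
  have bij: "bij_betw (\<lambda>k. ?xs ! k) {..<card S} S"
    using bij_betw_nth[OF xs(2)] xs by auto
  have pos: "card {u \<in> S. u < ?xs ! k} = k" if "k < card S" for k
  proof -
    have "{u \<in> S. u < ?xs ! k} = (\<lambda>i. ?xs ! i) ` {..<k}"
    proof (intro equalityI subsetI)
      fix u assume u: "u \<in> {u \<in> S. u < ?xs ! k}"
      then obtain i where i: "i < card S" "u = ?xs ! i"
        by (metis (mono_tags, lifting) in_set_conv_nth mem_Collect_eq xs(1,4))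
      have "\<not> k \<le> i" using u i sorted_nth_mono[OF xs(3), of k i] xs(4) by auto
      then show "u \<in> (\<lambda>i. ?xs ! i) ` {..<k}" using i by auto
    next
      fix u assume "u \<in> (\<lambda>i. ?xs ! i) ` {..<k}"
      then obtain i where i: "i < k" "u = ?xs ! i" by auto
      have "?xs ! i \<le> ?xs ! k" using sorted_nth_mono[OF xs(3), of i k] i that xs(4) by auto
      moreover have "?xs ! i \<noteq> ?xs ! k" using nth_eq_iff_index_eq[OF xs(2)] i that xs(4) by auto
      moreover have "?xs ! i \<in> S" using i that xs by (metis nth_mem order_less_trans)
      ultimately show "u \<in> {u \<in> S. u < ?xs ! k}" using i by auto
    qed
    moreover have "inj_on (\<lambda>i. ?xs ! i) {..<k}"
      using bij_betw_imp_inj_on[OF bij] by (rule inj_on_subset) (use that in auto)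
    ultimately show ?thesis by (simp add: card_image)
  qed
  have "(\<Sum>k<card S. f k (delete_nth k S)) =
      (\<Sum>k<card S. f (card {u \<in> S. u < ?xs ! k}) (S - {?xs ! k}))"
    by (rule sum.cong) (simp_all add: delete_nth_def pos)
  also have "\<dots> = (\<Sum>v\<in>S. f (card {u \<in> S. u < v}) (S - {v}))"
    using sum.reindex_bij_betw[OF bij, of "\<lambda>v. f (card {u \<in> S. u < v}) (S - {v})"] .
  finally show ?thesis .
qed

text \<open>The source of every \<open>\<partial>\<partial> = 0\<close> below. Pairing the terms with \<open>u < v\<close> and \<open>v < u\<close>, instead of showing that
  the sum equals its negative, keeps the argument valid in characteristic 2.\<close>

lemma sum_antisymmetric:
  fixes f :: "'a::linorder \<Rightarrow> 'a \<Rightarrow> 'b::ab_group_add"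
  assumes "finite S" and "\<And>u v. u \<in> S \<Longrightarrow> v \<in> S \<Longrightarrow> u < v \<Longrightarrow> f v u = - f u v"
  shows "(\<Sum>u\<in>S. \<Sum>v\<in>S - {u}. f u v) = 0"
proof -
  have "(\<Sum>u\<in>S. \<Sum>v\<in>S - {u}. f u v) =
      (\<Sum>u\<in>S. (\<Sum>v\<in>{v \<in> S. u < v}. f u v) + (\<Sum>v\<in>{v \<in> S. v < u}. f u v))"
  proof (rule sum.cong[OF refl])
    fix u assume "u \<in> S"
    have "S - {u} = {v \<in> S. u < v} \<union> {v \<in> S. v < u}" by auto
    moreover have "{v \<in> S. u < v} \<inter> {v \<in> S. v < u} = {}" by auto
    ultimately show "(\<Sum>v\<in>S - {u}. f u v) =
        (\<Sum>v\<in>{v \<in> S. u < v}. f u v) + (\<Sum>v\<in>{v \<in> S. v < u}. f u v)"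
      using assms(1) sum.union_disjoint[of "{v \<in> S. u < v}" "{v \<in> S. v < u}" "f u"] by simp
  qed
  also have "\<dots> = (\<Sum>u\<in>S. \<Sum>v\<in>{v \<in> S. u < v}. f u v) + (\<Sum>u\<in>S. \<Sum>v\<in>{v \<in> S. v < u}. f u v)"
    by (rule sum.distrib)
  also have "(\<Sum>u\<in>S. \<Sum>v\<in>{v \<in> S. v < u}. f u v) = (\<Sum>v\<in>S. \<Sum>u\<in>{u \<in> S. v < u}. f u v)"
    by (rule sum.swap_restrict) (use assms(1) in auto)
  also have "\<dots> = (\<Sum>v\<in>S. \<Sum>u\<in>{u \<in> S. v < u}. - f v u)"
    by (intro sum.cong refl) (use assms(2) in auto)
  finally show ?thesis by (simp add: sum_negf)
qed

definition scale :: "'r::comm_ring_1 \<Rightarrow> ('b \<Rightarrow>\<^sub>0 'r) \<Rightarrow> ('b \<Rightarrow>\<^sub>0 'r)" where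
  "scale a x = Poly_Mapping.map ((*) a) x"

lemma lookup_scale [simp]: "lookup (scale a x) b = a * lookup x b"
  by (simp add: scale_def Poly_Mapping.map.rep_eq when_def)

lemma scale_zero_right [simp]: "scale a 0 = 0"
  and scale_zero_left [simp]: "scale 0 x = 0"
  and scale_one [simp]: "scale 1 x = x"
  and scale_scale [simp]: "scale a (scale b x) = scale (a * b) x"
  and scale_minus_right [simp]: "scale a (- x) = - scale a x"
  and scale_minus_left [simp]: "scale (- a) x = - scale a x"
  and scale_single [simp]: "scale a (single k c) = single k (a * c)"
  by (auto intro!: poly_mapping_eqI simp: mult.assoc lookup_single when_def)

lemma scale_add: "scale a (x + y) = scale a x + scale a y"
  by (rule poly_mapping_eqI) (simp add: lookup_add algebra_simps)

lemma scale_diff: "scale a (x - y) = scale a x - scale a y"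
  by (rule poly_mapping_eqI) (simp add: lookup_minus algebra_simps)

lemma scale_add_left: "scale (a + b) x = scale a x + scale b x"
  by (rule poly_mapping_eqI) (simp add: lookup_add algebra_simps)

lemma scale_diff_left: "scale (a - b) x = scale a x - scale b x"
  by (rule poly_mapping_eqI) (simp add: lookup_minus algebra_simps)

lemma scale_sum: "scale a (\<Sum>i\<in>S. f i) = (\<Sum>i\<in>S. scale a (f i))"
  by (induction S rule: infinite_finite_induct) (simp_all add: scale_add)

lemma scale_sum_scalars: "scale (\<Sum>i\<in>S. a i) x = (\<Sum>i\<in>S. scale (a i) x)"
  by (induction S rule: infinite_finite_induct) (simp_all add: scale_add_left)

lemma keys_scale_subset: "keys (scale a x) \<subseteq> keys x"
  by (auto simp: in_keys_iff)

lemma keys_scale_le: "keys x \<subseteq> B \<Longrightarrow> keys (scale a x) \<subseteq> B"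
  by (rule order_trans[OF keys_scale_subset])

lemma keys_sum_le: "(\<And>i. i \<in> S \<Longrightarrow> keys (f i) \<subseteq> B) \<Longrightarrow> keys (\<Sum>i\<in>S. f i) \<subseteq> B"
  by (induction S rule: infinite_finite_induct) (auto dest!: subsetD[OF Poly_Mapping.keys_add])

lemma keys_diff_le:
  "keys x \<subseteq> B \<Longrightarrow> keys y \<subseteq> B \<Longrightarrow> keys (x - y) \<subseteq> B"
  using Poly_Mapping.keys_diff[of x y] by blast

lemma keys_add_le:
  "keys x \<subseteq> B \<Longrightarrow> keys y \<subseteq> B \<Longrightarrow> keys (x + y) \<subseteq> B"
  using Poly_Mapping.keys_add[of x y] by blast

lemma linear_extension_eq:
  "linear_extension f x = (\<Sum>b\<in>keys x. scale (lookup x b) (f b))"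
  by (simp add: linear_extension_def scale_def)

lemma linear_extension_superset:
  assumes "finite B" "keys x \<subseteq> B"
  shows "linear_extension f x = (\<Sum>b\<in>B. scale (lookup x b) (f b))"
  unfolding linear_extension_eq
  by (rule sum.mono_neutral_left) (use assms in \<open>auto simp: in_keys_iff\<close>)

lemma linear_extension_zero [simp]: "linear_extension f 0 = 0"
  by (simp add: linear_extension_eq)

lemma linear_extension_single [simp]:
  "linear_extension f (single b a) = scale a (f b)"
  by (subst linear_extension_superset[of "{b}"]) auto

lemma linear_extension_add: "linear_extension f (x + y) = linear_extension f x + linear_extension f y"
proof -
  let ?B = "keys x \<union> keys y"
  have "keys (x + y) \<subseteq> ?B" by (rule Poly_Mapping.keys_add)
  then show ?thesis
    by (simp add: linear_extension_superset[of ?B] lookup_add scale_add_left sum.distrib)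
qed

lemma linear_extension_scale: "linear_extension f (scale a x) = scale a (linear_extension f x)"
  by (simp add: linear_extension_superset[of "keys x"] keys_scale_subset scale_sum)

lemma linear_extension_uminus: "linear_extension f (- x) = - linear_extension f x"
  using linear_extension_scale[of f "- 1" x] by simp

lemma linear_extension_diff: "linear_extension f (x - y) = linear_extension f x - linear_extension f y"
  using linear_extension_add[of f x "- y"] by (simp add: linear_extension_uminus)

lemma linear_extension_sum: "linear_extension f (\<Sum>i\<in>S. x i) = (\<Sum>i\<in>S. linear_extension f (x i))"
  by (induction S rule: infinite_finite_induct) (simp_all add: linear_extension_add)

lemma linear_extension_cong:
  "(\<And>b. b \<in> keys x \<Longrightarrow> f b = g b) \<Longrightarrow> linear_extension f x = linear_extension g x"
  by (simp add: linear_extension_eq)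

lemma linear_extension_compose:
  "linear_extension g (linear_extension f x) = linear_extension (\<lambda>b. linear_extension g (f b)) x"
  by (simp add: linear_extension_eq[of _ x] linear_extension_sum linear_extension_scale)

lemma linear_extension_fun_add:
  "linear_extension (\<lambda>b. f b + g b) x = linear_extension f x + linear_extension g x"
  by (simp add: linear_extension_eq scale_add sum.distrib)

lemma linear_extension_fun_diff:
  "linear_extension (\<lambda>b. f b - g b) x = linear_extension f x - linear_extension g x"
  by (simp add: linear_extension_eq scale_diff sum_subtractf)

lemma linear_extension_eq_0:
  "(\<And>b. b \<in> keys x \<Longrightarrow> f b = 0) \<Longrightarrow> linear_extension f x = 0"
  by (simp add: linear_extension_eq)

lemma linear_extension_basis: "linear_extension (\<lambda>b. single b 1) x = x"
proof (rule poly_mapping_eqI)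
  fix c
  have "(\<Sum>b\<in>keys x. lookup x b when b = c) = lookup x c"
    by (subst sum.mono_neutral_right[of _ "keys x \<inter> {c}"])
      (auto simp: when_def in_keys_iff Int_insert_right)
  then show "lookup (linear_extension (\<lambda>b. single b 1) x) c = lookup x c"
    by (simp add: linear_extension_eq lookup_sum lookup_single mult_when)
qed

lemma lookup_linear_extension:
  "lookup (linear_extension f x) c =
    (\<Sum>b\<in>keys x. lookup x b * lookup (f b) c)"
  by (simp add: linear_extension_eq lookup_sum)

lemma keys_linear_extension:
  "(\<And>b. b \<in> keys x \<Longrightarrow> keys (f b) \<subseteq> B) \<Longrightarrow>
    keys (linear_extension f x) \<subseteq> B"
  unfolding linear_extension_eq by (intro keys_sum_le keys_scale_le)

section \<open>Simplicial chains\<close>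

lemma simplex_boundary_eq:
  assumes "finite S"
  shows "(simplex_boundary S :: 'v::linorder set \<Rightarrow>\<^sub>0 'k::field) =
    (if card S \<le> 1 then 0 else \<Sum>v\<in>S. single (S - {v}) (position_sign v S))"
  unfolding simplex_boundary_def position_sign_def
  by (subst sum_delete_nth[OF assms, of "\<lambda>k \<sigma>. single \<sigma> ((- 1) ^ k)"]) (rule refl)

abbreviation boundary :: "('v::linorder set \<Rightarrow>\<^sub>0 'k::field) \<Rightarrow> ('v set \<Rightarrow>\<^sub>0 'k)" where
  "boundary \<equiv> linear_extension simplex_boundary"

lemma boundary_edge:
  assumes "u < v"
  shows "(simplex_boundary {u, v} :: 'v::linorder set \<Rightarrow>\<^sub>0 'k::field) =
    single {v} 1 - single {u} 1"
proof -
  have "{x \<in> {u, v}. x < u} = {}" "{x \<in> {u, v}. x < v} = {u}"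
    using assms by auto
  then have "position_sign u {u, v} = (1 :: 'k)" "position_sign v {u, v} = (- 1 :: 'k)"
    by (simp_all only: position_sign_def) simp_all
  moreover have "{u, v} - {u} = {v}" "{u, v} - {v} = {u}" "u \<noteq> v" using assms by auto
  ultimately show ?thesis by (simp add: simplex_boundary_eq single_uminus)
qed

lemma boundary_of_boundary:
  assumes "finite S"
  shows "linear_extension simplex_boundary (simplex_boundary S :: 'v::linorder set \<Rightarrow>\<^sub>0 'k::field) = 0"
proof (cases "card S \<le> 2")
  case True
  then show ?thesis using assms
    by (auto simp: simplex_boundary_eq linear_extension_sum intro!: sum.neutral)
next
  case False
  then have c: "\<not> card S \<le> 1" by simp
  have "boundary (simplex_boundary S :: 'v set \<Rightarrow>\<^sub>0 'k) =
    (\<Sum>u\<in>S. \<Sum>v\<in>S - {u}. single (S - {u} - {v}) (position_sign u S * position_sign v (S - {u})))"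
    unfolding simplex_boundary_eq[OF assms] linear_extension_sum if_not_P[OF c]
  proof (rule sum.cong[OF refl])
    fix u assume "u \<in> S"
    then have "\<not> card (S - {u}) \<le> 1" using False assms by simp
    then show "boundary (single (S - {u}) (position_sign u S)) =
        (\<Sum>v\<in>S - {u}. single (S - {u} - {v}) (position_sign u S * position_sign v (S - {u}) :: 'k))"
      using assms by (simp add: simplex_boundary_eq scale_sum)
  qed
  also have "\<dots> = 0"
    using assms
    by (intro sum_antisymmetric) (auto simp: position_sign_remove Diff_insert2[symmetric] insert_commute
        single_uminus mult.commute simp flip: Diff_insert)
  finally show ?thesis .
qed

lemma boundary_boundary:
  assumes "\<And>\<sigma>. \<sigma> \<in> keys c \<Longrightarrow> finite \<sigma>"
  shows "boundary (boundary c) = 0"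
  unfolding linear_extension_compose using assms
  by (intro linear_extension_eq_0 boundary_of_boundary)

definition augmentation :: "('b \<Rightarrow>\<^sub>0 'r::comm_ring_1) \<Rightarrow> 'r" where
  "augmentation c = (\<Sum>b\<in>keys c. lookup c b)"

lemma linear_extension_const: "linear_extension (\<lambda>_. g) c = scale (augmentation c) g"
  by (simp add: linear_extension_eq augmentation_def scale_sum_scalars)

lemma augmentation_eq: "augmentation c = lookup (linear_extension (\<lambda>_. single () 1) c) ()"
  by (simp add: linear_extension_const)

lemma augmentation_simps:
  "augmentation 0 = 0"
  "augmentation (x + y) = augmentation x + augmentation y"
  "augmentation (x - y) = augmentation x - augmentation y"
  "augmentation (scale a x) = a * augmentation x"
  "augmentation (single b a) = a"
  by (simp_all add: augmentation_eq linear_extension_add linear_extension_diff lookup_add lookup_minus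
      linear_extension_scale)

lemma augmentation_sum: "augmentation (\<Sum>i\<in>A. x i) = (\<Sum>i\<in>A. augmentation (x i))"
  by (induction A rule: infinite_finite_induct) (simp_all add: augmentation_simps)

lemma augmentation_boundary:
  assumes "c \<in> chains 1 K"
  shows "augmentation (boundary c) = 0"
proof -
  have "linear_extension (\<lambda>_. single () 1) (simplex_boundary \<sigma> :: _ \<Rightarrow>\<^sub>0 'b) = 0"
    if "\<sigma> \<in> keys c" for \<sigma>
  proof -
    have "card \<sigma> = 2" using that assms by (auto simp: chains_def)
    then obtain u v where uv: "\<sigma> = {u, v}" "u < v"
      by (metis card_2_iff insert_commute linorder_neqE)
    then show ?thesis by (simp add: boundary_edge linear_extension_diff)
  qed
  then have "linear_extension (\<lambda>_. single () 1) (boundary c) = 0"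
    unfolding linear_extension_compose by (rule linear_extension_eq_0)
  then show ?thesis by (simp add: augmentation_eq)
qed

text \<open>The value 0 for \<open>v \<in> S\<close> is the usual convention for degenerate simplices.\<close>

definition cone_simplex :: "'v::linorder \<Rightarrow> 'v set \<Rightarrow> ('v set \<Rightarrow>\<^sub>0 'k::field)" where
  "cone_simplex v S = (if v \<in> S then 0 else single (insert v S) (position_sign v S))"

text \<open>Since the boundary of a vertex is 0 rather than the empty simplex, the homotopy between the identity
  and 0 fails on vertices, where the apex remains as an error term.\<close>

lemma cone_homotopy_simplex:
  assumes "finite S" "S \<noteq> {}"
  shows "boundary (cone_simplex v S) + linear_extension (cone_simplex v) (simplex_boundary S) =
    (single S 1 - (if card S = 1 then single {v} 1 else 0)
      :: 'v::linorder set \<Rightarrow>\<^sub>0 'k::field)"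
proof (cases "v \<in> S")
  case True
  show ?thesis
  proof (cases "card S = 1")
    case c1: True
    then have "S = {v}" using True by (auto simp: card_1_singleton_iff)
    then show ?thesis by (simp add: cone_simplex_def simplex_boundary_eq)
  next
    case False
    then have c: "\<not> card S \<le> 1" using assms by (simp add: le_Suc_eq)
    have "linear_extension (cone_simplex v) (simplex_boundary S :: 'v set \<Rightarrow>\<^sub>0 'k) =
        (\<Sum>u\<in>S. if u = v then single S 1 else 0)"
      unfolding simplex_boundary_eq[OF assms(1)] linear_extension_sum if_not_P[OF c]
    proof (rule sum.cong[OF refl])
      fix u assume "u \<in> S"
      then show "linear_extension (cone_simplex v) (single (S - {u}) (position_sign u S :: 'k)) =
          (if u = v then single S 1 else 0)"
        using True assms by (auto simp: cone_simplex_def position_sign_remove insert_absorb)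
    qed
    then show ?thesis using True assms c False by (simp add: cone_simplex_def)
  qed
next
  case False
  have card: "card (insert v S) = Suc (card S)" "card S \<noteq> 0" using assms False by simp_all
  let ?s = "position_sign v S :: 'k"
  have "boundary (cone_simplex v S) =
     (\<Sum>u\<in>insert v S. single (insert v S - {u}) (?s * position_sign u (insert v S)))"
    using False assms card by (simp add: cone_simplex_def simplex_boundary_eq scale_sum scale_add)
  also have "\<dots> = single S 1 +
     (\<Sum>u\<in>S. single (insert v S - {u}) (?s * position_sign u (insert v S)))"
    using False assms by (simp add: position_sign_insert)
  finally have 1: "boundary (cone_simplex v S) = single S 1 +
     (\<Sum>u\<in>S. single (insert v S - {u}) (?s * position_sign u (insert v S)))" .
  show ?thesis
  proof (cases "card S = 1")
    case True
    then obtain w where w: "S = {w}" by (auto simp: card_1_singleton_iff)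
    then have "w \<noteq> v" using False by auto
    then have "{x. x = w \<and> x < v} = (if w < v then {w} else {})" "{x. (x = v \<or> x = w) \<and> x < w} = (if w < v then {} else {v})"
      "insert v {w} - {w} = {v}" by auto
    then show ?thesis using w True unfolding 1 
      by (simp add: simplex_boundary_eq position_sign_def single_uminus)
  next
    case c1: False
    then have c: "\<not> card S \<le> 1" using card by linarith
    have "linear_extension (cone_simplex v) (simplex_boundary S :: 'v set \<Rightarrow>\<^sub>0 'k) =
        (\<Sum>u\<in>S. - single (insert v S - {u}) (?s * position_sign u (insert v S)))"
      unfolding simplex_boundary_eq[OF assms(1)] linear_extension_sum if_not_P[OF c]
    proof (rule sum.cong[OF refl])
      fix u assume u: "u \<in> S"
      then have uv: "u \<noteq> v" and "insert v (S - {u}) = insert v S - {u}" using False by auto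
      then have cone: "cone_simplex v (S - {u}) =
          single (insert v S - {u}) (position_sign v (S - {u}) :: 'k)"
        using False by (simp add: cone_simplex_def)
      have "position_sign u S * position_sign v (S - {u}) = - (?s * position_sign u (insert v S))"
        using False assms u uv
        by (cases "u < v") (auto simp: position_sign_remove position_sign_insert)
      then show "linear_extension (cone_simplex v) (single (S - {u}) (position_sign u S :: 'k)) =
         - single (insert v S - {u}) (?s * position_sign u (insert v S))"
        by (simp add: cone single_uminus)
    qed
    then show ?thesis unfolding 1 using c1 by (simp add: sum_negf)
  qed
qed

lemma cone_homotopy:
  assumes "c \<in> chains q K" "simplicial_complex K"
  shows "boundary (linear_extension (cone_simplex v) c) + linear_extension (cone_simplex v) (boundary c) =
    (c - (if q = 0 then scale (augmentation c) (single {v} 1) else 0)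
      :: 'v::linorder set \<Rightarrow>\<^sub>0 'k::field)"
proof -
  have k: "finite \<sigma>" "\<sigma> \<noteq> {}" "card \<sigma> = q + 1" if "\<sigma> \<in> keys c" for \<sigma>
    using that assms by (auto simp: chains_def simplicial_complex_def)
  let ?r = "\<lambda>_. if q = 0 then single {v} 1 else (0 :: 'v set \<Rightarrow>\<^sub>0 'k)"
  have "boundary (linear_extension (cone_simplex v) c) + linear_extension (cone_simplex v) (boundary c) =
     linear_extension (\<lambda>\<sigma>. single \<sigma> 1 - ?r \<sigma>) c"
    unfolding linear_extension_compose linear_extension_fun_add[symmetric]
    by (rule linear_extension_cong) (simp add: cone_homotopy_simplex k)
  then show ?thesis
    by (simp add: linear_extension_fun_diff linear_extension_basis linear_extension_const)
qed

text \<open>If the cone over the support of a cycle of \<open>K\<close> lies in a larger complex \<open>L\<close>, then the cycle becomes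
  trivial there. Neither \<open>K\<close> nor \<open>L\<close> has to be a cone itself, which is what allows an apex that only
  becomes available some steps later in a filtration.\<close>

lemma cone_off:
  assumes z: "z \<in> (cycles q K :: ('v::linorder set \<Rightarrow>\<^sub>0 'k::field) set)" and K: "simplicial_complex K"
    and KL: "\<And>\<sigma>. \<sigma> \<in> keys z \<Longrightarrow> v \<notin> \<sigma> \<Longrightarrow> insert v \<sigma> \<in> L"
  shows "z - (if q = 0 then scale (augmentation z) (single {v} 1) else 0) \<in> boundaries q L"
proof -
  have c: "z \<in> chains q K" "boundary z = 0" using z by (auto simp: cycles_def)
  have k: "finite \<sigma>" "card \<sigma> = q + 1" if "\<sigma> \<in> keys z" for \<sigma>
    using that c K by (auto simp: chains_def simplicial_complex_def)
  have "linear_extension (cone_simplex v) z \<in> chains (q + 1) L"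
    unfolding chains_def mem_Collect_eq
    by (rule keys_linear_extension) (use k KL in \<open>auto simp: cone_simplex_def\<close>)
  moreover have "boundary (linear_extension (cone_simplex v) z) =
      z - (if q = 0 then scale (augmentation z) (single {v} 1) else 0)"
    using cone_homotopy[OF c(1) K, of v] c by simp
  ultimately show ?thesis unfolding boundaries_def by (metis image_eqI)
qed

section \<open>Quotients of graded modules\<close>

definition coset :: "'m::ab_group_add set \<Rightarrow> 'm \<Rightarrow> 'm set" where
  "coset N x = (\<lambda>n. n + x) ` N"

definition plus_subgroup :: "'m::ab_group_add set \<Rightarrow> bool" where
  "plus_subgroup N \<longleftrightarrow> 0 \<in> N \<and> (\<forall>x\<in>N. \<forall>y\<in>N. x - y \<in> N)"

lemma plus_subgroupD:
  assumes "plus_subgroup N"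
  shows "0 \<in> N" and "x \<in> N \<Longrightarrow> y \<in> N \<Longrightarrow> x - y \<in> N" and "x \<in> N \<Longrightarrow> - x \<in> N"
    and "x \<in> N \<Longrightarrow> y \<in> N \<Longrightarrow> x + y \<in> N"
proof -
  show 0: "0 \<in> N" and d: "x \<in> N \<Longrightarrow> y \<in> N \<Longrightarrow> x - y \<in> N" for x y
    using assms by (auto simp: plus_subgroup_def)
  show m: "x \<in> N \<Longrightarrow> - x \<in> N" for x using d[of 0 x] 0 by simp
  show "x \<in> N \<Longrightarrow> y \<in> N \<Longrightarrow> x + y \<in> N" using d[of x "- y"] m[of y] by simp
qed

lemma mem_coset_iff: "y \<in> coset N x \<longleftrightarrow> y - x \<in> N"
  by (force simp: coset_def image_iff)

lemma coset_eq_iff: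
  assumes "plus_subgroup N"
  shows "coset N x = coset N y \<longleftrightarrow> x - y \<in> N"
proof
  assume "coset N x = coset N y"
  moreover have "x \<in> coset N x" using plus_subgroupD(1)[OF assms] by (simp add: mem_coset_iff)
  ultimately show "x - y \<in> N" by (simp add: mem_coset_iff)
next
  assume xy: "x - y \<in> N"
  have "z - x \<in> N \<longleftrightarrow> z - y \<in> N" for z
    using plus_subgroupD(4)[OF assms, of "z - x" "x - y"] plus_subgroupD(2)[OF assms, of "z - y" "x - y"] xy
    by auto
  then show "coset N x = coset N y" by (auto simp: mem_coset_iff)
qed

lemma coset_zero [simp]: "coset N 0 = N"
  by (simp add: coset_def)

lemma coset_image:
  assumes "plus_subgroup N'" "0 \<in> N" and "\<And>n. n \<in> N \<Longrightarrow> g (n + x) - g x \<in> N'"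
  shows "(\<Union>y\<in>coset N x. coset N' (g y)) = coset N' (g x)"
proof -
  have "coset N' (g y) = coset N' (g x)" if "y \<in> coset N x" for y
    using that assms(3)[of "y - x"] by (simp add: coset_eq_iff[OF assms(1)] mem_coset_iff)
  moreover have "x \<in> coset N x" using assms by (simp add: mem_coset_iff)
  ultimately show ?thesis by blast
qed

lemma r_coset_plus: "add M = (+) \<Longrightarrow> (+>\<^bsub>M\<^esub>) = coset"
  by (auto simp: a_r_coset_def r_coset_def coset_def fun_eq_iff)

lemma rcosets_plus: "add M = (+) \<Longrightarrow> a_rcosets\<^bsub>M\<^esub> N = coset N ` carrier M"
  using r_coset_plus[of M] by (auto simp: A_RCOSETS_def RCOSETS_def a_r_coset_def)

lemma set_add_plus:
  assumes "add M = (+)" "plus_subgroup N"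
  shows "coset N x <+>\<^bsub>M\<^esub> coset N y = coset N (x + y)"
proof -
  have "\<exists>n\<in>N. \<exists>m\<in>N. k + (x + y) = (n + x) + (m + y)" if "k \<in> N" for k
    using that plus_subgroupD(1)[OF assms(2)] by (intro bexI[of _ k] bexI[of _ 0]) (auto simp: algebra_simps)
  moreover have "(n + x) + (m + y) = (n + m) + (x + y)" for n m by (simp add: algebra_simps)
  ultimately show ?thesis using assms plus_subgroupD(4)[OF assms(2)]
    by (fastforce simp: set_add_def set_mult_def coset_def)
qed

text \<open>The modules whose quotients are taken all add by the type class operation, so that their cosets are
  translates and can be computed with ordinary algebra.\<close>

definition plus_module :: "('r, 'm::ab_group_add, 'z) module_scheme \<Rightarrow> bool" where
  "plus_module M \<longleftrightarrow> add M = (+) \<and> (\<forall>a x y. a \<odot>\<^bsub>M\<^esub> (x + y) = a \<odot>\<^bsub>M\<^esub> x + a \<odot>\<^bsub>M\<^esub> y)"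

definition plus_submodule :: "('r, 'm::ab_group_add, 'z) module_scheme \<Rightarrow> 'm set \<Rightarrow> bool" where
  "plus_submodule M N \<longleftrightarrow> plus_subgroup N \<and> (\<forall>a. \<forall>x\<in>N. a \<odot>\<^bsub>M\<^esub> x \<in> N)"

lemma smult_coset:
  assumes "plus_module M" "plus_submodule M N"
  shows "(\<Union>y\<in>coset N x. N +>\<^bsub>M\<^esub> (a \<odot>\<^bsub>M\<^esub> y)) = coset N (a \<odot>\<^bsub>M\<^esub> x)"
proof -
  have "(\<Union>y\<in>coset N x. coset N (a \<odot>\<^bsub>M\<^esub> y)) = coset N (a \<odot>\<^bsub>M\<^esub> x)"
    using assms by (intro coset_image) (auto simp: plus_module_def plus_submodule_def plus_subgroupD)
  then show ?thesis using assms by (simp add: plus_module_def r_coset_plus)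
qed

lemma quotient_module_plus:
  assumes "plus_module M" "plus_submodule M N"
  shows "carrier (quotient_module M N) = coset N ` carrier M"
    and "zero (quotient_module M N) = N"
    and "coset N x \<oplus>\<^bsub>quotient_module M N\<^esub> coset N y = coset N (x + y)"
    and "a \<odot>\<^bsub>quotient_module M N\<^esub> coset N x = coset N (a \<odot>\<^bsub>M\<^esub> x)"
  using assms smult_coset[OF assms]
  by (simp_all add: quotient_module_def rcosets_plus set_add_plus plus_module_def plus_submodule_def)

lemma graded_quotient_plus:
  assumes "plus_module M" "plus_submodule M N"
  shows "carrier (graded_quotient M N) = coset N ` carrier M"
    and "coset N x \<oplus>\<^bsub>graded_quotient M N\<^esub> coset N y = coset N (x + y)"
    and "a \<odot>\<^bsub>graded_quotient M N\<^esub> coset N x = coset N (a \<odot>\<^bsub>M\<^esub> x)"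
    and "grade (graded_quotient M N) j = coset N ` grade M j"
  using assms quotient_module_plus[OF assms]
  by (simp_all add: graded_quotient_def module.defs gmodule.defs plus_module_def r_coset_plus)

definition closed_gmodule :: "('k::field, 'm) gmodule \<Rightarrow> bool" where
  "closed_gmodule M \<longleftrightarrow>
     (\<forall>x\<in>carrier M. \<forall>y\<in>carrier M. x \<oplus>\<^bsub>M\<^esub> y \<in> carrier M) \<and>
     (\<forall>p. \<forall>x\<in>carrier M. p \<odot>\<^bsub>M\<^esub> x \<in> carrier M) \<and> (\<forall>j. grade M j \<subseteq> carrier M)"

lemma closed_graded_quotient:
  assumes "plus_module M" "plus_submodule M N" "closed_gmodule M"
  shows "closed_gmodule (graded_quotient M N)"
proof -
  have "add M = (+)" using assms by (simp add: plus_module_def)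
  then show ?thesis using assms(3)
    by (auto simp: closed_gmodule_def graded_quotient_plus[OF assms(1,2)] image_subset_iff subset_iff)
qed

text \<open>The isomorphism theorem for graded modules. Surjectivity is asked for in every degree because a
  homogeneous element could otherwise have only inhomogeneous preimages.\<close>

lemma graded_quotient_iso:
  fixes M :: "('k::field, 'm::ab_group_add) gmodule"
  assumes M: "plus_module M" "plus_submodule M N" "closed_gmodule M"
    and f: "eta_morphism 0 M P f" "carrier P \<subseteq> f ` carrier M" "\<And>j. grade P j \<subseteq> f ` grade M j"
    and kernel: "\<And>x y. x \<in> carrier M \<Longrightarrow> y \<in> carrier M \<Longrightarrow> f x = f y \<longleftrightarrow> x - y \<in> N"
  shows "graded_quotient M N \<cong>\<^sub>g P"
proof -
  define g where "g S = f (SOME x. x \<in> carrier M \<and> S = coset N x)" for S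
  have N: "plus_subgroup N" using M by (simp add: plus_submodule_def)
  have g: "g (coset N x) = f x" if "x \<in> carrier M" for x
  proof -
    have "\<exists>y. y \<in> carrier M \<and> coset N x = coset N y" using that by blast
    from someI_ex[OF this] obtain y where y: "y \<in> carrier M" "coset N x = coset N y" "g (coset N x) = f y"
      unfolding g_def by blast
    then have "x - y \<in> N" by (simp add: coset_eq_iff[OF N])
    then show ?thesis using kernel[OF that y(1)] y(3) by simp
  qed
  have c: "x + y \<in> carrier M" "p \<odot>\<^bsub>M\<^esub> x \<in> carrier M" "x \<oplus>\<^bsub>M\<^esub> y = x + y"
    if "x \<in> carrier M" "y \<in> carrier M" for x y p
    using that M by (auto simp: closed_gmodule_def plus_module_def)
  have gr: "x \<in> carrier M" if "x \<in> grade M j" for x j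
    using that M by (auto simp: closed_gmodule_def)
  have gg: "g ` grade (graded_quotient M N) j = f ` grade M j" for j
    unfolding graded_quotient_plus[OF M(1,2)] image_image by (rule image_cong) (auto simp: g gr)
  have gC: "g ` carrier (graded_quotient M N) = f ` carrier M"
    unfolding graded_quotient_plus[OF M(1,2)] image_image by (rule image_cong) (auto simp: g)
  have "eta_morphism 0 (graded_quotient M N) P g"
    unfolding eta_morphism_def gg using f(1) c
    by (auto simp: eta_morphism_def graded_quotient_plus[OF M(1,2)] g)
  moreover have "inj_on g (carrier (graded_quotient M N))"
    by (auto simp: inj_on_def graded_quotient_plus[OF M(1,2)] g kernel coset_eq_iff[OF N])
  moreover have "g ` carrier (graded_quotient M N) = carrier P"
    using f(1,2) unfolding gC eta_morphism_def by blast
  moreover have "g ` grade (graded_quotient M N) j = grade P j" for j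
    using f(1) f(3)[of j] unfolding gg eta_morphism_def by (simp add: subset_antisym)
  ultimately show ?thesis unfolding gmodule_iso_def bij_betw_def by blast
qed

lemma gmodule_iso_obtain_inverse:
  assumes "M \<cong>\<^sub>g N" "closed_gmodule M"
  obtains f g where "eta_morphism 0 M N f" "eta_morphism 0 N M g"
    "\<And>x. x \<in> carrier M \<Longrightarrow> g (f x) = x" "\<And>y. y \<in> carrier N \<Longrightarrow> f (g y) = y"
    "\<And>j. g ` grade N j = grade M j" "bij_betw g (carrier N) (carrier M)"
proof -
  obtain f where f: "eta_morphism 0 M N f" "bij_betw f (carrier M) (carrier N)"
    "\<And>j. f ` grade M j = grade N j" using assms by (auto simp: gmodule_iso_def)
  define g where "g = inv_into (carrier M) f"
  have gf: "g (f x) = x" if "x \<in> carrier M" for x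
    using that f(2) by (simp add: g_def bij_betw_inv_into_left)
  have fg: "f (g y) = y" if "y \<in> carrier N" for y
    using that f(2) by (simp add: g_def bij_betw_inv_into_right)
  have bij: "bij_betw g (carrier N) (carrier M)"
    unfolding g_def by (rule bij_betw_inv_into[OF f(2)])
  have gc: "g y \<in> carrier M" if "y \<in> carrier N" for y using bij that by (auto simp: bij_betw_def)
  have gr: "g ` grade N j = grade M j" for j
  proof -
    have "grade M j \<subseteq> carrier M" using assms by (simp add: closed_gmodule_def)
    then show ?thesis unfolding f(3)[symmetric] image_image using gf by (force simp: subset_iff)
  qed
  have "g (x \<oplus>\<^bsub>N\<^esub> y) = g x \<oplus>\<^bsub>M\<^esub> g y" if "x \<in> carrier N" "y \<in> carrier N" for x y
  proof -
    have "x \<oplus>\<^bsub>N\<^esub> y = f (g x \<oplus>\<^bsub>M\<^esub> g y)"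
      using f(1) gc[OF that(1)] gc[OF that(2)] that by (simp add: eta_morphism_def fg)
    then show ?thesis using assms(2) gc[OF that(1)] gc[OF that(2)] by (simp add: gf closed_gmodule_def)
  qed
  moreover have "g (p \<odot>\<^bsub>N\<^esub> x) = p \<odot>\<^bsub>M\<^esub> g x" if "x \<in> carrier N" for p x
  proof -
    have "p \<odot>\<^bsub>N\<^esub> x = f (p \<odot>\<^bsub>M\<^esub> g x)"
      using f(1) gc[OF that(1)] that by (simp add: eta_morphism_def fg)
    then show ?thesis using assms(2) gc[OF that(1)] by (simp add: gf closed_gmodule_def)
  qed
  ultimately have "eta_morphism 0 N M g" using gr gc by (auto simp: eta_morphism_def)
  then show ?thesis using that[of f g] f(1) gf fg gr bij by blast
qed

lemma gmodule_iso_sym: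
  assumes "M \<cong>\<^sub>g N" "closed_gmodule M"
  shows "N \<cong>\<^sub>g M"
  by (rule gmodule_iso_obtain_inverse[OF assms]) (auto simp: gmodule_iso_def)

lemma eta_morphism_compose:
  assumes "eta_morphism a M N f" "eta_morphism b N P g"
  shows "eta_morphism (a + b) M P (\<lambda>x. g (f x))"
  using assms by (force simp: eta_morphism_def Pi_iff image_subset_iff add.assoc)

lemma interleaved_iso_aux:
  assumes "interleaved \<eta> M N"
    and f: "eta_morphism 0 M M' f" "eta_morphism 0 M' M f'"
      "\<And>x. x \<in> carrier M \<Longrightarrow> f' (f x) = x" "\<And>x. x \<in> carrier M' \<Longrightarrow> f (f' x) = x"
    and g: "eta_morphism 0 N N' g" "eta_morphism 0 N' N g'"
      "\<And>x. x \<in> carrier N \<Longrightarrow> g' (g x) = x" "\<And>x. x \<in> carrier N' \<Longrightarrow> g (g' x) = x"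
  shows "interleaved \<eta> M' N'"
proof -
  obtain \<phi> \<psi> where pp: "eta_morphism \<eta> M N \<phi>" "eta_morphism \<eta> N M \<psi>"
    "\<And>y. y \<in> carrier N \<Longrightarrow> \<phi> (\<psi> y) = monom 1 (2 * \<eta>) \<odot>\<^bsub>N\<^esub> y"
    "\<And>x. x \<in> carrier M \<Longrightarrow> \<psi> (\<phi> x) = monom 1 (2 * \<eta>) \<odot>\<^bsub>M\<^esub> x"
    using assms(1) unfolding interleaved_def by blast
  have "eta_morphism \<eta> M' N' (\<lambda>x. g (\<phi> (f' x)))" "eta_morphism \<eta> N' M' (\<lambda>x. f (\<psi> (g' x)))"
    using eta_morphism_compose[OF eta_morphism_compose[OF f(2) pp(1)] g(1)]
      eta_morphism_compose[OF eta_morphism_compose[OF g(2) pp(2)] f(1)] by simp_all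
  moreover have "h x \<in> carrier B" if "eta_morphism e A B h" "x \<in> carrier A" for h x e
    and A :: "('x::field, 'y) gmodule" and B :: "('x, 'z) gmodule"
    using that by (auto simp: eta_morphism_def)
  note c = this
  moreover have "g (\<phi> (f' (f (\<psi> (g' y))))) = monom 1 (2 * \<eta>) \<odot>\<^bsub>N'\<^esub> y" if "y \<in> carrier N'" for y
    using that g(1) by (simp add: f g pp c[OF g(2)] c[OF pp(2)] eta_morphism_def[of _ N N'])
  moreover have "f (\<psi> (g' (g (\<phi> (f' x))))) = monom 1 (2 * \<eta>) \<odot>\<^bsub>M'\<^esub> x" if "x \<in> carrier M'" for x
    using that f(1) by (simp add: f g pp c[OF f(2)] c[OF pp(1)] eta_morphism_def[of _ M M'])
  ultimately show ?thesis unfolding interleaved_def by blast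
qed

lemma interleaved_iso:
  assumes "M \<cong>\<^sub>g M'" "closed_gmodule M" "N \<cong>\<^sub>g N'" "closed_gmodule N"
  shows "interleaved \<eta> M N \<longleftrightarrow> interleaved \<eta> M' N'"
proof -
  obtain f f' where f: "eta_morphism 0 M M' f" "eta_morphism 0 M' M f'"
    "\<And>x. x \<in> carrier M \<Longrightarrow> f' (f x) = x" "\<And>x. x \<in> carrier M' \<Longrightarrow> f (f' x) = x"
    by (rule gmodule_iso_obtain_inverse[OF assms(1,2)]) blast
  obtain g g' where g: "eta_morphism 0 N N' g" "eta_morphism 0 N' N g'"
    "\<And>x. x \<in> carrier N \<Longrightarrow> g' (g x) = x" "\<And>x. x \<in> carrier N' \<Longrightarrow> g (g' x) = x"
    by (rule gmodule_iso_obtain_inverse[OF assms(3,4)]) blast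
  show ?thesis
    using interleaved_iso_aux[OF _ f g, of \<eta>] interleaved_iso_aux[OF _ f(2,1,4,3) g(2,1,4,3), of \<eta>] by blast
qed

section \<open>Laurent polynomials and interval modules\<close>

lemma lookup_single_mult:
  fixes x :: "int \<Rightarrow>\<^sub>0 'k::field"
  shows "lookup (single i c * x) j = c * lookup x (j - i)"
proof -
  have "lookup (single i c * x) j =
      Sum_any (\<lambda>l. lookup (single i c) l * lookup x (j - l))"
    unfolding lookup_mult
  proof (rule Sum_any.cong)
    fix l
    have "Sum_any (\<lambda>q. lookup x q when j = l + q) = Sum_any (\<lambda>q. lookup x q when j - l = q)"
      by (rule Sum_any.cong) (auto simp: when_def)
    then show "lookup (single i c) l * Sum_any (\<lambda>q. lookup x q when j = l + q) =
      lookup (single i c) l * lookup x (j - l)" by simp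
  qed
  also have "\<dots> = Sum_any (\<lambda>l. (c * lookup x (j - l)) when i = l)"
    by (rule Sum_any.cong) (auto simp: lookup_single when_def)
  finally show ?thesis by simp
qed

lemma lookup_laurent_of_poly:
  "lookup (laurent_of_poly p) j = (if 0 \<le> j then coeff p (nat j) else 0)"
proof -
  have "lookup (laurent_of_poly p) j = (\<Sum>i\<le>Polynomial.degree p. if int i = j then coeff p i else 0)"
    by (simp add: laurent_of_poly_def lookup_sum lookup_single when_def)
  also have "\<dots> = (\<Sum>i\<in>{i \<in> {..Polynomial.degree p}. int i = j}. coeff p i)"
    by (subst sum.inter_filter) auto
  also have "{i \<in> {..Polynomial.degree p}. int i = j} = (if 0 \<le> j \<and> nat j \<le> Polynomial.degree p then {nat j} else {})"
    by auto
  finally show ?thesis by (auto simp: coeff_eq_0)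
qed

lemma laurent_of_poly_add: "laurent_of_poly (p + q) = laurent_of_poly p + laurent_of_poly q"
  by (rule poly_mapping_eqI) (simp add: lookup_laurent_of_poly lookup_add)

lemma laurent_of_poly_zero [simp]: "laurent_of_poly 0 = 0"
  by (rule poly_mapping_eqI) (simp add: lookup_laurent_of_poly)

lemma laurent_of_poly_monom: "laurent_of_poly (monom c n) = single (int n) c"
  by (rule poly_mapping_eqI) (auto simp: lookup_laurent_of_poly lookup_single when_def)

lemma laurent_of_poly_pCons:
  "laurent_of_poly (pCons a p) = single 0 a + single 1 1 * laurent_of_poly p"
  by (rule poly_mapping_eqI)
    (auto simp: lookup_laurent_of_poly lookup_single when_def lookup_add lookup_single_mult coeff_pCons
      nat_diff_distrib split: nat.splits)

lemma laurent_of_poly_smult: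
  "laurent_of_poly (Polynomial.smult a p) = single 0 a * laurent_of_poly p"
  by (rule poly_mapping_eqI) (simp add: lookup_laurent_of_poly lookup_single_mult)

lemma laurent_of_poly_mult: "laurent_of_poly (p * q) = laurent_of_poly p * laurent_of_poly q"
proof (induction p)
  case (pCons a p)
  then show ?case
    by (simp add: laurent_of_poly_add laurent_of_poly_smult laurent_of_poly_pCons algebra_simps)
qed simp

lemma lookup_laurent_mult:
  "lookup (laurent_of_poly p * x) j =
    (\<Sum>i\<le>Polynomial.degree p. coeff p i * lookup x (j - int i))"
  by (simp add: laurent_of_poly_def sum_distrib_right lookup_sum lookup_single_mult)

lemma keys_le_iff_lookup: "keys x \<subseteq> B \<longleftrightarrow> (\<forall>b. b \<notin> B \<longrightarrow> lookup x b = 0)"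
  by (auto simp: in_keys_iff)

lemma laurent_mult_keys:
  "keys x \<subseteq> {a..} \<Longrightarrow> keys (laurent_of_poly p * x) \<subseteq> {a..}"
  by (auto simp: keys_le_iff_lookup lookup_laurent_mult)

lemma shifted_free_simps [simp]:
  "carrier (shifted_free k a) = {x. keys x \<subseteq> {a..}}"
  "add (shifted_free k a) = (+)"
  "p \<odot>\<^bsub>shifted_free k a\<^esub> x = laurent_of_poly p * x"
  "grade (shifted_free k a) j = {x. keys x \<subseteq> {a..} \<inter> {j}}"
  by (simp_all add: shifted_free_def)

lemma shifted_free_plus_module: "plus_module (shifted_free k a)"
  by (simp add: plus_module_def algebra_simps)

lemma shifted_free_submodule: "plus_submodule (shifted_free k a) {x. keys x \<subseteq> {b..}}"
  by (simp add: plus_submodule_def plus_subgroup_def keys_diff_le laurent_mult_keys)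

lemma shifted_free_closed: "closed_gmodule (shifted_free k a)"
  by (auto simp: closed_gmodule_def keys_add_le laurent_mult_keys)

lemma interval_module_eq:
  "interval_module k a b = graded_quotient (shifted_free k a) {x. keys x \<subseteq> {b..}}"
  by (simp add: interval_module_def)

lemmas interval_module_simps =
  graded_quotient_plus[OF shifted_free_plus_module shifted_free_submodule,
    folded interval_module_eq, unfolded shifted_free_simps]

lemma interval_module_closed: "closed_gmodule (interval_module k a b)"
  unfolding interval_module_eq
  by (rule closed_graded_quotient[OF shifted_free_plus_module shifted_free_submodule shifted_free_closed])


lemma shift_keys:
  fixes x :: "int \<Rightarrow>\<^sub>0 'k::field"
  shows "keys x \<subseteq> B \<Longrightarrow> keys (single i c * x) \<subseteq> (+) i ` B"
proof -
  assume x: "keys x \<subseteq> B"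
  have "lookup x (b - i) = 0" if "b \<notin> (+) i ` B" for b
  proof -
    have "b - i \<notin> B" using that by (metis add.commute diff_add_cancel image_eqI)
    then show ?thesis using x by (auto simp: keys_le_iff_lookup)
  qed
  then show ?thesis by (simp add: keys_le_iff_lookup lookup_single_mult)
qed

text \<open>Multiplication by \<open>t\<^sup>\<eta>\<close>, from a quotient by \<open>t\<^sup>b k[t]\<close> to a quotient by \<open>t\<^sup>c k[t]\<close>; being a union
  over representatives, it involves no choice.\<close>

definition interval_shift :: "nat \<Rightarrow> int \<Rightarrow> (int \<Rightarrow>\<^sub>0 'k::field) set \<Rightarrow> (int \<Rightarrow>\<^sub>0 'k) set" where
  "interval_shift \<eta> c S =
    (\<Union>x\<in>S. coset {x. keys x \<subseteq> {c..}} (single (int \<eta>) 1 * x))"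

lemma plus_subgroup_keys: "plus_subgroup {x :: 'b \<Rightarrow>\<^sub>0 'r::ab_group_add. keys x \<subseteq> B}"
  by (simp add: plus_subgroup_def keys_diff_le)

lemma interval_shift_coset:
  assumes "c \<le> b + int \<eta>"
  shows "interval_shift \<eta> c (coset {x. keys x \<subseteq> {b..}} y) =
    coset {x. keys x \<subseteq> {c..}} (single (int \<eta>) (1 :: 'k::field) * y)"
  unfolding interval_shift_def
proof (rule coset_image[OF plus_subgroup_keys])
  fix n :: "int \<Rightarrow>\<^sub>0 'k" assume "n \<in> {x. keys x \<subseteq> {b..}}"
  then have "keys (single (int \<eta>) 1 * n) \<subseteq> (+) (int \<eta>) ` {b..}"
    by (intro shift_keys) simp
  also have "\<dots> \<subseteq> {c..}" using assms by auto
  finally show "single (int \<eta>) 1 * (n + y) - single (int \<eta>) 1 * y \<in>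
      {x. keys x \<subseteq> {c..}}"
    by (simp add: algebra_simps)
qed simp

lemma interval_shift_morphism:
  fixes k :: "'k::field itself"
  assumes "c \<le> b + int \<eta>"
  shows "eta_morphism \<eta> (interval_module k a b) (interval_module k a c) (interval_shift \<eta> c)"
proof -
  have "keys (single (int \<eta>) 1 * x) \<subseteq> {a..}" if "keys x \<subseteq> {a..}"
    for x :: "int \<Rightarrow>\<^sub>0 'k"
    using shift_keys[OF that, of "int \<eta>" 1] by (rule order_trans) auto
  moreover have "keys (single (int \<eta>) 1 * x) \<subseteq> {j + int \<eta>}" if "keys x \<subseteq> {j}"
    for x :: "int \<Rightarrow>\<^sub>0 'k" and j
    using shift_keys[OF that, of "int \<eta>" 1] by (simp add: add.commute)
  ultimately show ?thesis
    unfolding eta_morphism_def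
    by (auto simp: interval_module_simps interval_shift_coset[OF assms] algebra_simps intro!: imageI)
qed

lemma interval_modules_interleaved:
  fixes k :: "'k::field itself"
  assumes "b \<le> c + int \<eta>" "c \<le> b + int \<eta>"
  shows "interleaved \<eta> (interval_module k a b) (interval_module k a c)"
proof -
  have "single (int \<eta>) 1 * (single (int \<eta>) 1 * x) = laurent_of_poly (monom 1 (2 * \<eta>)) * x"
    for x :: "int \<Rightarrow>\<^sub>0 'k"
    by (simp add: laurent_of_poly_monom mult_single flip: mult.assoc)
  then show ?thesis
    unfolding interleaved_def
    using interval_shift_morphism[OF assms(1), of k a] interval_shift_morphism[OF assms(2), of k a]
    by (intro exI[of _ "interval_shift \<eta> _"] conjI)
      (auto simp only: interval_module_simps interval_shift_coset assms)
qed

text \<open>Degree reasons force the first map to kill an element of degree \<open>c - \<eta>\<close>, as its target vanishes from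
  degree \<open>c\<close> on. But \<open>t\<^bsup>2\<eta>\<^esup>\<close> moves this element only to degree \<open>c + \<eta> < b\<close>, where it is still nonzero.\<close>

lemma interval_modules_not_interleaved:
  fixes k :: "'k::field itself"
  assumes "int \<eta> < b - c" "int \<eta> \<le> c - a"
  shows "\<not> interleaved \<eta> (interval_module k a b) (interval_module k a c)"
proof
  let ?N = "\<lambda>b. {x :: int \<Rightarrow>\<^sub>0 'k. keys x \<subseteq> {b..}}"
  let ?I = "\<lambda>b. interval_module k a b"
  note N = plus_subgroup_keys
  assume "interleaved \<eta> (?I b) (?I c)"
  then obtain \<phi> \<psi> where pp: "eta_morphism \<eta> (?I b) (?I c) \<phi>" "eta_morphism \<eta> (?I c) (?I b) \<psi>"
    "\<And>x. x \<in> carrier (?I b) \<Longrightarrow> \<psi> (\<phi> x) = monom 1 (2 * \<eta>) \<odot>\<^bsub>?I b\<^esub> x"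
    unfolding interleaved_def by blast
  \<comment> \<open>the last power of \<open>t\<close> whose image under \<open>\<phi>\<close> has to vanish\<close>
  define g where "g = coset (?N b) (single (c - int \<eta>) 1)"
  have g: "g \<in> grade (?I b) (c - int \<eta>)" "g \<in> carrier (?I b)"
    unfolding g_def interval_module_simps using assms by (auto intro!: imageI)
  have "\<phi> ` grade (?I b) (c - int \<eta>) \<subseteq> grade (?I c) (c - int \<eta> + int \<eta>)"
    using pp(1) unfolding eta_morphism_def by blast
  then have "\<phi> g \<in> grade (?I c) c" using g(1) by auto
  then obtain x where x: "\<phi> g = coset (?N c) x" "keys x \<subseteq> {c}"
    by (auto simp: interval_module_simps)
  then have "keys x \<subseteq> {c..}" by (rule_tac order_trans[OF x(2)]) simp
  then have "coset (?N c) x = coset (?N c) 0" by (simp only: coset_eq_iff[OF N]) simp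
  then have "\<phi> g = ?N c" using x(1) by simp
  moreover have "\<psi> (?N c) = ?N b"
  proof -
    have z: "?N c = coset (?N c) 0" "?N b = coset (?N b) 0" by simp_all
    have c: "?N c \<in> carrier (?I c)" unfolding interval_module_simps by (subst z(1)) (rule imageI, simp)
    have "?N c = 0 \<odot>\<^bsub>?I c\<^esub> ?N c"
    proof -
      have "0 \<odot>\<^bsub>?I c\<^esub> coset (?N c) 0 = coset (?N c) (laurent_of_poly 0 * 0)"
        by (rule interval_module_simps(3))
      then show ?thesis by simp
    qed
    then have "\<psi> (?N c) = 0 \<odot>\<^bsub>?I b\<^esub> \<psi> (?N c)" using pp(2) c unfolding eta_morphism_def by metis
    moreover obtain y where "\<psi> (?N c) = coset (?N b) y"
    proof -
      have "\<psi> (?N c) \<in> carrier (?I b)" using pp(2) c unfolding eta_morphism_def by (auto simp only: Pi_iff)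
      then show thesis using that unfolding interval_module_simps by blast
    qed
    ultimately show ?thesis by (simp add: interval_module_simps)
  qed
  ultimately have "coset (?N b) (single (c + int \<eta>) 1) = coset (?N b) 0"
    using pp(3)[OF g(2)]
    by (simp add: g_def interval_module_simps laurent_of_poly_monom mult_single add.commute[of c])
  then have "single (c + int \<eta>) (1 :: 'k) - 0 \<in> ?N b" by (simp only: coset_eq_iff[OF N])
  then show False using assms by simp
qed

section \<open>Persistent homology\<close>

lemma cycles_plus_subgroup: "plus_subgroup (cycles q K)"
  by (simp add: plus_subgroup_def cycles_def chains_def keys_diff_le linear_extension_diff)

lemma cycles_scale: "z \<in> cycles q K \<Longrightarrow> scale a z \<in> cycles q K"
  by (simp add: cycles_def chains_def linear_extension_scale keys_scale_le)

lemma boundaries_plus_subgroup: "plus_subgroup (boundaries q K :: ('v::linorder set \<Rightarrow>\<^sub>0 'k::field) set)"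
proof -
  have "0 = boundary (0 :: 'v set \<Rightarrow>\<^sub>0 'k)" by simp
  moreover have "(0 :: 'v set \<Rightarrow>\<^sub>0 'k) \<in> chains (q + 1) K" by (simp add: chains_def)
  moreover have "x - y \<in> chains (q + 1) K" if "x \<in> chains (q + 1) K" "y \<in> chains (q + 1) K"
    for x y :: "'v set \<Rightarrow>\<^sub>0 'k"
    using that by (simp add: chains_def keys_diff_le)
  ultimately show ?thesis
    unfolding plus_subgroup_def boundaries_def
    by (auto simp flip: linear_extension_diff intro!: imageI intro: image_eqI[of 0 boundary 0])
qed

lemma boundaries_scale: "z \<in> boundaries q K \<Longrightarrow> scale a z \<in> boundaries q K"
  by (auto simp: boundaries_def chains_def keys_scale_le simp flip: linear_extension_scale intro!: imageI)

lemma chains_mono: "K \<subseteq> L \<Longrightarrow> chains q K \<subseteq> chains q L"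
  by (auto simp: chains_def)

lemma cycles_mono: "K \<subseteq> L \<Longrightarrow> cycles q K \<subseteq> cycles q L"
  using chains_mono[of K L q] by (auto simp: cycles_def)

lemma boundaries_mono: "K \<subseteq> L \<Longrightarrow> boundaries q K \<subseteq> boundaries q L"
  unfolding boundaries_def by (intro image_mono chains_mono)

lemma cycles_sum: "(\<And>i. i \<in> A \<Longrightarrow> z i \<in> cycles q K) \<Longrightarrow> (\<Sum>i\<in>A. z i) \<in> cycles q K"
  by (induction A rule: infinite_finite_induct)
    (simp_all add: plus_subgroupD[OF cycles_plus_subgroup])

abbreviation homology_class ::
    "nat \<Rightarrow> 'v::linorder set set \<Rightarrow> ('v set \<Rightarrow>\<^sub>0 'k::field) \<Rightarrow> ('v set \<Rightarrow>\<^sub>0 'k) set" where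
  "homology_class q K \<equiv> coset (boundaries q K)"

lemma homology_space_simps:
  fixes K :: "'v::linorder set set"
  shows "carrier (homology_space q K :: ('k::field, _) module) = homology_class q K ` cycles q K"
    and "zero (homology_space q K :: ('k, _) module) = boundaries q K"
    and "homology_class q K x \<oplus>\<^bsub>homology_space q K :: ('k, _) module\<^esub> homology_class q K y = homology_class q K (x + y)"
    and "a \<odot>\<^bsub>homology_space q K :: ('k, _) module\<^esub> homology_class q K x = homology_class q K (scale a x)"
proof -
  let ?M = "(free_module UNIV)\<lparr>carrier := cycles q K\<rparr> :: ('k, 'v set \<Rightarrow>\<^sub>0 'k) module"
  have "plus_module ?M"
    by (simp add: plus_module_def free_module_def scale_add[unfolded scale_def])
  moreover have "plus_submodule ?M (boundaries q K)"
    by (simp add: plus_submodule_def free_module_def boundaries_plus_subgroup boundaries_scale[unfolded scale_def])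
  ultimately show "carrier (homology_space q K :: ('k, _) module) = homology_class q K ` cycles q K"
    and "zero (homology_space q K :: ('k, _) module) = boundaries q K"
    and "homology_class q K x \<oplus>\<^bsub>homology_space q K :: ('k, _) module\<^esub> homology_class q K y = homology_class q K (x + y)"
    and "a \<odot>\<^bsub>homology_space q K :: ('k, _) module\<^esub> homology_class q K x = homology_class q K (scale a x)"
    unfolding homology_space_def by (simp_all add: quotient_module_plus) (simp_all add: free_module_def scale_def)
qed

lemma homology_space_abelian_monoid: "abelian_monoid (homology_space q K :: ('k::field, _) module)"
proof -
  let ?V = "homology_space q K :: ('k, _) module"
  have z: "\<zero>\<^bsub>?V\<^esub> = homology_class q K 0" by (simp add: homology_space_simps)
  show ?thesis
  proof (rule abelian_monoidI)
    show "\<zero>\<^bsub>?V\<^esub> \<in> carrier ?V"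
      unfolding z homology_space_simps(1) using plus_subgroupD(1)[OF cycles_plus_subgroup] by blast
  next
    fix x assume "x \<in> carrier ?V"
    then show "\<zero>\<^bsub>?V\<^esub> \<oplus>\<^bsub>?V\<^esub> x = x"
      unfolding z by (auto simp: homology_space_simps(1,3) simp del: coset_zero)
  qed (auto simp: homology_space_simps add_ac intro!: imageI plus_subgroupD(4)[OF cycles_plus_subgroup])
qed

lemma homology_space_finsum:
  assumes "finite A" "\<And>i. i \<in> A \<Longrightarrow> z i \<in> cycles q K"
  shows "(\<Oplus>\<^bsub>homology_space q K :: ('k::field, _) module\<^esub>i\<in>A. homology_class q K (z i)) = homology_class q K (\<Sum>i\<in>A. z i)"
  using assms
proof (induction A)
  case empty
  then show ?case
    by (simp add: abelian_monoid.finsum_empty[OF homology_space_abelian_monoid] homology_space_simps)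
next
  case (insert i A)
  then show ?case
    by (subst abelian_monoid.finsum_insert[OF homology_space_abelian_monoid])
      (auto simp: homology_space_simps)
qed

lemma induced_map_class:
  assumes "K \<subseteq> L"
  shows "induced_map q L (homology_class q K z) = homology_class q L z"
proof -
  note L = plus_subgroupD[OF boundaries_plus_subgroup[of q L]]
  show ?thesis
  proof (intro equalityI subsetI)
    fix y assume "y \<in> induced_map q L (homology_class q K z)"
    then obtain b w where y: "y = b + w" "b \<in> boundaries q L" "w - z \<in> boundaries q K"
      by (auto simp: induced_map_def mem_coset_iff)
    then have "b + (w - z) \<in> boundaries q L" using boundaries_mono[OF assms, of q] by (intro L(4)) auto
    then show "y \<in> homology_class q L z" by (simp add: y(1) mem_coset_iff add_diff_eq)
  next
    fix y assume "y \<in> homology_class q L z"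
    then have "y - z \<in> boundaries q L" by (simp add: mem_coset_iff)
    moreover have "z \<in> homology_class q K z"
      by (simp add: mem_coset_iff plus_subgroupD[OF boundaries_plus_subgroup])
    moreover have "y = (y - z) + z" by simp
    ultimately show "y \<in> induced_map q L (homology_class q K z)" unfolding induced_map_def by blast
  qed
qed

text \<open>Elements of persistent homology are handled through families of representing cycles. In these terms
  \<open>t\<close> merely shifts the index, because the maps induced by inclusions do not change representatives.\<close>

definition persistent_cycles :: "nat \<Rightarrow> (int \<Rightarrow> 'v::linorder set set) \<Rightarrow> (int \<Rightarrow> 'v set \<Rightarrow>\<^sub>0 'k::field) set" where
  "persistent_cycles q X = {z. (\<forall>j. z j \<in> cycles q (X j)) \<and> finite {j. z j \<noteq> 0}}"

definition persistent_class ::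
    "nat \<Rightarrow> (int \<Rightarrow> 'v::linorder set set) \<Rightarrow> (int \<Rightarrow> 'v set \<Rightarrow>\<^sub>0 'k::field) \<Rightarrow> int \<Rightarrow> ('v set \<Rightarrow>\<^sub>0 'k) set" where
  "persistent_class q X z = (\<lambda>j. homology_class q (X j) (z j))"

lemma persistent_class_eq_iff:
  "persistent_class q X z = persistent_class q X w \<longleftrightarrow> (\<forall>j. z j - w j \<in> boundaries q (X j))"
  by (simp add: persistent_class_def fun_eq_iff coset_eq_iff[OF boundaries_plus_subgroup])

lemma persistent_homology_representatives:
  fixes f :: "int \<Rightarrow> ('v::linorder set \<Rightarrow>\<^sub>0 'k::field) set"
  assumes "\<And>j. f j \<in> carrier (homology_space q (X j) :: ('k, _) module)"
    and "finite {j. f j \<noteq> \<zero>\<^bsub>homology_space q (X j) :: ('k, _) module\<^esub>}"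
  obtains z where "z \<in> persistent_cycles q X" "f = persistent_class q X z"
    "\<And>j. f j = \<zero>\<^bsub>homology_space q (X j) :: ('k, _) module\<^esub> \<Longrightarrow> z j = 0"
proof -
  have "\<exists>z. z \<in> cycles q (X j) \<and> f j = homology_class q (X j) z \<and> (f j = boundaries q (X j) \<longrightarrow> z = 0)" for j
  proof (cases "f j = boundaries q (X j)")
    case True
    then show ?thesis using plus_subgroupD(1)[OF cycles_plus_subgroup, of q "X j"]
      by (intro exI[of _ 0]) simp
  next
    case False
    then show ?thesis using assms(1)[of j] by (auto simp: homology_space_simps)
  qed
  then obtain z where z: "\<And>j. z j \<in> cycles q (X j)" "\<And>j. f j = homology_class q (X j) (z j)"
    "\<And>j. f j = boundaries q (X j) \<Longrightarrow> z j = 0" by metis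
  have "{j. z j \<noteq> 0} \<subseteq> {j. f j \<noteq> boundaries q (X j)}" using z(3) by blast
  then have "z \<in> persistent_cycles q X"
    using z(1) assms(2) unfolding homology_space_simps by (auto simp: persistent_cycles_def intro: finite_subset)
  moreover have "f = persistent_class q X z" by (rule ext) (simp only: persistent_class_def z(2))
  moreover have "z j = 0" if "f j = \<zero>\<^bsub>homology_space q (X j) :: ('k, _) module\<^esub>" for j
    using z(3) that by (simp only: homology_space_simps)
  ultimately show ?thesis by (rule that)
qed

lemma t_action_class:
  assumes "mono X"
  shows "(t_action (\<lambda>j. induced_map q (X (j + 1))) ^^ i) (persistent_class q X z) j =
    homology_class q (X j) (z (j - int i))"
proof (induction i arbitrary: j)
  case (Suc i)
  have "X (j - 1) \<subseteq> X j" by (rule monoD[OF assms]) simp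
  moreover have "j - 1 - int i = j - int (Suc i)" by simp
  ultimately show ?case using Suc[of "j - 1"]
    by (simp only: funpow.simps o_def t_action_def induced_map_class diff_add_cancel)
qed (simp add: persistent_class_def)

lemma persistent_cycles_shift:
  assumes "mono X" "z \<in> persistent_cycles q X"
  shows "z (j - int i) \<in> cycles q (X j)"
proof -
  have "X (j - int i) \<subseteq> X j" by (rule monoD[OF assms(1)]) simp
  moreover have "z (j - int i) \<in> cycles q (X (j - int i))"
    using assms(2) by (simp add: persistent_cycles_def)
  ultimately show ?thesis using cycles_mono by blast
qed

lemma persistent_homology_simps:
  fixes X :: "int \<Rightarrow> 'v::linorder set set" and k :: "'k::field itself"
  shows "carrier (persistent_homology k q X) = persistent_class q X ` persistent_cycles q X"
    and "persistent_class q X z \<oplus>\<^bsub>persistent_homology k q X\<^esub> persistent_class q X w =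
      persistent_class q X (\<lambda>j. z j + w j)"
    and "mono X \<Longrightarrow> z \<in> persistent_cycles q X \<Longrightarrow> p \<odot>\<^bsub>persistent_homology k q X\<^esub> persistent_class q X z =
      persistent_class q X (\<lambda>j. \<Sum>i\<le>Polynomial.degree p. scale (coeff p i) (z (j - int i)))"
    and "grade (persistent_homology k q X) j =
      persistent_class q X ` {z \<in> persistent_cycles q X. \<forall>i. i \<noteq> j \<longrightarrow> z i = 0}"
proof -
  let ?V = "\<lambda>j. homology_space q (X j) :: ('k, _) module"
  have class_mem: "persistent_class q X z j \<in> carrier (?V j)" "finite {j. persistent_class q X z j \<noteq> \<zero>\<^bsub>?V j\<^esub>}"
    if z: "z \<in> persistent_cycles q X" for z :: "int \<Rightarrow> 'v set \<Rightarrow>\<^sub>0 'k" and j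
  proof -
    have "{j. persistent_class q X z j \<noteq> \<zero>\<^bsub>?V j\<^esub>} \<subseteq> {j. z j \<noteq> 0}"
      by (auto simp: persistent_class_def homology_space_simps)
    then show "finite {j. persistent_class q X z j \<noteq> \<zero>\<^bsub>?V j\<^esub>}"
      using z by (auto simp: persistent_cycles_def intro: finite_subset)
    show "persistent_class q X z j \<in> carrier (?V j)"
      using z by (auto simp: persistent_cycles_def persistent_class_def homology_space_simps)
  qed
  show C: "carrier (persistent_homology k q X) = persistent_class q X ` persistent_cycles q X"
  proof (intro equalityI subsetI)
    fix f :: "int \<Rightarrow> ('v set \<Rightarrow>\<^sub>0 'k) set" assume "f \<in> carrier (persistent_homology k q X)"
    then have "\<And>j. f j \<in> carrier (?V j)" "finite {j. f j \<noteq> \<zero>\<^bsub>?V j\<^esub>}"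
      by (auto simp: persistent_homology_def persistence_module_def Let_def)
    then show "f \<in> persistent_class q X ` persistent_cycles q X"
      by (rule persistent_homology_representatives) blast
  next
    fix f :: "int \<Rightarrow> ('v set \<Rightarrow>\<^sub>0 'k) set" assume "f \<in> persistent_class q X ` persistent_cycles q X"
    then show "f \<in> carrier (persistent_homology k q X)"
      using class_mem by (auto simp: persistent_homology_def persistence_module_def Let_def)
  qed
  show "persistent_class q X z \<oplus>\<^bsub>persistent_homology k q X\<^esub> persistent_class q X w =
      persistent_class q X (\<lambda>j. z j + w j)"
    by (simp add: persistent_homology_def persistence_module_def Let_def persistent_class_def homology_space_simps)
  show "grade (persistent_homology k q X) j =
      persistent_class q X ` {z \<in> persistent_cycles q X. \<forall>i. i \<noteq> j \<longrightarrow> z i = 0}"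
  proof (intro equalityI subsetI)
    fix f :: "int \<Rightarrow> ('v set \<Rightarrow>\<^sub>0 'k) set" assume "f \<in> grade (persistent_homology k q X) j"
    then have f: "\<And>j. f j \<in> carrier (?V j)" "finite {j. f j \<noteq> \<zero>\<^bsub>?V j\<^esub>}" "\<And>i. i \<noteq> j \<Longrightarrow> f i = \<zero>\<^bsub>?V i\<^esub>"
      by (auto simp: persistent_homology_def persistence_module_def Let_def)
    show "f \<in> persistent_class q X ` {z \<in> persistent_cycles q X. \<forall>i. i \<noteq> j \<longrightarrow> z i = 0}"
      by (rule persistent_homology_representatives[OF f(1,2)]) (use f(3) in auto)
  next
    fix f :: "int \<Rightarrow> ('v set \<Rightarrow>\<^sub>0 'k) set" assume "f \<in> persistent_class q X ` {z \<in> persistent_cycles q X. \<forall>i. i \<noteq> j \<longrightarrow> z i = 0}"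
    then obtain z where z: "z \<in> persistent_cycles q X" "f = persistent_class q X z" "\<And>i. i \<noteq> j \<Longrightarrow> z i = 0" by blast
    have "f i = \<zero>\<^bsub>?V i\<^esub>" if "i \<noteq> j" for i
      using z(3)[OF that] by (simp add: z(2) persistent_class_def homology_space_simps)
    then show "f \<in> grade (persistent_homology k q X) j"
      using class_mem[OF z(1)] z(2) by (auto simp: persistent_homology_def persistence_module_def Let_def)
  qed
  assume X: "mono X" and z: "z \<in> persistent_cycles q X"
  show "p \<odot>\<^bsub>persistent_homology k q X\<^esub> persistent_class q X z =
      persistent_class q X (\<lambda>j. \<Sum>i\<le>Polynomial.degree p. scale (coeff p i) (z (j - int i)))"
  proof
    fix j
    have "z (j - int i) \<in> cycles q (X j)" for i by (rule persistent_cycles_shift[OF X z])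
    then show "(p \<odot>\<^bsub>persistent_homology k q X\<^esub> persistent_class q X z) j =
        persistent_class q X (\<lambda>j. \<Sum>i\<le>Polynomial.degree p. scale (coeff p i) (z (j - int i))) j"
      by (simp add: persistent_homology_def persistence_module_def Let_def t_action_class[OF X]
          homology_space_simps(4) homology_space_finsum cycles_scale)
        (simp add: persistent_class_def)
  qed
qed

lemma persistent_cycles_smult:
  assumes "mono X" "z \<in> persistent_cycles q X"
  shows "(\<lambda>j. \<Sum>i\<le>n. scale (c i) (z (j - int i))) \<in> persistent_cycles q X"
proof -
  have "z (j - int i) \<in> cycles q (X j)" for i j by (rule persistent_cycles_shift[OF assms])
  moreover have "{j. (\<Sum>i\<le>n. scale (c i) (z (j - int i))) \<noteq> 0} \<subseteq> (\<Union>i\<le>n. (\<lambda>j. j + int i) ` {j. z j \<noteq> 0})"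
  proof
    fix j assume "j \<in> {j. (\<Sum>i\<le>n. scale (c i) (z (j - int i))) \<noteq> 0}"
    then obtain i where "i \<le> n" "z (j - int i) \<noteq> 0"
      by (metis (mono_tags, lifting) atMost_iff mem_Collect_eq scale_zero_right sum.neutral)
    then show "j \<in> (\<Union>i\<le>n. (\<lambda>j. j + int i) ` {j. z j \<noteq> 0})"
      by (intro UN_I[of i] image_eqI[of _ _ "j - int i"]) auto
  qed
  moreover have "finite (\<Union>i\<le>n. (\<lambda>j. j + int i) ` {j. z j \<noteq> 0})"
    using assms(2) by (auto simp: persistent_cycles_def)
  ultimately show ?thesis
    unfolding persistent_cycles_def by (auto intro!: cycles_sum cycles_scale intro: finite_subset)
qed

lemma smult_monom_class:
  assumes "mono X" "z \<in> persistent_cycles q X"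
  shows "monom 1 n \<odot>\<^bsub>persistent_homology k q X\<^esub> persistent_class q X z = persistent_class q X (\<lambda>j. z (j - int n))"
proof -
  have "(\<Sum>i\<le>n. scale (if n = i then 1 else 0) (z (j - int i))) = (\<Sum>i\<le>n. if n = i then z (j - int i) else 0)" for j
    by (rule sum.cong) auto
  then show ?thesis using persistent_homology_simps(3)[OF assms, of k "monom 1 n"]
    by (simp add: degree_monom_eq if_distribR)
qed

text \<open>For \<open>0\<close> on one side, an interleaving just says that \<open>t\<^bsup>2\<eta>\<^esup>\<close> vanishes.\<close>

lemma interleaved_zero:
  fixes k :: "'k::field itself"
  assumes "mono X" and b: "\<And>j. cycles q (X j) \<subseteq> (boundaries q (X (j + 2 * int \<eta>)) :: (_ \<Rightarrow>\<^sub>0 'k) set)"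
  shows "interleaved \<eta> (persistent_homology k q X) (zero_gmodule k)"
proof -
  let ?P = "persistent_homology k q X"
  let ?z = "persistent_class q X (\<lambda>_. 0 :: _ \<Rightarrow>\<^sub>0 'k)"
  have z: "(\<lambda>_. 0) \<in> (persistent_cycles q X :: (int \<Rightarrow> _ \<Rightarrow>\<^sub>0 'k) set)"
    using plus_subgroupD(1)[OF cycles_plus_subgroup] by (auto simp: persistent_cycles_def)
  have "eta_morphism \<eta> ?P (zero_gmodule k) (\<lambda>_. ())"
    by (auto simp: eta_morphism_def zero_gmodule_def)
  moreover have "eta_morphism \<eta> (zero_gmodule k) ?P (\<lambda>_. ?z)"
    using z by (auto simp: eta_morphism_def zero_gmodule_def persistent_homology_simps[where k = k] assms(1))
  moreover have "?z = monom 1 (2 * \<eta>) \<odot>\<^bsub>?P\<^esub> x" if x: "x \<in> carrier ?P" for x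
  proof -
    obtain z where z: "x = persistent_class q X z" "z \<in> persistent_cycles q X"
      using x by (auto simp: persistent_homology_simps)
    have "z (j - 2 * int \<eta>) \<in> boundaries q (X j)" for j
      using z(2) b[of "j - 2 * int \<eta>"] by (auto simp: persistent_cycles_def)
    then have "- z (j - 2 * int \<eta>) \<in> boundaries q (X j)" for j
      by (rule plus_subgroupD(3)[OF boundaries_plus_subgroup])
    then show ?thesis
      by (simp add: z(1) smult_monom_class[OF assms(1) z(2)] persistent_class_eq_iff)
  qed
  ultimately show ?thesis
    unfolding interleaved_def by (intro exI conjI) (auto simp: zero_gmodule_def)
qed

text \<open>A cycle that lives from degree \<open>a\<close> on generates an image of \<open>t\<^sup>a k[t]\<close>.\<close>

definition free_to_homology ::
    "nat \<Rightarrow> nat \<Rightarrow> (int \<Rightarrow> 'v::linorder set set) \<Rightarrow> ('v set \<Rightarrow>\<^sub>0 'k::field) \<Rightarrow> (int \<Rightarrow>\<^sub>0 'k) \<Rightarrow> int \<Rightarrow> ('v set \<Rightarrow>\<^sub>0 'k) set" where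
  "free_to_homology \<eta> q X c x = persistent_class q X (\<lambda>j. scale (lookup x (j - int \<eta>)) c)"

lemma free_to_homology_cycles:
  assumes "mono X" "c \<in> cycles q (X a)" "keys x \<subseteq> {a..}"
  shows "(\<lambda>j. scale (lookup x (j - int \<eta>)) c) \<in> persistent_cycles q X"
proof -
  have "scale (lookup x (j - int \<eta>)) c \<in> cycles q (X j)" for j
  proof (cases "j - int \<eta> < a")
    case True
    then have "lookup x (j - int \<eta>) = 0" using assms(3) by (auto simp: keys_le_iff_lookup)
    then show ?thesis using plus_subgroupD(1)[OF cycles_plus_subgroup] by simp
  next
    case False
    then show ?thesis using cycles_mono[of "X a" "X j" q] assms by (auto simp: mono_def intro!: cycles_scale)
  qed
  moreover have "{j. scale (lookup x (j - int \<eta>)) c \<noteq> 0} \<subseteq> (\<lambda>j. j + int \<eta>) ` keys x"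
  proof
    fix j assume "j \<in> {j. scale (lookup x (j - int \<eta>)) c \<noteq> 0}"
    then have "lookup x (j - int \<eta>) \<noteq> 0" by auto
    then show "j \<in> (\<lambda>j. j + int \<eta>) ` keys x"
      by (intro image_eqI[of _ _ "j - int \<eta>"]) (auto simp: in_keys_iff)
  qed
  ultimately show ?thesis by (auto simp: persistent_cycles_def intro: finite_subset)
qed

lemma free_to_homology_morphism:
  fixes k :: "'k::field itself"
  assumes X: "mono X" and c: "c \<in> cycles q (X a)"
  shows "eta_morphism \<eta> (shifted_free k a) (persistent_homology k q X) (free_to_homology \<eta> q X c)"
  unfolding eta_morphism_def
proof (intro conjI ballI allI funcsetI subsetI)
  fix x assume "x \<in> carrier (shifted_free k a)"
  then have x: "keys x \<subseteq> {a..}" by simp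
  show "free_to_homology \<eta> q X c x \<in> carrier (persistent_homology k q X)"
    using free_to_homology_cycles[OF X c x] by (auto simp: persistent_homology_simps free_to_homology_def)
  show "free_to_homology \<eta> q X c (x \<oplus>\<^bsub>shifted_free k a\<^esub> y) =
      free_to_homology \<eta> q X c x \<oplus>\<^bsub>persistent_homology k q X\<^esub> free_to_homology \<eta> q X c y" for y
    by (simp add: free_to_homology_def persistent_homology_simps lookup_add scale_add_left)
  show "free_to_homology \<eta> q X c (p \<odot>\<^bsub>shifted_free k a\<^esub> x) = p \<odot>\<^bsub>persistent_homology k q X\<^esub> free_to_homology \<eta> q X c x" for p
    using free_to_homology_cycles[OF X c x, of \<eta>]
    by (simp add: free_to_homology_def persistent_homology_simps(3)[OF X] lookup_laurent_mult scale_sum_scalars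
        diff_diff_eq add_ac)
next
  fix j y assume "y \<in> free_to_homology \<eta> q X c ` grade (shifted_free k a) j"
  then obtain x where x: "keys x \<subseteq> {a..}" "keys x \<subseteq> {j}" "y = free_to_homology \<eta> q X c x"
    by auto
  have "scale (lookup x (i - int \<eta>)) c = 0" if "i \<noteq> j + int \<eta>" for i
    using x(2) that by (auto simp: keys_le_iff_lookup)
  then show "y \<in> grade (persistent_homology k q X) (j + int \<eta>)"
    using free_to_homology_cycles[OF X c x(1), of \<eta>]
    unfolding persistent_homology_simps x(3) free_to_homology_def by blast
qed

text \<open>The choice of a representative does not matter on homology classes, because the augmentation vanishes
  on boundaries.\<close>

definition coset_augmentation :: "('b \<Rightarrow>\<^sub>0 'r::comm_ring_1) set \<Rightarrow> 'r" where
  "coset_augmentation S = augmentation (SOME z. z \<in> S)"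

lemma coset_augmentation_class:
  "coset_augmentation (homology_class 0 K z) = (augmentation z :: 'k::field)"
proof -
  let ?z = "SOME w. w \<in> homology_class 0 K z"
  have "z \<in> homology_class 0 K z"
    using plus_subgroupD(1)[OF boundaries_plus_subgroup] by (auto simp: mem_coset_iff)
  then have "?z \<in> homology_class 0 K z" by (rule someI)
  then have "augmentation (?z - z) = 0"
    by (auto simp: mem_coset_iff boundaries_def augmentation_boundary[simplified])
  then show ?thesis by (simp add: coset_augmentation_def augmentation_simps)
qed

text \<open>The augmentation and the class of the point \<open>v\<close>, both shifted by \<open>\<eta>\<close>, form an interleaving. One composite
  is \<open>t\<^bsup>2\<eta>\<^esup>\<close> on the nose; the other one is because every 0-cycle is homologous to a multiple of \<open>v\<close> after
  \<open>2\<eta>\<close> steps.\<close>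

lemma interleaved_free:
  fixes k :: "'k::field itself" and X :: "int \<Rightarrow> 'v::linorder set set"
  assumes X: "mono X" and empty: "\<And>j. j < a \<Longrightarrow> X j = {}" and v: "{v} \<in> X a"
    and b: "\<And>j z. z \<in> cycles 0 (X j) \<Longrightarrow>
      z - scale (augmentation z) (single {v} (1 :: 'k)) \<in> boundaries 0 (X (j + 2 * int \<eta>))"
  shows "interleaved \<eta> (persistent_homology k 0 X) (shifted_free k a)"
proof -
  let ?P = "persistent_homology k 0 X"
  let ?c = "single {v} (1 :: 'k)"
  define \<phi> where "\<phi> f = Abs_poly_mapping (\<lambda>j. coset_augmentation (f (j - int \<eta>)) :: 'k)"
    for f :: "int \<Rightarrow> ('v set \<Rightarrow>\<^sub>0 'k) set"
  have twice: "j - int \<eta> - int \<eta> = j - 2 * int \<eta>" for j by simp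
  have c: "?c \<in> cycles 0 (X a)"
    using v by (simp add: cycles_def chains_def simplex_boundary_def)
  have \<phi>: "lookup (\<phi> (persistent_class 0 X z)) j = augmentation (z (j - int \<eta>))"
    if z: "z \<in> persistent_cycles 0 X" for z j
  proof -
    have "{j. augmentation (z (j - int \<eta>)) \<noteq> 0} \<subseteq> (\<lambda>j. j + int \<eta>) ` {j. z j \<noteq> 0}"
    proof
      fix j assume "j \<in> {j. augmentation (z (j - int \<eta>)) \<noteq> 0}"
      then have "z (j - int \<eta>) \<noteq> 0" by (auto simp: augmentation_simps)
      then show "j \<in> (\<lambda>j. j + int \<eta>) ` {j. z j \<noteq> 0}" by (intro image_eqI[of _ _ "j - int \<eta>"]) auto
    qed
    then have "finite {j. augmentation (z (j - int \<eta>)) \<noteq> 0}"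
      using z by (auto simp: persistent_cycles_def intro: finite_subset)
    then show ?thesis
      by (simp add: \<phi>_def persistent_class_def coset_augmentation_class)
  qed
  have zero: "z j = 0" if "z \<in> persistent_cycles 0 X" "j < a" for z :: "int \<Rightarrow> 'v set \<Rightarrow>\<^sub>0 'k" and j
    using that empty[of j] by (auto simp: persistent_cycles_def cycles_def chains_def dest!: spec[of _ j])
  have keys: "keys (\<phi> (persistent_class 0 X z)) \<subseteq> {a..}" if z: "z \<in> persistent_cycles 0 X" for z
    using zero[OF z] by (auto simp: keys_le_iff_lookup \<phi>[OF z] augmentation_simps)
  have sum: "(\<lambda>j. x j + y j) \<in> persistent_cycles 0 X" if "x \<in> persistent_cycles 0 X" "y \<in> persistent_cycles 0 X"
    for x y :: "int \<Rightarrow> 'v set \<Rightarrow>\<^sub>0 'k"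
  proof -
    have "{j. x j + y j \<noteq> 0} \<subseteq> {j. x j \<noteq> 0} \<union> {j. y j \<noteq> 0}" by auto
    then show ?thesis using that
      by (auto simp: persistent_cycles_def intro: finite_subset plus_subgroupD(4)[OF cycles_plus_subgroup])
  qed
  have "eta_morphism \<eta> ?P (shifted_free k a) \<phi>"
    unfolding eta_morphism_def
  proof (intro conjI ballI allI funcsetI subsetI)
    fix x assume "x \<in> carrier ?P"
    then obtain z where z: "z \<in> persistent_cycles 0 X" "x = persistent_class 0 X z"
      by (auto simp: persistent_homology_simps)
    show "\<phi> x \<in> carrier (shifted_free k a)" using keys[OF z(1)] by (simp add: z(2))
    show "\<phi> (p \<odot>\<^bsub>?P\<^esub> x) = p \<odot>\<^bsub>shifted_free k a\<^esub> \<phi> x" for p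
      unfolding z(2) persistent_homology_simps(3)[OF X z(1)]
      by (rule poly_mapping_eqI)
        (simp add: \<phi>[OF persistent_cycles_smult[OF X z(1)]] \<phi>[OF z(1)] lookup_laurent_mult
          augmentation_sum augmentation_simps diff_diff_eq add_ac)
    fix y assume "y \<in> carrier ?P"
    then obtain w where w: "w \<in> persistent_cycles 0 X" "y = persistent_class 0 X w"
      by (auto simp: persistent_homology_simps)
    show "\<phi> (x \<oplus>\<^bsub>?P\<^esub> y) = \<phi> x \<oplus>\<^bsub>shifted_free k a\<^esub> \<phi> y"
      unfolding z(2) w(2) persistent_homology_simps(2)
      by (rule poly_mapping_eqI)
        (simp add: \<phi>[OF z(1)] \<phi>[OF w(1)] \<phi>[OF sum[OF z(1) w(1)]] augmentation_simps lookup_add)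
  next
    fix j y assume "y \<in> \<phi> ` grade ?P j"
    then obtain z where z: "z \<in> persistent_cycles 0 X" "\<And>i. i \<noteq> j \<Longrightarrow> z i = 0" "y = \<phi> (persistent_class 0 X z)"
      by (auto simp: persistent_homology_simps)
    have "keys y \<subseteq> {j + int \<eta>}"
      unfolding keys_le_iff_lookup z(3) \<phi>[OF z(1)] using z(2) by (auto simp: augmentation_simps)
    then show "y \<in> grade (shifted_free k a) (j + int \<eta>)" using keys[OF z(1)] by (simp add: z(3))
  qed
  moreover have "eta_morphism \<eta> (shifted_free k a) ?P (free_to_homology \<eta> 0 X ?c)"
    by (rule free_to_homology_morphism[OF X c])
  moreover have "\<phi> (free_to_homology \<eta> 0 X ?c y) = monom 1 (2 * \<eta>) \<odot>\<^bsub>shifted_free k a\<^esub> y"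
    if "y \<in> carrier (shifted_free k a)" for y
  proof -
    have y: "keys y \<subseteq> {a..}" using that by simp
    show ?thesis unfolding free_to_homology_def
      by (rule poly_mapping_eqI, subst \<phi>[OF free_to_homology_cycles[OF X c y, of \<eta>]])
        (simp add: augmentation_simps laurent_of_poly_monom lookup_single_mult twice del: scale_single)
  qed
  moreover have "free_to_homology \<eta> 0 X ?c (\<phi> x) = monom 1 (2 * \<eta>) \<odot>\<^bsub>?P\<^esub> x" if x: "x \<in> carrier ?P" for x
  proof -
    obtain z where z: "z \<in> persistent_cycles 0 X" "x = persistent_class 0 X z"
      using x by (auto simp: persistent_homology_simps)
    have "scale (augmentation (z (j - 2 * int \<eta>))) ?c - z (j - 2 * int \<eta>) \<in> boundaries 0 (X j)" for j
      using plus_subgroupD(3)[OF boundaries_plus_subgroup b[of "z (j - 2 * int \<eta>)" "j - 2 * int \<eta>"]] z(1)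
      by (simp add: persistent_cycles_def)
    then show ?thesis
      by (simp add: z(2) smult_monom_class[OF X z(1)] free_to_homology_def persistent_class_eq_iff \<phi>[OF z(1)]
          twice del: scale_single)
  qed
  ultimately show ?thesis unfolding interleaved_def by blast
qed

text \<open>The map from the free module on \<open>c\<close> is onto by the assumption on cycles inside the interval, and its
  kernel begins exactly in degree \<open>b\<close>.\<close>

lemma persistent_homology_interval:
  fixes k :: "'k::field itself" and X :: "int \<Rightarrow> 'v::linorder set set" and c :: "'v set \<Rightarrow>\<^sub>0 'k"
  assumes X: "mono X" and c: "c \<in> cycles q (X a)"
    and below: "\<And>j. j < a \<Longrightarrow> X j = {}"
    and inside: "\<And>j z. a \<le> j \<Longrightarrow> j < b \<Longrightarrow> z \<in> cycles q (X j) \<Longrightarrow> \<exists>s. z - scale s c \<in> boundaries q (X j)"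
    and nonzero: "\<And>j s. a \<le> j \<Longrightarrow> j < b \<Longrightarrow> scale s c \<in> boundaries q (X j) \<Longrightarrow> s = 0"
    and above: "\<And>j. b \<le> j \<Longrightarrow> cycles q (X j) \<subseteq> (boundaries q (X j) :: ('v set \<Rightarrow>\<^sub>0 'k) set)"
  shows "interval_module k a b \<cong>\<^sub>g persistent_homology k q X"
  unfolding interval_module_eq
proof (rule graded_quotient_iso[OF shifted_free_plus_module shifted_free_submodule shifted_free_closed,
      where f = "free_to_homology 0 q X c"])
  note B = plus_subgroupD[OF boundaries_plus_subgroup]
  show "eta_morphism 0 (shifted_free k a) (persistent_homology k q X) (free_to_homology 0 q X c)"
    by (rule free_to_homology_morphism[OF X c])
  have zero: "z j = 0" if "z \<in> persistent_cycles q X" "j < a" for z :: "int \<Rightarrow> 'v set \<Rightarrow>\<^sub>0 'k" and j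
    using that below[of j] by (auto simp: persistent_cycles_def cycles_def chains_def dest!: spec[of _ j])
  have onto: "\<exists>x. keys x \<subseteq> {a..} \<and> free_to_homology 0 q X c x = persistent_class q X z \<and>
      keys x \<subseteq> {j. z j \<noteq> 0}" if z: "z \<in> persistent_cycles q X" for z
  proof -
    have "\<exists>s. z j - scale s c \<in> boundaries q (X j) \<and> (z j = 0 \<longrightarrow> s = 0)" if "a \<le> j" "j < b" for j
    proof (cases "z j = 0")
      case False
      have "z j \<in> cycles q (X j)" using z by (simp add: persistent_cycles_def)
      then show ?thesis using inside[OF that] False by blast
    qed (auto simp: B)
    then obtain s where s: "\<And>j. a \<le> j \<Longrightarrow> j < b \<Longrightarrow> z j - scale (s j) c \<in> boundaries q (X j)"
      "\<And>j. a \<le> j \<Longrightarrow> j < b \<Longrightarrow> z j = 0 \<Longrightarrow> s j = 0" by metis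
    define x where "x = Abs_poly_mapping (\<lambda>j. if a \<le> j \<and> j < b then s j else 0)"
    have "{j. (if a \<le> j \<and> j < b then s j else 0) \<noteq> 0} \<subseteq> {a..<b}" by auto
    then have "finite {j. (if a \<le> j \<and> j < b then s j else 0) \<noteq> 0}" by (rule finite_subset) simp
    then have x: "lookup x j = (if a \<le> j \<and> j < b then s j else 0)" for j
      by (simp add: x_def)
    have "scale (lookup x j) c - z j \<in> boundaries q (X j)" for j
    proof -
      consider "j < a" | "a \<le> j" "j < b" | "b \<le> j" by linarith
      then show ?thesis
      proof cases
        case 1
        then show ?thesis using zero[OF z] by (simp add: x B)
      next
        case 2
        then show ?thesis using B(3)[OF s(1)[of j]] by (simp add: x)
      next
        case 3
        then have "z j \<in> boundaries q (X j)" using above z by (auto simp: persistent_cycles_def)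
        then show ?thesis using 3 by (simp add: x B)
      qed
    qed
    then have "free_to_homology 0 q X c x = persistent_class q X z"
      by (simp add: free_to_homology_def persistent_class_eq_iff)
    moreover have "keys x \<subseteq> {a..}" "keys x \<subseteq> {j. z j \<noteq> 0}"
      using s(2) by (auto simp: keys_le_iff_lookup x)
    ultimately show ?thesis by blast
  qed
  show "carrier (persistent_homology k q X) \<subseteq> free_to_homology 0 q X c ` carrier (shifted_free k a)"
    using onto by (force simp: persistent_homology_simps)
  show "grade (persistent_homology k q X) j \<subseteq> free_to_homology 0 q X c ` grade (shifted_free k a) j" for j
  proof
    fix y assume "y \<in> grade (persistent_homology k q X) j"
    then obtain z where z: "z \<in> persistent_cycles q X" "\<And>i. i \<noteq> j \<Longrightarrow> z i = 0" "y = persistent_class q X z"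
      by (auto simp: persistent_homology_simps)
    obtain x where x: "keys x \<subseteq> {a..}" "free_to_homology 0 q X c x = y"
        "keys x \<subseteq> {j. z j \<noteq> 0}"
      using onto[OF z(1)] z(3) by blast
    have "keys x \<subseteq> {j}" using x(3) z(2) by blast
    then show "y \<in> free_to_homology 0 q X c ` grade (shifted_free k a) j"
      using x by (intro image_eqI[of _ _ x]) auto
  qed
  fix x y assume "x \<in> carrier (shifted_free k a)" "y \<in> carrier (shifted_free k a)"
  then have xy: "keys (x - y) \<subseteq> {a..}" by (simp add: keys_diff_le)
  have "free_to_homology 0 q X c x = free_to_homology 0 q X c y \<longleftrightarrow>
      (\<forall>j. scale (lookup (x - y) j) c \<in> boundaries q (X j))"
    by (simp add: free_to_homology_def persistent_class_eq_iff lookup_minus scale_diff_left)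
  also have "\<dots> \<longleftrightarrow> (\<forall>j. j < b \<longrightarrow> lookup (x - y) j = 0)"
  proof (intro iffI allI impI)
    fix j assume "\<forall>j. scale (lookup (x - y) j) c \<in> boundaries q (X j)" "j < b"
    then show "lookup (x - y) j = 0"
      using nonzero[of j "lookup (x - y) j"] xy by (cases "a \<le> j") (auto simp: keys_le_iff_lookup)
  next
    fix j assume lt: "\<forall>j. j < b \<longrightarrow> lookup (x - y) j = 0"
    show "scale (lookup (x - y) j) c \<in> boundaries q (X j)"
    proof (cases "j < b")
      case False
      have "scale (lookup (x - y) j) c \<in> cycles q (X j)"
        using free_to_homology_cycles[OF X c xy, of 0] by (simp add: persistent_cycles_def)
      then show ?thesis using above[of j] False by auto
    qed (use lt in \<open>simp add: B\<close>)
  qed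
  finally show "free_to_homology 0 q X c x = free_to_homology 0 q X c y \<longleftrightarrow> x - y \<in> {x. keys x \<subseteq> {b..}}"
    by (auto simp: keys_le_iff_lookup)
qed

section \<open>The cover is 1-acyclic\<close>

text \<open>It suffices that a simplex can be coned off after \<open>2\<eta>\<close> more steps.\<close>

lemma acyclic_by_cone:
  fixes k :: "'k::field itself" and X :: "int \<Rightarrow> 'v::linorder set set"
  assumes X: "mono X" "\<And>j. simplicial_complex (X j)"
    and a: "\<And>j. j < a \<Longrightarrow> X j = {}" "{v} \<in> X a"
    and v: "\<And>j \<sigma>. \<sigma> \<in> X j \<Longrightarrow> insert v \<sigma> \<in> X (j + 2 * int \<eta>)"
  shows "interleaved \<eta> (persistent_homology k 0 X) (shifted_free k a)"
    and "q > 0 \<Longrightarrow> interleaved \<eta> (persistent_homology k q X) (zero_gmodule k)"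
proof -
  have k: "\<sigma> \<in> X j" if "\<sigma> \<in> keys z" "z \<in> cycles q (X j)" for \<sigma> q j and z :: "_ \<Rightarrow>\<^sub>0 'k"
    using that by (auto simp: cycles_def chains_def)
  show "interleaved \<eta> (persistent_homology k 0 X) (shifted_free k a)"
  proof (rule interleaved_free[OF X(1) a])
    fix j and z :: "_ \<Rightarrow>\<^sub>0 'k" assume z: "z \<in> cycles 0 (X j)"
    show "z - scale (augmentation z) (single {v} 1) \<in> boundaries 0 (X (j + 2 * int \<eta>))"
      using cone_off[OF z X(2), of v "X (j + 2 * int \<eta>)"] v k[OF _ z] by simp
  qed
  assume q: "q > 0"
  show "interleaved \<eta> (persistent_homology k q X) (zero_gmodule k)"
  proof (rule interleaved_zero[OF X(1)], rule subsetI)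
    fix j and z :: "_ \<Rightarrow>\<^sub>0 'k" assume z: "z \<in> cycles q (X j)"
    show "z \<in> boundaries q (X (j + 2 * int \<eta>))"
      using cone_off[OF z X(2), of v "X (j + 2 * int \<eta>)"] v k[OF _ z] q by simp
  qed
qed

text \<open>In a simplex that contains \<open>0\<close> and \<open>D + 2\<close>, the missing indices \<open>i \<in> {1..D + 1}\<close> are those with \<open>\<sigma> \<in> U\<^sub>i\<close>,
  so that it is born in degree \<open>2 * i\<close> for the least of them. The other simplices appear in degree \<open>0\<close>
  or \<open>- 2 * D\<close>, depending on whether they contain \<open>0\<close>. This also covers the top degrees, since no simplex
  contains all of \<open>{1..D + 1}\<close>.\<close>

lemma mem_ex_X_filt:
  "\<sigma> \<in> ex_X_filt D m \<longleftrightarrow> \<sigma> \<in> ex_X D \<and> - 2 * int D \<le> m \<and>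
    (0 \<notin> \<sigma> \<or> (0 \<le> m \<and> (D + 2 \<notin> \<sigma> \<or> (\<exists>i\<in>{1..D + 1}. 2 * int i \<le> m \<and> i \<notin> \<sigma>))))"
proof (cases "\<sigma> \<in> ex_X D")
  case True
  then have X: "\<sigma> \<subseteq> {0..D + 3}" "\<not> {1..D + 1} \<subseteq> \<sigma>" "D + 2 \<in> \<sigma> \<Longrightarrow> D + 3 \<notin> \<sigma>"
    by (auto simp: ex_X_def)
  have U0: "\<sigma> \<in> ex_U D 0 \<longleftrightarrow> D + 2 \<notin> \<sigma>"
  proof -
    have "{0..D + 3} - {D + 2} = {0..D + 1} \<union> {D + 3}" by auto
    then have "\<sigma> \<subseteq> {0..D + 1} \<union> {D + 3} \<longleftrightarrow> D + 2 \<notin> \<sigma>" using X(1) by blast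
    then show ?thesis using True by (simp add: ex_U_def full_subcomplex_def)
  qed
  have Ui: "\<sigma> \<in> ex_U D i \<longleftrightarrow> D + 3 \<notin> \<sigma> \<and> i \<notin> \<sigma>" if "i \<noteq> 0" for i
  proof -
    have "{0..D + 3} - {D + 3} = {0..D + 2}" by auto
    then have "\<sigma> \<subseteq> {0..D + 2} \<longleftrightarrow> D + 3 \<notin> \<sigma>" using X(1) by blast
    then show ?thesis using True that by (auto simp: ex_U_def full_subcomplex_def)
  qed
  have union: "\<sigma> \<in> (\<Union>i\<in>{0..n}. ex_U D i) \<longleftrightarrow> D + 2 \<notin> \<sigma> \<or> (\<exists>i\<in>{1..n}. i \<notin> \<sigma>)" for n
  proof -
    have "\<sigma> \<in> (\<Union>i\<in>{0..n}. ex_U D i) \<longleftrightarrow> \<sigma> \<in> ex_U D 0 \<or> (\<exists>i\<in>{1..n}. \<sigma> \<in> ex_U D i)"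
      by (force simp: Suc_le_eq)
    also have "\<dots> \<longleftrightarrow> D + 2 \<notin> \<sigma> \<or> (\<exists>i\<in>{1..n}. D + 3 \<notin> \<sigma> \<and> i \<notin> \<sigma>)"
      using U0 Ui by auto
    finally show ?thesis using X(3) by blast
  qed
  consider "m < - 2 * int D" | "- 2 * int D \<le> m" "m < 0" | "0 \<le> m" "m < 2 * int D + 2" | "2 * int D + 2 \<le> m"
    by linarith
  then show ?thesis
  proof cases
    case 3
    have "i \<in> {1..nat (m div 2)} \<longleftrightarrow> i \<in> {1..D + 1} \<and> 2 * int i \<le> m" for i
      using 3 by auto
    then show ?thesis using True 3 union[of "nat (m div 2)"]
      by (auto simp: ex_X_filt_def ex_A_def)
  next
    case 4
    then have "\<exists>i\<in>{1..D + 1}. 2 * int i \<le> m \<and> i \<notin> \<sigma>" using X(2) by force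
    then show ?thesis using 4 True by (auto simp: ex_X_filt_def)
  qed (use True in \<open>auto simp: ex_X_filt_def ex_A_def\<close>)
next
  case False
  then show ?thesis by (auto simp: ex_X_filt_def ex_A_def ex_U_def full_subcomplex_def)
qed

lemma mem_ex_U_filt:
  "\<sigma> \<in> ex_U_filt D i m \<longleftrightarrow> \<sigma> \<in> ex_X_filt D m \<and> (if i = 0 then D + 2 \<notin> \<sigma> else D + 3 \<notin> \<sigma> \<and> i \<notin> \<sigma>)"
proof (cases "\<sigma> \<in> ex_X D")
  case True
  then have X: "\<sigma> \<subseteq> {0..D + 3}" by (auto simp: ex_X_def)
  have "{0..D + 3} - {D + 2} = {0..D + 1} \<union> {D + 3}" "{0..D + 3} - {D + 3} = {0..D + 2}" by auto
  then have "\<sigma> \<subseteq> {0..D + 1} \<union> {D + 3} \<longleftrightarrow> D + 2 \<notin> \<sigma>" "\<sigma> \<subseteq> {0..D + 2} \<longleftrightarrow> D + 3 \<notin> \<sigma>"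
    using X by blast+
  then show ?thesis using True by (auto simp: ex_U_filt_def ex_U_def full_subcomplex_def)
next
  case False
  then show ?thesis by (auto simp: ex_U_filt_def ex_U_def full_subcomplex_def mem_ex_X_filt)
qed

lemma mem_cover_inter:
  assumes "I \<noteq> {}"
  shows "\<sigma> \<in> cover_inter (ex_U_filt D) I m \<longleftrightarrow> \<sigma> \<in> ex_X_filt D m \<and>
    (0 \<in> I \<longrightarrow> D + 2 \<notin> \<sigma>) \<and> (\<forall>i\<in>I. i \<noteq> 0 \<longrightarrow> D + 3 \<notin> \<sigma> \<and> i \<notin> \<sigma>)"
  using assms by (auto simp: cover_inter_def mem_ex_U_filt split: if_splits)

lemma ex_X_face: "\<sigma> \<in> ex_X D \<Longrightarrow> \<tau> \<subseteq> \<sigma> \<Longrightarrow> \<tau> \<noteq> {} \<Longrightarrow> \<tau> \<in> ex_X D"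
  unfolding ex_X_def by blast

lemma ex_X_finite: "\<sigma> \<in> ex_X D \<Longrightarrow> finite \<sigma>"
  unfolding ex_X_def using finite_subset by blast

lemma ex_X_filt_face: "\<sigma> \<in> ex_X_filt D m \<Longrightarrow> \<tau> \<subseteq> \<sigma> \<Longrightarrow> \<tau> \<noteq> {} \<Longrightarrow> \<tau> \<in> ex_X_filt D m"
  unfolding mem_ex_X_filt using ex_X_face by blast

lemma ex_X_filt_simplicial: "simplicial_complex (ex_X_filt D m)"
  unfolding simplicial_complex_def
proof (intro ballI conjI allI impI)
  fix \<sigma> assume \<sigma>: "\<sigma> \<in> ex_X_filt D m"
  then have X: "\<sigma> \<in> ex_X D" by (simp add: mem_ex_X_filt)
  show "finite \<sigma>" by (rule ex_X_finite[OF X])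
  show "\<sigma> \<noteq> {}" using X by (simp add: ex_X_def)
  show "\<tau> \<in> ex_X_filt D m" if "\<tau> \<subseteq> \<sigma> \<and> \<tau> \<noteq> {}" for \<tau>
    using ex_X_filt_face[OF \<sigma>] that by blast
qed

lemma ex_X_filt_mono: "mono (ex_X_filt D)"
  unfolding mono_def subset_iff mem_ex_X_filt by (meson order_trans)

lemma ex_X_filt_below: "m < - 2 * int D \<Longrightarrow> ex_X_filt D m = {}"
  by (auto simp: mem_ex_X_filt)

lemma ex_U_filt_face:
  assumes "\<sigma> \<in> ex_U_filt D i m" "\<tau> \<subseteq> \<sigma>" "\<tau> \<noteq> {}"
  shows "\<tau> \<in> ex_U_filt D i m"
proof -
  have "\<tau> \<in> ex_X_filt D m" using assms ex_X_filt_face[of \<sigma> D m \<tau>] by (auto simp: mem_ex_U_filt)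
  then show ?thesis using assms(1,2) by (auto simp: mem_ex_U_filt split: if_splits)
qed

lemma cover_inter_simplicial:
  assumes "I \<noteq> {}"
  shows "simplicial_complex (cover_inter (ex_U_filt D) I m)"
  unfolding simplicial_complex_def
proof (intro ballI conjI allI impI)
  fix \<sigma> assume \<sigma>: "\<sigma> \<in> cover_inter (ex_U_filt D) I m"
  then have X: "\<sigma> \<in> ex_X D" using assms by (simp add: mem_cover_inter mem_ex_X_filt)
  show "finite \<sigma>" by (rule ex_X_finite[OF X])
  show "\<sigma> \<noteq> {}" using X by (simp add: ex_X_def)
  show "\<tau> \<in> cover_inter (ex_U_filt D) I m" if "\<tau> \<subseteq> \<sigma> \<and> \<tau> \<noteq> {}" for \<tau>
    using ex_U_filt_face \<sigma> that by (simp add: cover_inter_def) blast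
qed

lemma cover_inter_single: "cover_inter U {i} = U i"
  by (simp add: cover_inter_def)

lemma cover_inter_mono: "mono (cover_inter (ex_U_filt D) I)"
proof (rule monoI)
  fix m n :: int assume "m \<le> n"
  then have "ex_U_filt D i m \<subseteq> ex_U_filt D i n" for i
    using monoD[OF ex_X_filt_mono[of D]] unfolding ex_U_filt_def by (intro Int_mono) auto
  then show "cover_inter (ex_U_filt D) I m \<subseteq> cover_inter (ex_U_filt D) I n"
    unfolding cover_inter_def by (rule INF_mono')
qed

lemma ex_filtered_cover: "filtered_cover (ex_X_filt D) {0..D + 1} (ex_U_filt D)"
proof -
  have "ex_X_filt D (- 2 * int D - 1) = {}" by (rule ex_X_filt_below) simp
  then have "(\<Inter>j. ex_X_filt D j) = {}" by blast
  moreover have "(\<Inter>j. ex_U_filt D i j) = {}" for i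
    using \<open>(\<Inter>j. ex_X_filt D j) = {}\<close> by (auto simp: ex_U_filt_def)
  moreover have "ex_X_filt D j = (\<Union>i\<in>{0..D + 1}. ex_U_filt D i j)" for j
  proof (intro equalityI subsetI)
    fix \<sigma> assume \<sigma>: "\<sigma> \<in> ex_X_filt D j"
    then have X: "\<not> {1..D + 1} \<subseteq> \<sigma>" "\<not> {D + 2, D + 3} \<subseteq> \<sigma>" by (auto simp: mem_ex_X_filt ex_X_def)
    show "\<sigma> \<in> (\<Union>i\<in>{0..D + 1}. ex_U_filt D i j)"
    proof (cases "D + 2 \<in> \<sigma>")
      case True
      obtain i where "i \<in> {1..D + 1}" "i \<notin> \<sigma>" using X(1) by blast
      then show ?thesis using True X(2) \<sigma> by (intro UN_I[of i]) (auto simp: mem_ex_U_filt)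
    next
      case False
      then show ?thesis using \<sigma> by (intro UN_I[of 0]) (auto simp: mem_ex_U_filt)
    qed
  qed (auto simp: mem_ex_U_filt)
  ultimately show ?thesis
    unfolding filtered_cover_def filtered_complex_def
    by (intro conjI ballI allI ex_X_filt_simplicial ex_X_filt_mono
        cover_inter_simplicial[of "{_}", unfolded cover_inter_single]
        cover_inter_mono[of _ "{_}", unfolded cover_inter_single]) simp_all
qed

text \<open>The apex is the largest vertex \<open>v\<close> of \<open>{1..D + 1} - I\<close> if there is one. Adding \<open>v\<close> can delay the birth of a simplex
  only if \<open>v\<close> was its least missing index. But \<open>v + 1\<close>, which belongs to \<open>I\<close> by maximality, is missing
  as well, so the delay is at most 2. If there is no such vertex, \<open>D + 2\<close> serves, again with a delay of at most 2
  because \<open>1 \<in> I\<close>. The index sets \<open>{0}\<close> and \<open>{0..D + 1}\<close> need apices of their own; for the latter \<open>U\<^sub>I\<close> is a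
  point born in degree 0.\<close>

lemma ex_apex:
  assumes D: "D \<ge> 1" and I: "I \<subseteq> {0..D + 1}" "I \<noteq> {}"
  obtains v a where "{v} \<in> cover_inter (ex_U_filt D) I a"
    "\<And>j. j < a \<Longrightarrow> cover_inter (ex_U_filt D) I j = {}"
    "\<And>j \<sigma>. \<sigma> \<in> cover_inter (ex_U_filt D) I j \<Longrightarrow> insert v \<sigma> \<in> cover_inter (ex_U_filt D) I (j + 2)"
proof -
  note mem = mem_cover_inter I(2) mem_ex_X_filt
  have point: "\<not> {1..D + 1} \<subseteq> {v}" for v
  proof
    assume "{1..D + 1} \<subseteq> {v}"
    then have "card {1..D + 1} \<le> card {v}" by (intro card_mono) auto
    then show False using D by simp
  qed
  have below: "cover_inter (ex_U_filt D) I j = {}" if "j < - 2 * int D" for j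
    using that by (auto simp: mem)
  consider "I = {0}" | "I = {0..D + 1}" | "I \<noteq> {0}" "I \<noteq> {0..D + 1}" by blast
  then show ?thesis
  proof cases
    case 1
    show ?thesis
    proof (rule that[of "D + 3" "- 2 * int D"])
      show "{D + 3} \<in> cover_inter (ex_U_filt D) I (- 2 * int D)"
        using point 1 by (auto simp: mem ex_X_def)
      fix j \<sigma> assume "\<sigma> \<in> cover_inter (ex_U_filt D) I j"
      then have \<sigma>: "\<sigma> \<in> ex_X D" "D + 2 \<notin> \<sigma>" "- 2 * int D \<le> j" "0 \<in> \<sigma> \<Longrightarrow> 0 \<le> j" using 1 by (auto simp: mem)
      have "insert (D + 3) \<sigma> \<in> ex_X D" using \<sigma>(1,2) by (auto simp: ex_X_def)
      then show "insert (D + 3) \<sigma> \<in> cover_inter (ex_U_filt D) I (j + 2)"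
        using \<sigma> 1 by (auto simp: mem)
    qed (rule below)
  next
    case 2
    have only: "\<sigma> = {0} \<and> 0 \<le> j" if "\<sigma> \<in> cover_inter (ex_U_filt D) I j" for \<sigma> j
    proof -
      have \<sigma>: "\<sigma> \<noteq> {}" "\<sigma> \<subseteq> {0..D + 3}" "D + 2 \<notin> \<sigma>" "D + 3 \<notin> \<sigma>" "\<And>i. i \<in> {1..D + 1} \<Longrightarrow> i \<notin> \<sigma>"
          "0 \<in> \<sigma> \<Longrightarrow> 0 \<le> j"
        using that 2 D by (auto simp: mem ex_X_def)
      have "x = 0" if "x \<in> \<sigma>" for x
      proof (rule ccontr)
        assume "x \<noteq> 0"
        moreover have "x \<le> D + 3" "x \<noteq> D + 2" "x \<noteq> D + 3" "\<not> (1 \<le> x \<and> x \<le> D + 1)"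
          using \<sigma>(2-5) that by auto
        ultimately show False by linarith
      qed
      then have "\<sigma> = {0}" using \<sigma>(1) by blast
      then show ?thesis using \<sigma>(6) by simp
    qed
    show ?thesis
    proof (rule that[of 0 0])
      show 0: "{0} \<in> cover_inter (ex_U_filt D) I 0" using point 2 by (auto simp: mem ex_X_def)
      show "cover_inter (ex_U_filt D) I j = {}" if "j < 0" for j using only[of _ j] that by fastforce
      fix j \<sigma> assume "\<sigma> \<in> cover_inter (ex_U_filt D) I j"
      then have "\<sigma> = {0}" "0 \<le> j" using only by blast+
      then show "insert 0 \<sigma> \<in> cover_inter (ex_U_filt D) I (j + 2)"
        using monoD[OF cover_inter_mono[of D I], of 0 "j + 2"] 0 by auto
    qed
  next
    case 3
    define J where "J = {1..D + 1} - I"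
    define v where "v = (if J = {} then D + 2 else Max J)"
    \<comment> \<open>this index keeps \<open>insert v \<sigma>\<close> from containing \<open>{1..D + 1}\<close>, and replaces \<open>v + 1\<close> when \<open>v = D + 1\<close>\<close>
    obtain i0 where i0: "i0 \<in> I" "i0 \<noteq> 0" "i0 \<le> D + 1" using 3 I by force
    have finJ: "finite J" by (simp add: J_def)
    have vJ: "v \<in> J \<and> v \<in> {1..D + 1} \<and> v \<notin> I" if "J \<noteq> {}"
      using Max_in[OF finJ that] that by (auto simp: v_def J_def)
    have I0: "0 \<notin> I" if "J = {}"
    proof
      assume 0: "0 \<in> I"
      have "{0..D + 1} \<subseteq> I"
      proof
        fix x assume "x \<in> {0..D + 1}"
        moreover have "x \<notin> J" using that by simp
        ultimately show "x \<in> I" using 0 by (cases "x = 0") (auto simp: J_def)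
      qed
      then show False using 3(2) I(1) by (simp add: subset_antisym)
    qed
    have v: "v \<noteq> 0" "v \<notin> I" "v \<noteq> D + 3" "v \<le> D + 3" "0 \<in> I \<Longrightarrow> v \<noteq> D + 2"
      using vJ I I0 by (cases "J = {}"; auto simp: v_def)+
    have X: "insert v \<sigma> \<in> ex_X D" if "\<sigma> \<in> ex_X D \<or> \<sigma> = {}" "D + 3 \<notin> \<sigma>" "i0 \<notin> \<sigma>" for \<sigma>
    proof -
      have "i0 \<notin> insert v \<sigma>" "D + 3 \<notin> insert v \<sigma>" "insert v \<sigma> \<subseteq> {0..D + 3}" "i0 \<in> {1..D + 1}"
        using that i0 v by (auto simp: ex_X_def)
      then show ?thesis unfolding ex_X_def by blast
    qed
    show ?thesis
    proof (rule that[of v "- 2 * int D"])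
      show "{v} \<in> cover_inter (ex_U_filt D) I (- 2 * int D)"
        using X[of "{}"] v by (auto simp: mem)
      fix j \<sigma> assume "\<sigma> \<in> cover_inter (ex_U_filt D) I j"
      then have \<sigma>: "\<sigma> \<in> ex_X D" "- 2 * int D \<le> j" "0 \<in> I \<Longrightarrow> D + 2 \<notin> \<sigma>" "D + 3 \<notin> \<sigma>"
          "\<And>i. i \<in> I \<Longrightarrow> i \<noteq> 0 \<Longrightarrow> i \<notin> \<sigma>"
          "0 \<notin> \<sigma> \<or> (0 \<le> j \<and> (D + 2 \<notin> \<sigma> \<or> (\<exists>i\<in>{1..D + 1}. 2 * int i \<le> j \<and> i \<notin> \<sigma>)))"
        using i0 by (auto simp: mem)
      have step: "D + 2 \<notin> insert v \<sigma> \<or> (\<exists>i\<in>{1..D + 1}. 2 * int i \<le> j + 2 \<and> i \<notin> insert v \<sigma>)" if zero: "0 \<in> \<sigma>"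
      proof (cases "J = {}")
        case True
        then have "1 \<in> I" "v = D + 2" by (auto simp: J_def v_def)
        then show ?thesis using \<sigma>(5)[of 1] \<sigma>(6) that by (intro disjI2 bexI[of _ 1]) auto
      next
        case False
        show ?thesis
        proof (cases "D + 2 \<in> \<sigma>")
          case True
          then obtain i where i: "i \<in> {1..D + 1}" "2 * int i \<le> j" "i \<notin> \<sigma>" using \<sigma>(6) zero by blast
          show ?thesis
          proof (cases "i = v")
            case iv: True
            show ?thesis
            proof (cases "v = D + 1")
              case True
              then show ?thesis using i iv i0 \<sigma>(5)[OF i0(1,2)] v(2)
                by (intro disjI2 bexI[of _ i0]) auto
            next
              case v1: False
              have "v + 1 \<notin> J"
              proof
                assume "v + 1 \<in> J"
                then have "v + 1 \<le> Max J" by (rule Max_ge[OF finJ])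
                then show False using False by (simp add: v_def)
              qed
              then have "v + 1 \<in> I" using vJ[OF False] v1 by (auto simp: J_def)
              then show ?thesis using i iv v1 \<sigma>(5)[of "v + 1"] vJ[OF False]
                by (intro disjI2 bexI[of _ "v + 1"]) auto
            qed
          qed (intro disjI2 bexI[of _ i], use i in auto)
        qed (use vJ[OF False] in auto)
      qed
      then show "insert v \<sigma> \<in> cover_inter (ex_U_filt D) I (j + 2)"
        using X[of \<sigma>] \<sigma> v i0 by (auto simp: mem)
    qed (rule below)
  qed
qed

theorem ex_acyclic_cover:
  fixes k :: "'k::field itself"
  assumes "D \<ge> 1"
  shows "acyclic_cover k 1 (ex_X_filt D) {0..D + 1} (ex_U_filt D)"
  unfolding acyclic_cover_def
proof (intro conjI allI impI ex_filtered_cover)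
  fix I assume I: "I \<subseteq> {0..D + 1} \<and> finite I \<and> I \<noteq> {} \<and> total (cover_inter (ex_U_filt D) I) \<noteq> {}"
  let ?U = "cover_inter (ex_U_filt D) I"
  have U: "mono ?U" "\<And>j. simplicial_complex (?U j)"
    using I by (simp_all add: cover_inter_mono cover_inter_simplicial)
  obtain v a where va: "{v} \<in> ?U a" "\<And>j. j < a \<Longrightarrow> ?U j = {}" "\<And>j \<sigma>. \<sigma> \<in> ?U j \<Longrightarrow> insert v \<sigma> \<in> ?U (j + 2 * int 1)"
    using ex_apex[OF assms, of I] I by (metis mult.right_neutral of_nat_1)
  have "interleaved 1 (persistent_homology k 0 ?U) (shifted_free k a)"
    by (rule acyclic_by_cone(1)[OF U va(2,1,3)])
  then show "\<exists>a. interleaved 1 (persistent_homology k 0 ?U) (shifted_free k a)" by blast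
  show "interleaved 1 (persistent_homology k q ?U) (zero_gmodule k)" if "0 < q" for q
    by (rule acyclic_by_cone(2)[OF U va(2,1,3)]) (use that in auto)
qed

section \<open>The persistent homology of the example\<close>

lemma keys_simplex_boundary:
  assumes "finite \<sigma>"
  shows "keys (simplex_boundary \<sigma> :: 'v::linorder set \<Rightarrow>\<^sub>0 'k::field) \<subseteq> (\<lambda>v. \<sigma> - {v}) ` \<sigma>"
  by (auto simp only: simplex_boundary_eq[OF assms] keys_zero intro!: keys_sum_le split: if_splits)
    (auto split: if_splits)

lemma lookup_simplex_boundary:
  assumes V: "finite V" "\<sigma> \<subseteq> V" "\<rho> \<subseteq> V" "\<rho> \<noteq> {}"
  shows "lookup (simplex_boundary \<sigma> :: 'v::linorder set \<Rightarrow>\<^sub>0 'k::field) \<rho> =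
    (\<Sum>x\<in>V - \<rho>. if \<sigma> = insert x \<rho> then position_sign x \<rho> else 0)"
proof -
  have fin: "finite \<sigma>" "finite \<rho>" using V finite_subset by blast+
  have "lookup (simplex_boundary \<sigma> :: 'v set \<Rightarrow>\<^sub>0 'k) \<rho> =
      (\<Sum>x\<in>\<sigma>. if \<sigma> - {x} = \<rho> then position_sign x \<sigma> else 0)"
  proof (cases "card \<sigma> \<le> 1")
    case True
    then have "\<sigma> - {x} \<noteq> \<rho>" if "x \<in> \<sigma>" for x
      using fin(1) that V(4) by (auto simp: card_le_Suc0_iff_eq)
    then show ?thesis using True fin by (simp add: simplex_boundary_eq)
  next
    case False
    then show ?thesis using fin
      by (simp add: simplex_boundary_eq lookup_sum lookup_single when_def)
  qed
  also have "\<dots> = (\<Sum>x\<in>V - \<rho>. if \<sigma> = insert x \<rho> then position_sign x \<rho> else 0)"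
  proof -
    have "(\<Sum>x\<in>\<sigma>. if \<sigma> - {x} = \<rho> then position_sign x \<sigma> else (0 :: 'k)) =
        (\<Sum>x\<in>\<sigma> - \<rho>. if \<sigma> = insert x \<rho> then position_sign x \<rho> else 0)"
      by (rule sum.mono_neutral_cong_right) (use fin in \<open>auto simp: position_sign_insert insert_absorb\<close>)
    also have "\<dots> = (\<Sum>x\<in>V - \<rho>. if \<sigma> = insert x \<rho> then position_sign x \<rho> else 0)"
      by (rule sum.mono_neutral_left) (use V in auto)
    finally show ?thesis .
  qed
  finally show ?thesis .
qed

text \<open>Expressing the coefficients of \<open>\<partial>c\<close> through the cofaces of \<open>\<rho>\<close> is convenient here because the relevant
  faces have only four conceivable cofaces, most of which are not in the complex.\<close>

lemma lookup_boundary: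
  fixes c :: "'v::linorder set \<Rightarrow>\<^sub>0 'k::field"
  assumes V: "finite V" "\<rho> \<subseteq> V" "\<rho> \<noteq> {}" and c: "\<And>\<sigma>. \<sigma> \<in> keys c \<Longrightarrow> \<sigma> \<subseteq> V"
  shows "lookup (boundary c) \<rho> =
    (\<Sum>x\<in>V - \<rho>. position_sign x \<rho> * lookup c (insert x \<rho>))"
proof -
  have "lookup (boundary c) \<rho> =
      (\<Sum>\<sigma>\<in>keys c. \<Sum>x\<in>V - \<rho>. if \<sigma> = insert x \<rho> then position_sign x \<rho> * lookup c \<sigma> else 0)"
    unfolding lookup_linear_extension
  proof (rule sum.cong[OF refl])
    fix \<sigma> assume "\<sigma> \<in> keys c"
    then have "\<sigma> \<subseteq> V" by (rule c)
    then show "lookup c \<sigma> * lookup (simplex_boundary \<sigma>) \<rho> =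
        (\<Sum>x\<in>V - \<rho>. if \<sigma> = insert x \<rho> then position_sign x \<rho> * lookup c \<sigma> else 0)"
      unfolding lookup_simplex_boundary[OF V(1) \<open>\<sigma> \<subseteq> V\<close> V(2,3)] sum_distrib_left
      by (intro sum.cong) auto
  qed
  also have "\<dots> = (\<Sum>x\<in>V - \<rho>. \<Sum>\<sigma>\<in>keys c. if \<sigma> = insert x \<rho> then position_sign x \<rho> * lookup c \<sigma> else 0)"
    by (rule sum.swap)
  also have "\<dots> = (\<Sum>x\<in>V - \<rho>. position_sign x \<rho> * lookup c (insert x \<rho>))"
    by (rule sum.cong) (auto simp: sum.delta' in_keys_iff)
  finally show ?thesis .
qed

lemma position_sign_nonzero: "position_sign x \<sigma> \<noteq> (0 :: 'k::field)"
  by (simp add: position_sign_def)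

text \<open>The top-dimensional simplices of \<open>A\<close> that contain \<open>D + 2\<close>; the one for \<open>i\<close> gets its cone with apex \<open>0\<close> in
  degree \<open>2 * i\<close>. The one for \<open>i = D + 1\<close> is the last, and its coefficient is the invariant that identifies homology
  classes until then.\<close>

definition ex_facet :: "nat \<Rightarrow> nat \<Rightarrow> nat set" where
  "ex_facet D i = insert (D + 2) ({1..D + 1} - {i})"

text \<open>The fundamental cycle of the sphere \<open>A\<close>, which is the suspension of the boundary of \<open>{1..D + 1}\<close>. The simplices
  with this boundary are not in \<open>X\<close>, but their common face \<open>{1..D + 1}\<close> cancels.\<close>

definition ex_cycle :: "nat \<Rightarrow> nat set \<Rightarrow>\<^sub>0 'k::field" where
  "ex_cycle D = boundary (single {1..D + 2} 1 - single (insert (D + 3) {1..D + 1}) 1)"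

lemma ex_cycle_lookup:
  assumes "\<rho> \<subseteq> {0..D + 3}" "\<rho> \<noteq> {}"
  shows "lookup (ex_cycle D :: nat set \<Rightarrow>\<^sub>0 'k::field) \<rho> = (\<Sum>x\<in>{0..D + 3} - \<rho>. position_sign x \<rho> *
    ((if insert x \<rho> = {1..D + 2} then 1 else 0) - (if insert x \<rho> = insert (D + 3) {1..D + 1} then 1 else 0)))"
proof -
  let ?c = "single {1..D + 2} 1 - single (insert (D + 3) {1..D + 1}) (1 :: 'k)"
  have "keys ?c \<subseteq> {{1..D + 2}, insert (D + 3) {1..D + 1}}"
    by (intro keys_diff_le) auto
  then have "\<sigma> \<subseteq> {0..D + 3}" if "\<sigma> \<in> keys ?c" for \<sigma>
    using that by fastforce
  then have "lookup (boundary ?c) \<rho> =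
      (\<Sum>x\<in>{0..D + 3} - \<rho>. position_sign x \<rho> * lookup ?c (insert x \<rho>))"
    by (intro lookup_boundary assms) simp_all
  moreover have "lookup (single S (1 :: 'k)) T = (if T = S then 1 else 0)" for S T :: "nat set"
    by (simp add: lookup_single when_def)
  ultimately show ?thesis unfolding ex_cycle_def by (simp only: lookup_minus)
qed

lemma insert_neq: "x \<notin> T \<Longrightarrow> insert x S \<noteq> T"
  by blast

lemma ex_cycle_lookup_facet:
  "lookup (ex_cycle D) (ex_facet D (D + 1)) = (position_sign (D + 1) (ex_facet D (D + 1)) :: 'k::field)"
proof -
  let ?F = "ex_facet D (D + 1)"
  have F: "{0..D + 3} - ?F = {0, D + 1, D + 3}" by (auto simp: ex_facet_def)
  have "insert (D + 1) ?F = {1..D + 2}" by (auto simp: ex_facet_def)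
  moreover have "insert 0 ?F \<noteq> {1..D + 2}" "insert (D + 3) ?F \<noteq> {1..D + 2}"
    by (rule insert_neq; simp)+
  moreover have "insert x ?F \<noteq> insert (D + 3) {1..D + 1}" for x
  proof
    assume "insert x ?F = insert (D + 3) {1..D + 1}"
    moreover have "D + 2 \<in> insert x ?F" by (simp add: ex_facet_def)
    ultimately have "D + 2 \<in> insert (D + 3) {1..D + 1}" by (simp only:)
    then show False by simp
  qed
  moreover have "?F \<subseteq> {0..D + 3}" "?F \<noteq> {}" by (auto simp: ex_facet_def)
  ultimately show ?thesis using ex_cycle_lookup[of ?F D, where 'k = 'k] unfolding F by simp
qed

lemma ex_cycle_in_cycles: "(ex_cycle D :: nat set \<Rightarrow>\<^sub>0 'k::field) \<in> cycles D (ex_X_filt D (- 2 * int D))"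
proof -
  let ?T = "{1..D + 2}" and ?T' = "insert (D + 3) {1..D + 1}"
  have "boundary (ex_cycle D :: nat set \<Rightarrow>\<^sub>0 'k) = 0"
    unfolding ex_cycle_def
  proof (rule boundary_boundary)
    have "keys (single ?T 1 - single ?T' (1 :: 'k)) \<subseteq> {?T, ?T'}"
      by (intro keys_diff_le) auto
    then show "finite \<sigma>" if "\<sigma> \<in> keys (single ?T 1 - single ?T' (1 :: 'k))" for \<sigma>
      using that by auto
  qed
  moreover have "\<sigma> \<in> ex_X_filt D (- 2 * int D) \<and> card \<sigma> = D + 1"
    if \<sigma>: "\<sigma> \<in> keys (ex_cycle D :: nat set \<Rightarrow>\<^sub>0 'k)" for \<sigma>
  proof -
    have sub: "keys (ex_cycle D :: nat set \<Rightarrow>\<^sub>0 'k) \<subseteq> (\<lambda>v. ?T - {v}) ` ?T \<union> (\<lambda>v. ?T' - {v}) ` ?T'"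
      unfolding ex_cycle_def linear_extension_diff linear_extension_single scale_one
      by (intro keys_diff_le le_supI1[OF keys_simplex_boundary] le_supI2[OF keys_simplex_boundary]) simp_all
    have "{1..D + 1} \<notin> keys (ex_cycle D :: nat set \<Rightarrow>\<^sub>0 'k)"
    proof -
      have "{0..D + 3} - {1..D + 1} = {0, D + 2, D + 3}" by auto
      moreover have "insert (D + 2) {1..D + 1} = ?T" by auto
      moreover have "?T' \<noteq> ?T" "insert 0 {1..D + 1} \<noteq> ?T" "insert 0 {1..D + 1} \<noteq> ?T'"
        by (rule insert_neq; simp)+
      moreover from this(1) have "?T \<noteq> ?T'" by (rule not_sym)
      moreover have "{x. 1 \<le> x \<and> x \<le> D + 1 \<and> x < D + 2} = {1..D + 1}" "{x. 1 \<le> x \<and> x \<le> D + 1 \<and> x < D + 3} = {1..D + 1}"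
        by auto
      ultimately show ?thesis
        using ex_cycle_lookup[of "{1..D + 1}", where 'k = 'k] by (simp add: in_keys_iff position_sign_def)
    qed
    then have ne: "\<sigma> \<noteq> {1..D + 1}" using \<sigma> by metis
    have "\<exists>T v. (T = T1 \<or> T = T2) \<and> v \<in> T \<and> \<sigma> = T - {v}"
      if "\<sigma> \<in> (\<lambda>v. T1 - {v}) ` T1 \<union> (\<lambda>v. T2 - {v}) ` T2" for T1 T2 :: "nat set"
      using that by blast
    from this[OF subsetD[OF sub \<sigma>]]
    obtain T v where T: "T = ?T \<or> T = ?T'" "v \<in> T" "\<sigma> = T - {v}" by (elim exE conjE)
    have "card T = D + 2" using T(1) by auto
    then have "card \<sigma> = D + 1" using T by auto
    moreover have "\<not> {1..D + 1} \<subseteq> \<sigma>"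
    proof
      assume "{1..D + 1} \<subseteq> \<sigma>"
      then have "{1..D + 1} = \<sigma>" using \<open>card \<sigma> = D + 1\<close> by (intro card_subset_eq) (auto intro: card_ge_0_finite)
      then show False using ne by simp
    qed
    moreover have "\<sigma> \<subseteq> {1..D + 3}" "\<not> {D + 2, D + 3} \<subseteq> \<sigma>" using T(1,3) by auto
    ultimately show ?thesis by (auto simp: mem_ex_X_filt ex_X_def)
  qed
  ultimately show ?thesis by (auto simp: cycles_def chains_def)
qed

lemma ex_chain_vertices: "c \<in> chains q (ex_X_filt D j) \<Longrightarrow> \<sigma> \<in> keys c \<Longrightarrow> \<sigma> \<subseteq> {0..D + 3}"
  by (auto simp: chains_def mem_ex_X_filt ex_X_def)

lemma ex_lookup_boundary:
  assumes "c \<in> chains q (ex_X_filt D j)" "\<rho> \<subseteq> {0..D + 3}" "\<rho> \<noteq> {}"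
  shows "lookup (boundary c) \<rho> =
    (\<Sum>x\<in>{0..D + 3} - \<rho>. position_sign x \<rho> * lookup c (insert x \<rho>))"
  by (rule lookup_boundary[OF _ assms(2,3) ex_chain_vertices[OF assms(1)]]) simp

lemma ex_chain_lookup: "c \<in> chains q (ex_X_filt D j) \<Longrightarrow> \<sigma> \<notin> ex_X_filt D j \<Longrightarrow> lookup c \<sigma> = 0"
  by (auto simp: chains_def in_keys_iff)

lemma not_ex_X:
  "insert i ({1..D + 1} - {i}) \<subseteq> \<sigma> \<Longrightarrow> i \<in> {1..D + 1} \<Longrightarrow> \<sigma> \<notin> ex_X_filt D j"
  "D + 2 \<in> \<sigma> \<Longrightarrow> D + 3 \<in> \<sigma> \<Longrightarrow> \<sigma> \<notin> ex_X_filt D j"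
  by (auto simp: mem_ex_X_filt ex_X_def)

text \<open>The only simplex of \<open>X\<close> with the last facet in its boundary is its cone with apex \<open>0\<close>, which is born in degree
  \<open>2 * D + 2\<close>.\<close>

lemma ex_boundary_lookup_facet:
  assumes w: "w \<in> boundaries D (ex_X_filt D j)" and j: "j < 2 * int D + 2"
  shows "lookup w (ex_facet D (D + 1)) = (0 :: 'k::field)"
proof -
  let ?F = "ex_facet D (D + 1)"
  obtain c where c: "w = boundary c" "c \<in> chains (D + 1) (ex_X_filt D j)"
    using w by (auto simp: boundaries_def)
  have F: "{0..D + 3} - ?F = {0, D + 1, D + 3}" "?F \<subseteq> {0..D + 3}" "?F \<noteq> {}" by (auto simp: ex_facet_def)
  have "insert 0 ?F \<notin> ex_X_filt D j" using j by (auto simp: mem_ex_X_filt ex_facet_def)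
  moreover have "insert (D + 1) ?F \<notin> ex_X_filt D j" by (rule not_ex_X(1)[of "D + 1"]) (auto simp: ex_facet_def)
  moreover have "insert (D + 3) ?F \<notin> ex_X_filt D j" by (rule not_ex_X(2)) (auto simp: ex_facet_def)
  ultimately show ?thesis
    unfolding c(1) ex_lookup_boundary[OF c(2) F(2,3)] F(1)
    by (intro sum.neutral) (auto simp: ex_chain_lookup[OF c(2)])
qed

text \<open>Two facets that have not been coned off yet are the only cofaces of their intersection, so that a cycle
  takes equal values on them up to sign. This propagates vanishing from the last facet to all facets
  without a cone (in negative degrees also to those that contain \<open>D + 3\<close>), and then the whole cycle can
  be coned off from \<open>0\<close>.\<close>

lemma ex_cycle_is_boundary:
  fixes z :: "nat set \<Rightarrow>\<^sub>0 'k::field"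
  assumes D: "D \<ge> 1" and z: "z \<in> cycles D (ex_X_filt D j)" and j: "j < 2 * int D + 2"
    and F: "lookup z (ex_facet D (D + 1)) = 0"
  shows "z \<in> boundaries D (ex_X_filt D j)"
proof -
  have c: "z \<in> chains D (ex_X_filt D j)" "boundary z = 0" using z by (auto simp: cycles_def)
  note look = ex_lookup_boundary[OF c(1), unfolded c(2) lookup_zero]
  have free: "lookup z (ex_facet D i) = 0" if i: "i \<in> {1..D + 1}" "\<not> (0 \<le> j \<and> 2 * int i \<le> j)" for i
  proof (cases "i = D + 1")
    case False
    let ?\<rho> = "insert (D + 2) ({1..D} - {i})"
    have \<rho>: "{0..D + 3} - ?\<rho> = {0, i, D + 1, D + 3}" "?\<rho> \<subseteq> {0..D + 3}" "?\<rho> \<noteq> {}" using i(1) False by auto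
    have "insert 0 ?\<rho> \<notin> ex_X_filt D j"
    proof
      assume "insert 0 ?\<rho> \<in> ex_X_filt D j"
      then obtain l where "0 \<le> j" "l \<in> {1..D + 1}" "2 * int l \<le> j" "l \<notin> ?\<rho>"
        unfolding mem_ex_X_filt by blast
      then show False using i(2) j by (cases "l = D + 1") auto
    qed
    moreover have "insert (D + 3) ?\<rho> \<notin> ex_X_filt D j" by (rule not_ex_X(2)) auto
    moreover have "insert i ?\<rho> = ex_facet D (D + 1)" "insert (D + 1) ?\<rho> = ex_facet D i"
      using i(1) False by (auto simp: ex_facet_def)
    ultimately have "position_sign (D + 1) ?\<rho> * lookup z (ex_facet D i) = 0"
      using look[of ?\<rho>] \<rho> False i(1) F ex_chain_lookup[OF c(1)] by simp
    then show ?thesis by (simp add: position_sign_nonzero)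
  qed (use F in simp)
  have facet: "\<exists>i\<in>{1..D + 1}. \<sigma> = insert w ({1..D + 1} - {i})"
    if "w \<in> \<sigma>" "w \<notin> {1..D + 1}" "\<sigma> \<subseteq> insert w {1..D + 1}" "card \<sigma> = D + 1" for \<sigma> w
  proof -
    let ?\<tau> = "\<sigma> - {w}"
    have \<tau>: "?\<tau> \<subseteq> {1..D + 1}" "card ?\<tau> = D" using that by auto
    have "card ({1..D + 1} - ?\<tau>) = 1"
      using \<tau> finite_subset[OF \<tau>(1)] by (subst card_Diff_subset) simp_all
    then obtain i where "{1..D + 1} - ?\<tau> = {i}" by (auto simp: card_1_singleton_iff)
    then have "i \<in> {1..D + 1}" "?\<tau> = {1..D + 1} - {i}" using \<tau>(1) by blast+
    then show ?thesis using that(1) by (intro bexI[of _ i]) auto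
  qed
  have "insert 0 \<sigma> \<in> ex_X_filt D j" if \<sigma>: "\<sigma> \<in> keys z" "0 \<notin> \<sigma>" for \<sigma>
  proof (rule ccontr)
    assume no: "insert 0 \<sigma> \<notin> ex_X_filt D j"
    have s: "\<sigma> \<in> ex_X_filt D j" "card \<sigma> = D + 1" using c(1) \<sigma>(1) by (auto simp: chains_def)
    then have X: "\<sigma> \<subseteq> {1..D + 3}" "\<not> {1..D + 1} \<subseteq> \<sigma>" "\<not> {D + 2, D + 3} \<subseteq> \<sigma>" "- 2 * int D \<le> j"
      using \<sigma>(2) by (auto simp: mem_ex_X_filt ex_X_def Suc_le_eq intro: gr0I)
    have "insert 0 \<sigma> \<in> ex_X D" using X by (auto simp: ex_X_def)
    then have no': "\<not> (0 \<le> j \<and> (D + 2 \<notin> \<sigma> \<or> (\<exists>i\<in>{1..D + 1}. 2 * int i \<le> j \<and> i \<notin> \<sigma>)))"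
      using no X(4) by (auto simp: mem_ex_X_filt)
    have sub: "\<sigma> \<subseteq> insert w {1..D + 1}" if "w = D + 2 \<and> D + 3 \<notin> \<sigma> \<or> w = D + 3 \<and> D + 2 \<notin> \<sigma>" for w
    proof
      fix x assume x: "x \<in> \<sigma>"
      then have "1 \<le> x" "x \<le> D + 3" "D + 3 \<notin> \<sigma> \<Longrightarrow> x \<noteq> D + 3" "D + 2 \<notin> \<sigma> \<Longrightarrow> x \<noteq> D + 2"
        using X(1) by auto
      then show "x \<in> insert w {1..D + 1}" using that by auto
    qed
    have "lookup z \<sigma> = 0"
    proof (cases "D + 2 \<in> \<sigma>")
      case True
      have "\<exists>i\<in>{1..D + 1}. \<sigma> = ex_facet D i"
        unfolding ex_facet_def by (rule facet[OF True _ sub s(2)]) (use True X(3) in auto)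
      then obtain i where i: "i \<in> {1..D + 1}" "\<sigma> = ex_facet D i" by (elim bexE)
      have "i \<notin> \<sigma>" unfolding i(2) using i(1) by (auto simp: ex_facet_def)
      then have "\<not> (0 \<le> j \<and> 2 * int i \<le> j)" using no' i(1) by blast
      then show ?thesis unfolding i(2) by (rule free[OF i(1)])
    next
      case False
      then have j0: "j < 0" using no' by auto
      have "D + 3 \<in> \<sigma>"
      proof (rule ccontr)
        assume "D + 3 \<notin> \<sigma>"
        then have "\<sigma> \<subseteq> {1..D + 1}" using sub[of "D + 2"] False by auto
        then have "\<sigma> = {1..D + 1}" using s(2) by (intro card_subset_eq) auto
        then show False using X(2) by simp
      qed
      then have "\<exists>i\<in>{1..D + 1}. \<sigma> = insert (D + 3) ({1..D + 1} - {i})"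
        by (rule facet[OF _ _ sub s(2)]) (use False in auto)
      then obtain i where i: "i \<in> {1..D + 1}" "\<sigma> = insert (D + 3) ({1..D + 1} - {i})" by (elim bexE)
      let ?\<rho> = "{1..D + 1} - {i}"
      have \<rho>: "{0..D + 3} - ?\<rho> = {0, i, D + 2, D + 3}" "?\<rho> \<subseteq> {0..D + 3}" "?\<rho> \<noteq> {}"
      proof -
        show "{0..D + 3} - ?\<rho> = {0, i, D + 2, D + 3}" "?\<rho> \<subseteq> {0..D + 3}" using i(1) by auto
        have "card ?\<rho> = D" using i(1) by simp
        then show "?\<rho> \<noteq> {}" using D by (metis card.empty not_one_le_zero)
      qed
      have "insert 0 ?\<rho> \<notin> ex_X_filt D j" using j0 by (auto simp: mem_ex_X_filt)
      moreover have "insert i ?\<rho> \<notin> ex_X_filt D j" by (rule not_ex_X(1)[of i]) (use i(1) in auto)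
      moreover have "lookup z (insert (D + 2) ?\<rho>) = 0"
        using free[OF i(1)] j0 by (simp add: ex_facet_def)
      ultimately have "position_sign (D + 3) ?\<rho> * lookup z \<sigma> = 0"
        using look[of ?\<rho>] \<rho> i ex_chain_lookup[OF c(1)] by simp
      then show ?thesis by (simp add: position_sign_nonzero)
    qed
    then show False using \<sigma>(1) by (simp add: in_keys_iff)
  qed
  then show ?thesis using cone_off[OF z ex_X_filt_simplicial, of 0] D by simp
qed

theorem ex_persistent_homology:
  fixes k :: "'k::field itself"
  assumes D: "D \<ge> 1"
  shows "interval_module k (- 2 * int D) (2 * int D + 2) \<cong>\<^sub>g persistent_homology k D (ex_X_filt D)"
proof (rule persistent_homology_interval[OF ex_X_filt_mono ex_cycle_in_cycles ex_X_filt_below])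
  let ?F = "ex_facet D (D + 1)"
  have F: "lookup (ex_cycle D :: nat set \<Rightarrow>\<^sub>0 'k) ?F \<noteq> 0"
    unfolding ex_cycle_lookup_facet by (rule position_sign_nonzero)
  {
    fix j and z :: "nat set \<Rightarrow>\<^sub>0 'k"
    assume j: "- 2 * int D \<le> j" "j < 2 * int D + 2" and z: "z \<in> cycles D (ex_X_filt D j)"
    define s where "s = lookup z ?F / lookup (ex_cycle D) ?F"
    have "ex_X_filt D (- 2 * int D) \<subseteq> ex_X_filt D j" by (rule monoD[OF ex_X_filt_mono j(1)])
    then have "ex_cycle D \<in> (cycles D (ex_X_filt D j) :: (_ \<Rightarrow>\<^sub>0 'k) set)"
      using ex_cycle_in_cycles cycles_mono by blast
    then have "z - scale s (ex_cycle D) \<in> cycles D (ex_X_filt D j)"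
      using z by (intro plus_subgroupD(2)[OF cycles_plus_subgroup] cycles_scale)
    then have "z - scale s (ex_cycle D) \<in> boundaries D (ex_X_filt D j)"
      by (rule ex_cycle_is_boundary[OF D _ j(2)]) (use F in \<open>simp add: s_def lookup_minus\<close>)
    then show "\<exists>s. z - scale s (ex_cycle D) \<in> boundaries D (ex_X_filt D j)" by blast
  next
    fix j and s :: 'k
    assume "- 2 * int D \<le> j" "j < 2 * int D + 2" "scale s (ex_cycle D) \<in> boundaries D (ex_X_filt D j)"
    then show "s = 0" using ex_boundary_lookup_facet[of "scale s (ex_cycle D)" D j] F by simp
  next
    fix j assume j: "2 * int D + 2 \<le> j"
    show "cycles D (ex_X_filt D j) \<subseteq> (boundaries D (ex_X_filt D j) :: (_ \<Rightarrow>\<^sub>0 'k) set)"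
    proof
      fix z :: "nat set \<Rightarrow>\<^sub>0 'k" assume z: "z \<in> cycles D (ex_X_filt D j)"
      have "insert 0 \<sigma> \<in> ex_X_filt D j" if "\<sigma> \<in> keys z" for \<sigma>
      proof -
        have "\<sigma> \<in> ex_X D" using z that by (auto simp: cycles_def chains_def mem_ex_X_filt)
        then have "insert 0 \<sigma> \<in> ex_X D" "\<not> {1..D + 1} \<subseteq> \<sigma>" by (auto simp: ex_X_def)
        moreover from this(2) obtain i where "i \<in> {1..D + 1}" "i \<notin> \<sigma>" by blast
        ultimately show ?thesis using j by (force simp: mem_ex_X_filt)
      qed
      then show "z \<in> boundaries D (ex_X_filt D j)"
        using cone_off[OF z ex_X_filt_simplicial, of 0] D by simp
    qed
  }
qed

section \<open>The total complex of a filtered cover\<close>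

text \<open>The degree function is left arbitrary because the generating cycle of the example is most easily found in
  the ungraded double complex, which is the case of constant degrees.\<close>

definition vertical_boundary ::
    "('v::linorder set \<times> 'i set \<Rightarrow> int) \<Rightarrow> 'v set \<times> 'i set \<Rightarrow> ('v set \<times> 'i set \<Rightarrow>\<^sub>0 'k::field poly)" where
  "vertical_boundary deg = (\<lambda>(\<sigma>, I). if card \<sigma> \<le> 1 then 0
     else \<Sum>v\<in>\<sigma>. single (\<sigma> - {v}, I)
       (monom (position_sign v \<sigma>) (nat (deg (\<sigma>, I) - deg (\<sigma> - {v}, I)))))"

definition horizontal_boundary ::
    "('v set \<times> 'i::linorder set \<Rightarrow> int) \<Rightarrow> 'v set \<times> 'i set \<Rightarrow> ('v set \<times> 'i set \<Rightarrow>\<^sub>0 'k::field poly)" where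
  "horizontal_boundary deg = (\<lambda>(\<sigma>, I). if card I \<le> 1 then 0
     else \<Sum>i\<in>I. single (\<sigma>, I - {i})
       (monom (position_sign i I) (nat (deg (\<sigma>, I) - deg (\<sigma>, I - {i})))))"

definition total_boundary ::
    "('v::linorder set \<times> 'i::linorder set \<Rightarrow> int) \<Rightarrow> 'v set \<times> 'i set \<Rightarrow> ('v set \<times> 'i set \<Rightarrow>\<^sub>0 'k::field poly)" where
  "total_boundary deg b = scale ((- 1) ^ (card (snd b) - 1)) (vertical_boundary deg b) + horizontal_boundary deg b"

lemma mv_d0_eq: "finite \<sigma> \<Longrightarrow> mv_d0 U (\<sigma>, I) = vertical_boundary (mv_degree U) (\<sigma>, I)"
  unfolding mv_d0_def vertical_boundary_def position_sign_def prod.case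
  by (subst sum_delete_nth[of \<sigma> "\<lambda>n \<tau>. single (\<tau>, I)
      (monom ((- 1) ^ n) (nat (mv_degree U (\<sigma>, I) - mv_degree U (\<tau>, I))))"]) auto

lemma mv_d1_eq: "finite I \<Longrightarrow> mv_d1 U (\<sigma>, I) = horizontal_boundary (mv_degree U) (\<sigma>, I)"
  unfolding mv_d1_def horizontal_boundary_def position_sign_def prod.case
  by (subst sum_delete_nth[of I "\<lambda>n J. single (\<sigma>, J)
      (monom ((- 1) ^ n) (nat (mv_degree U (\<sigma>, I) - mv_degree U (\<sigma>, J))))"]) auto

lemma mv_differential_eq:
  assumes "\<And>\<sigma> I. (\<sigma>, I) \<in> keys x \<Longrightarrow> finite \<sigma> \<and> finite I"
  shows "mv_differential U x = linear_extension (total_boundary (mv_degree U)) x"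
  unfolding mv_differential_def
proof (rule linear_extension_cong)
  fix b assume b: "b \<in> keys x"
  then show "(case b of (\<sigma>, I) \<Rightarrow> Poly_Mapping.map ((*) ((- 1) ^ (card I - 1))) (mv_d0 U (\<sigma>, I)) + mv_d1 U (\<sigma>, I)) =
      total_boundary (mv_degree U) b"
    using assms[of "fst b" "snd b"]
    by (cases b) (simp add: total_boundary_def mv_d0_eq mv_d1_eq scale_def)
qed

text \<open>Exponents of \<open>t\<close> are truncated at 0 by \<open>nat\<close>; monotonicity makes them additive along successive faces,
  so that \<open>\<partial>\<partial> = 0\<close> reduces to the signs.\<close>

definition degree_monotone :: "('v set \<times> 'i set \<Rightarrow> int) \<Rightarrow> 'v set \<Rightarrow> 'i set \<Rightarrow> bool" where
  "degree_monotone deg \<sigma> I \<longleftrightarrow> (\<forall>\<tau> \<rho> J K. \<rho> \<subseteq> \<tau> \<and> \<tau> \<subseteq> \<sigma> \<and> \<rho> \<noteq> {} \<and> K \<subseteq> J \<and> J \<subseteq> I \<and> K \<noteq> {} \<longrightarrow>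
     deg (\<rho>, K) \<le> deg (\<tau>, J))"

lemma degree_monotoneD:
  "degree_monotone deg \<sigma> I \<Longrightarrow> \<rho> \<subseteq> \<tau> \<Longrightarrow> \<tau> \<subseteq> \<sigma> \<Longrightarrow> \<rho> \<noteq> {} \<Longrightarrow> K \<subseteq> J \<Longrightarrow> J \<subseteq> I \<Longrightarrow> K \<noteq> {} \<Longrightarrow>
    deg (\<rho>, K) \<le> deg (\<tau>, J)"
  unfolding degree_monotone_def by blast

lemma card_ge_2_remove: "finite S \<Longrightarrow> \<not> card S \<le> 1 \<Longrightarrow> S - {x} \<noteq> {}"
  by (metis Diff_eq_empty_iff One_nat_def card.empty card_insert_le_m1 card_mono finite.emptyI finite.insertI
      card.insert_remove diff_Suc_1 empty_Diff le_trans zero_less_one)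

lemma monom_scale_single:
  "scale (monom a m) (single k (monom b n)) = single k (monom (a * b) (m + n))"
  by (simp add: mult_monom)

lemma nat_diff_add: "z \<le> y \<Longrightarrow> y \<le> x \<Longrightarrow> nat (x - y) + nat (y - z) = nat (x - z)" for x y z :: int
  by simp

lemma vertical_vertical:
  assumes "finite \<sigma>" "I \<noteq> {}" and deg: "degree_monotone deg \<sigma> I"
  shows "linear_extension (vertical_boundary deg) (vertical_boundary deg (\<sigma>, I)) = (0 :: _ \<Rightarrow>\<^sub>0 'k::field poly)"
proof (cases "card \<sigma> \<le> 2")
  case True
  then show ?thesis using assms(1)
    by (auto simp: vertical_boundary_def linear_extension_sum intro!: sum.neutral)
next
  case False
  then have c: "\<not> card \<sigma> \<le> 1" by simp
  have "linear_extension (vertical_boundary deg) (vertical_boundary deg (\<sigma>, I)) =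
    (\<Sum>u\<in>\<sigma>. \<Sum>v\<in>\<sigma> - {u}. single (\<sigma> - {u} - {v}, I)
      (monom (position_sign u \<sigma> * position_sign v (\<sigma> - {u}) :: 'k) (nat (deg (\<sigma>, I) - deg (\<sigma> - {u} - {v}, I)))))"
    unfolding vertical_boundary_def[of deg] prod.case if_not_P[OF c] linear_extension_sum
  proof (rule sum.cong[OF refl])
    fix u assume "u \<in> \<sigma>"
    then have cu: "\<not> card (\<sigma> - {u}) \<le> 1" using False assms(1) by simp
    have "nat (deg (\<sigma>, I) - deg (\<sigma> - {u}, I)) + nat (deg (\<sigma> - {u}, I) - deg (\<sigma> - {u} - {v}, I)) =
        nat (deg (\<sigma>, I) - deg (\<sigma> - {u} - {v}, I))" for v
      using card_ge_2_remove[OF assms(1) c] card_ge_2_remove[OF _ cu] assms(1,2)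
      by (intro nat_diff_add degree_monotoneD[OF deg]) auto
    then show "linear_extension (\<lambda>(\<sigma>, I). if card \<sigma> \<le> 1 then 0 else \<Sum>v\<in>\<sigma>. single (\<sigma> - {v}, I)
          (monom (position_sign v \<sigma>) (nat (deg (\<sigma>, I) - deg (\<sigma> - {v}, I)))))
        (single (\<sigma> - {u}, I) (monom (position_sign u \<sigma>) (nat (deg (\<sigma>, I) - deg (\<sigma> - {u}, I))))) =
      (\<Sum>v\<in>\<sigma> - {u}. single (\<sigma> - {u} - {v}, I)
        (monom (position_sign u \<sigma> * position_sign v (\<sigma> - {u}) :: 'k) (nat (deg (\<sigma>, I) - deg (\<sigma> - {u} - {v}, I)))))"
      by (simp only: linear_extension_single prod.case if_not_P[OF cu] scale_sum monom_scale_single)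
  qed
  also have "\<dots> = 0"
  proof (rule sum_antisymmetric[OF assms(1)])
    fix u v assume uv: "u \<in> \<sigma>" "v \<in> \<sigma>" "u < v"
    have e: "\<sigma> - {v} - {u} = \<sigma> - {u} - {v}" by blast
    have "position_sign v \<sigma> * position_sign u (\<sigma> - {v}) = - (position_sign u \<sigma> * position_sign v (\<sigma> - {u}) :: 'k)"
      using uv assms(1) by (simp add: position_sign_remove)
    then show "single (\<sigma> - {v} - {u}, I)
        (monom (position_sign v \<sigma> * position_sign u (\<sigma> - {v}) :: 'k) (nat (deg (\<sigma>, I) - deg (\<sigma> - {v} - {u}, I)))) =
      - single (\<sigma> - {u} - {v}, I)
        (monom (position_sign u \<sigma> * position_sign v (\<sigma> - {u})) (nat (deg (\<sigma>, I) - deg (\<sigma> - {u} - {v}, I))))"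
      by (simp only: e minus_monom[symmetric] single_uminus)
  qed
  finally show ?thesis .
qed

lemma horizontal_horizontal:
  assumes "finite I" "\<sigma> \<noteq> {}" and deg: "degree_monotone deg \<sigma> I"
  shows "linear_extension (horizontal_boundary deg) (horizontal_boundary deg (\<sigma>, I)) = (0 :: _ \<Rightarrow>\<^sub>0 'k::field poly)"
proof (cases "card I \<le> 2")
  case True
  then show ?thesis using assms(1)
    by (auto simp: horizontal_boundary_def linear_extension_sum intro!: sum.neutral)
next
  case False
  then have c: "\<not> card I \<le> 1" by simp
  have "linear_extension (horizontal_boundary deg) (horizontal_boundary deg (\<sigma>, I)) =
    (\<Sum>u\<in>I. \<Sum>v\<in>I - {u}. single (\<sigma>, I - {u} - {v})
      (monom (position_sign u I * position_sign v (I - {u}) :: 'k) (nat (deg (\<sigma>, I) - deg (\<sigma>, I - {u} - {v})))))"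
    unfolding horizontal_boundary_def[of deg] prod.case if_not_P[OF c] linear_extension_sum
  proof (rule sum.cong[OF refl])
    fix u assume "u \<in> I"
    then have cu: "\<not> card (I - {u}) \<le> 1" using False assms(1) by simp
    have "nat (deg (\<sigma>, I) - deg (\<sigma>, I - {u})) + nat (deg (\<sigma>, I - {u}) - deg (\<sigma>, I - {u} - {v})) =
        nat (deg (\<sigma>, I) - deg (\<sigma>, I - {u} - {v}))" for v
      using card_ge_2_remove[OF assms(1) c] card_ge_2_remove[OF _ cu] assms(1,2)
      by (intro nat_diff_add degree_monotoneD[OF deg]) auto
    then show "linear_extension (\<lambda>(\<sigma>, I). if card I \<le> 1 then 0 else \<Sum>v\<in>I. single (\<sigma>, I - {v})
          (monom (position_sign v I) (nat (deg (\<sigma>, I) - deg (\<sigma>, I - {v})))))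
        (single (\<sigma>, I - {u}) (monom (position_sign u I) (nat (deg (\<sigma>, I) - deg (\<sigma>, I - {u}))))) =
      (\<Sum>v\<in>I - {u}. single (\<sigma>, I - {u} - {v})
        (monom (position_sign u I * position_sign v (I - {u}) :: 'k) (nat (deg (\<sigma>, I) - deg (\<sigma>, I - {u} - {v})))))"
      by (simp only: linear_extension_single prod.case if_not_P[OF cu] scale_sum monom_scale_single)
  qed
  also have "\<dots> = 0"
  proof (rule sum_antisymmetric[OF assms(1)])
    fix u v assume uv: "u \<in> I" "v \<in> I" "u < v"
    have e: "I - {v} - {u} = I - {u} - {v}" by blast
    have "position_sign v I * position_sign u (I - {v}) = - (position_sign u I * position_sign v (I - {u}) :: 'k)"
      using uv assms(1) by (simp add: position_sign_remove)
    then show "single (\<sigma>, I - {v} - {u})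
        (monom (position_sign v I * position_sign u (I - {v}) :: 'k) (nat (deg (\<sigma>, I) - deg (\<sigma>, I - {v} - {u})))) =
      - single (\<sigma>, I - {u} - {v})
        (monom (position_sign u I * position_sign v (I - {u})) (nat (deg (\<sigma>, I) - deg (\<sigma>, I - {u} - {v}))))"
      by (simp only: e minus_monom[symmetric] single_uminus)
  qed
  finally show ?thesis .
qed

lemma vertical_horizontal:
  assumes "finite \<sigma>" "finite I" and deg: "degree_monotone deg \<sigma> I"
  shows "linear_extension (vertical_boundary deg) (horizontal_boundary deg (\<sigma>, I)) =
    (linear_extension (horizontal_boundary deg) (vertical_boundary deg (\<sigma>, I)) :: _ \<Rightarrow>\<^sub>0 'k::field poly)"
proof (cases "card \<sigma> \<le> 1 \<or> card I \<le> 1")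
  case True
  then show ?thesis
    by (auto simp: vertical_boundary_def horizontal_boundary_def linear_extension_sum)
next
  case False
  then have c: "\<not> card \<sigma> \<le> 1" "\<not> card I \<le> 1" by simp_all
  let ?t = "\<lambda>v i. single (\<sigma> - {v}, I - {i})
    (monom (position_sign v \<sigma> * position_sign i I :: 'k) (nat (deg (\<sigma>, I) - deg (\<sigma> - {v}, I - {i}))))"
  have ne: "\<sigma> - {v} \<noteq> {}" "I - {i} \<noteq> {}" "\<sigma> \<noteq> {}" "I \<noteq> {}" for v i
    using card_ge_2_remove[OF assms(1) c(1)] card_ge_2_remove[OF assms(2) c(2)] by blast+
  have "linear_extension (vertical_boundary deg) (horizontal_boundary deg (\<sigma>, I)) = (\<Sum>i\<in>I. \<Sum>v\<in>\<sigma>. ?t v i)"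
    unfolding horizontal_boundary_def prod.case if_not_P[OF c(2)] linear_extension_sum
  proof (rule sum.cong[OF refl])
    fix i assume "i \<in> I"
    have "nat (deg (\<sigma>, I) - deg (\<sigma>, I - {i})) + nat (deg (\<sigma>, I - {i}) - deg (\<sigma> - {v}, I - {i})) =
        nat (deg (\<sigma>, I) - deg (\<sigma> - {v}, I - {i}))" for v
      using ne by (intro nat_diff_add degree_monotoneD[OF deg]) auto
    then show "linear_extension (vertical_boundary deg) (single (\<sigma>, I - {i})
        (monom (position_sign i I) (nat (deg (\<sigma>, I) - deg (\<sigma>, I - {i}))))) = (\<Sum>v\<in>\<sigma>. ?t v i)"
      by (simp only: vertical_boundary_def linear_extension_single prod.case if_not_P[OF c(1)] scale_sum monom_scale_single
          mult.commute)
  qed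
  moreover have "linear_extension (horizontal_boundary deg) (vertical_boundary deg (\<sigma>, I)) = (\<Sum>v\<in>\<sigma>. \<Sum>i\<in>I. ?t v i)"
    unfolding vertical_boundary_def prod.case if_not_P[OF c(1)] linear_extension_sum
  proof (rule sum.cong[OF refl])
    fix v assume "v \<in> \<sigma>"
    have "nat (deg (\<sigma>, I) - deg (\<sigma> - {v}, I)) + nat (deg (\<sigma> - {v}, I) - deg (\<sigma> - {v}, I - {i})) =
        nat (deg (\<sigma>, I) - deg (\<sigma> - {v}, I - {i}))" for i
      using ne by (intro nat_diff_add degree_monotoneD[OF deg]) auto
    then show "linear_extension (horizontal_boundary deg) (single (\<sigma> - {v}, I)
        (monom (position_sign v \<sigma>) (nat (deg (\<sigma>, I) - deg (\<sigma> - {v}, I))))) = (\<Sum>i\<in>I. ?t v i)"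
      by (simp only: horizontal_boundary_def linear_extension_single prod.case if_not_P[OF c(2)] scale_sum monom_scale_single)
  qed
  ultimately show ?thesis by (simp only: sum.swap[of _ \<sigma>])
qed

lemma keys_vertical_boundary:
  "keys (vertical_boundary deg (\<sigma>, I) :: _ \<Rightarrow>\<^sub>0 'k::field poly) \<subseteq> (if card \<sigma> \<le> 1 then {} else (\<lambda>v. (\<sigma> - {v}, I)) ` \<sigma>)"
  unfolding vertical_boundary_def prod.case
  by (cases "card \<sigma> \<le> 1") (auto simp only: if_True if_False keys_zero intro!: keys_sum_le, auto split: if_splits)

lemma keys_horizontal_boundary:
  "keys (horizontal_boundary deg (\<sigma>, I) :: _ \<Rightarrow>\<^sub>0 'k::field poly) \<subseteq> (if card I \<le> 1 then {} else (\<lambda>i. (\<sigma>, I - {i})) ` I)"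
  unfolding horizontal_boundary_def prod.case
  by (cases "card I \<le> 1") (auto simp only: if_True if_False keys_zero intro!: keys_sum_le, auto split: if_splits)

lemma linear_extension_fun_scale: "linear_extension (\<lambda>b. scale a (f b)) x = scale a (linear_extension f x)"
  by (simp add: linear_extension_eq scale_sum mult.commute)

text \<open>The sign \<open>(- 1) ^ p\<close> changes with each horizontal step, which turns the commuting differentials into
  anticommuting ones.\<close>

lemma total_boundary_total_boundary:
  assumes "finite \<sigma>" "finite I" "\<sigma> \<noteq> {}" "I \<noteq> {}" and deg: "degree_monotone deg \<sigma> I"
  shows "linear_extension (total_boundary deg) (total_boundary deg (\<sigma>, I)) = (0 :: _ \<Rightarrow>\<^sub>0 'k::field poly)"
proof -
  let ?s = "(- 1) ^ (card I - 1) :: 'k poly"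
  let ?V = "vertical_boundary deg :: _ \<Rightarrow> (_ \<Rightarrow>\<^sub>0 'k poly)" and ?H = "horizontal_boundary deg :: _ \<Rightarrow> (_ \<Rightarrow>\<^sub>0 'k poly)"
  have V: "linear_extension (total_boundary deg) (?V (\<sigma>, I)) = linear_extension (\<lambda>b. scale ?s (?V b) + ?H b) (?V (\<sigma>, I))"
    by (rule linear_extension_cong)
      (use keys_vertical_boundary[of deg \<sigma> I, where 'k = 'k] in \<open>auto simp: total_boundary_def split: if_splits\<close>)
  have H: "linear_extension (total_boundary deg) (?H (\<sigma>, I)) = linear_extension (\<lambda>b. scale (- ?s) (?V b) + ?H b) (?H (\<sigma>, I))"
  proof (rule linear_extension_cong)
    fix b assume "b \<in> keys (?H (\<sigma>, I))"
    then have "\<not> card I \<le> 1" and "b \<in> (\<lambda>i. (\<sigma>, I - {i})) ` I"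
      using keys_horizontal_boundary[of deg \<sigma> I, where 'k = 'k] by (auto split: if_splits)
    then obtain i where i: "i \<in> I" "b = (\<sigma>, I - {i})" "\<not> card I \<le> 1" by blast
    then have "card I - 1 = Suc (card (snd b) - 1)" using assms(2) by simp
    then have "(- 1) ^ (card (snd b) - 1) = - ?s" by simp
    then show "total_boundary deg b = scale (- ?s) (?V b) + ?H b" by (simp only: total_boundary_def)
  qed
  have "linear_extension (total_boundary deg) (total_boundary deg (\<sigma>, I)) =
      scale ?s (linear_extension (total_boundary deg) (?V (\<sigma>, I))) + linear_extension (total_boundary deg) (?H (\<sigma>, I))"
    by (simp add: total_boundary_def[of deg "(\<sigma>, I)"] linear_extension_add linear_extension_scale)
  also have "\<dots> = 0"
    unfolding V H linear_extension_fun_add linear_extension_fun_scale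
      vertical_vertical[OF assms(1,4) deg] horizontal_horizontal[OF assms(2,3) deg] vertical_horizontal[OF assms(1,2) deg]
    by simp
  finally show ?thesis .
qed

text \<open>The integers are not well-ordered, so \<open>LEAST\<close> needs a lower bound to be meaningful.\<close>

lemma int_Least:
  fixes P :: "int \<Rightarrow> bool"
  assumes "P k" "\<And>j. P j \<Longrightarrow> b \<le> j"
  shows "P (LEAST j. P j)" and "P j \<Longrightarrow> (LEAST j. P j) \<le> j"
proof -
  define n where "n = (LEAST n. P (b + int n))"
  have ex: "\<exists>n. j = b + int n" if "P j" for j
    using assms(2)[OF that] by (intro exI[of _ "nat (j - b)"]) simp
  then obtain m where "P (b + int m)" using assms(1) by blast
  then have n: "P (b + int n)" unfolding n_def by (rule LeastI)
  have min: "b + int n \<le> j" if j: "P j" for j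
  proof -
    obtain m where "j = b + int m" using ex[OF j] by blast
    then show ?thesis using j Least_le[of "\<lambda>n. P (b + int n)" m] by (simp add: n_def)
  qed
  have "(LEAST j. P j) = b + int n" by (rule Least_equality) (use n min in auto)
  then show "P (LEAST j. P j)" "P j \<Longrightarrow> (LEAST j. P j) \<le> j" using n min by simp_all
qed

lemma cover_inter_filtered:
  assumes "filtered_cover X \<Lambda> U" "I \<subseteq> \<Lambda>"
  shows "\<sigma> \<in> cover_inter U I m \<Longrightarrow> m \<le> n \<Longrightarrow> \<sigma> \<in> cover_inter U I n"
    and "\<sigma> \<in> cover_inter U I m \<Longrightarrow> \<tau> \<subseteq> \<sigma> \<Longrightarrow> \<tau> \<noteq> {} \<Longrightarrow> \<tau> \<in> cover_inter U I m"
    and "\<sigma> \<in> cover_inter U I m \<Longrightarrow> I \<noteq> {} \<Longrightarrow> finite \<sigma> \<and> \<sigma> \<noteq> {}"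
proof -
  have U: "simplicial_complex (U i j)" "mono (U i)" if "i \<in> I" for i j
    using assms that by (auto simp: filtered_cover_def filtered_complex_def)
  show "\<sigma> \<in> cover_inter U I m \<Longrightarrow> m \<le> n \<Longrightarrow> \<sigma> \<in> cover_inter U I n"
    using monoD[OF U(2), of _ m n] by (auto simp: cover_inter_def)
  show "\<sigma> \<in> cover_inter U I m \<Longrightarrow> \<tau> \<subseteq> \<sigma> \<Longrightarrow> \<tau> \<noteq> {} \<Longrightarrow> \<tau> \<in> cover_inter U I m"
    using U(1)[of _ m] unfolding cover_inter_def simplicial_complex_def by blast
  show "\<sigma> \<in> cover_inter U I m \<Longrightarrow> I \<noteq> {} \<Longrightarrow> finite \<sigma> \<and> \<sigma> \<noteq> {}"
    using U(1)[of _ m] unfolding cover_inter_def simplicial_complex_def by auto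
qed

text \<open>The lower bound exists because the members of the filtration of a filtered complex have empty intersection.\<close>

lemma mv_degree_le_iff:
  assumes U: "filtered_cover X \<Lambda> U" and I: "I \<subseteq> \<Lambda>" "I \<noteq> {}" and \<sigma>: "\<sigma> \<in> total (cover_inter U I)"
  shows "mv_degree U (\<sigma>, I) \<le> j \<longleftrightarrow> \<sigma> \<in> cover_inter U I j"
proof -
  obtain k where k: "\<sigma> \<in> cover_inter U I k" using \<sigma> by (auto simp: total_def)
  obtain i where i: "i \<in> I" using I by blast
  then have "(\<Inter>j. U i j) = {}" using U I by (auto simp: filtered_cover_def filtered_complex_def)
  then obtain b where b: "\<sigma> \<notin> U i b" by blast
  have low: "b \<le> j" if "\<sigma> \<in> cover_inter U I j" for j
  proof (rule ccontr)
    assume "\<not> b \<le> j"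
    then have "\<sigma> \<in> cover_inter U I b" using cover_inter_filtered(1)[OF U I(1) that] by simp
    then show False using b i by (auto simp: cover_inter_def)
  qed
  have "\<sigma> \<in> cover_inter U I (mv_degree U (\<sigma>, I))"
    unfolding mv_degree_def prod.case by (rule int_Least(1)[of "\<lambda>j. \<sigma> \<in> cover_inter U I j"]) (fact k, fact low)
  moreover have "mv_degree U (\<sigma>, I) \<le> j" if "\<sigma> \<in> cover_inter U I j"
    unfolding mv_degree_def prod.case
    by (rule int_Least(2)[of "\<lambda>j. \<sigma> \<in> cover_inter U I j"]) (fact k, fact low, fact that)
  ultimately show ?thesis using cover_inter_filtered(1)[OF U I(1)] by blast
qed

lemma mv_basis_iff:
  "(\<sigma>, I) \<in> mv_basis \<Lambda> U p q \<longleftrightarrow> 0 \<le> p \<and> 0 \<le> q \<and> I \<subseteq> \<Lambda> \<and> int (card I) = p + 1 \<and>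
     \<sigma> \<in> total (cover_inter U I) \<and> int (card \<sigma>) = q + 1"
  by (simp add: mv_basis_def)

lemma mv_basis_finite: "(\<sigma>, I) \<in> mv_basis \<Lambda> U p q \<Longrightarrow> finite \<sigma> \<and> finite I \<and> \<sigma> \<noteq> {} \<and> I \<noteq> {}"
  by (auto simp: mv_basis_iff intro: card_ge_0_finite)

lemma mv_basis_monotone:
  assumes U: "filtered_cover X \<Lambda> U" and b: "(\<sigma>, I) \<in> mv_basis \<Lambda> U p q"
  shows "degree_monotone (mv_degree U) \<sigma> I"
    and "\<tau> \<subseteq> \<sigma> \<Longrightarrow> \<tau> \<noteq> {} \<Longrightarrow> J \<subseteq> I \<Longrightarrow> \<tau> \<in> total (cover_inter U J)"
proof -
  have I: "I \<subseteq> \<Lambda>" "\<sigma> \<in> total (cover_inter U I)" using b by (simp_all add: mv_basis_iff)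
  then obtain j where j: "\<sigma> \<in> cover_inter U I j" by (auto simp: total_def)
  have t: "\<tau> \<in> total (cover_inter U J)" if "\<tau> \<subseteq> \<sigma>" "\<tau> \<noteq> {}" "J \<subseteq> I" for \<tau> J
  proof -
    have "\<tau> \<in> cover_inter U I j" by (rule cover_inter_filtered(2)[OF U I(1) j that(1,2)])
    then show ?thesis using that(3) by (auto simp: total_def cover_inter_def)
  qed
  then show "\<tau> \<subseteq> \<sigma> \<Longrightarrow> \<tau> \<noteq> {} \<Longrightarrow> J \<subseteq> I \<Longrightarrow> \<tau> \<in> total (cover_inter U J)" .
  show "degree_monotone (mv_degree U) \<sigma> I"
    unfolding degree_monotone_def
  proof (intro allI impI, elim conjE)
    fix \<tau> \<rho> J K assume a: "\<rho> \<subseteq> \<tau>" "\<tau> \<subseteq> \<sigma>" "\<rho> \<noteq> {}" "K \<subseteq> J" "J \<subseteq> I" "K \<noteq> {}"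
    have *: "J \<subseteq> \<Lambda>" "J \<noteq> {}" "K \<subseteq> \<Lambda>" "\<tau> \<noteq> {}" "\<rho> \<subseteq> \<sigma>" "K \<subseteq> I" using a I by auto
    have "\<tau> \<in> cover_inter U J (mv_degree U (\<tau>, J))"
      using mv_degree_le_iff[OF U *(1,2) t[OF a(2) *(4) a(5)], of "mv_degree U (\<tau>, J)"] by simp
    then have "\<rho> \<in> cover_inter U J (mv_degree U (\<tau>, J))"
      by (rule cover_inter_filtered(2)[OF U *(1) _ a(1,3)])
    then have "\<rho> \<in> cover_inter U K (mv_degree U (\<tau>, J))" using a(4) by (auto simp: cover_inter_def)
    then show "mv_degree U (\<rho>, K) \<le> mv_degree U (\<tau>, J)"
      using mv_degree_le_iff[OF U *(3) a(6) t[OF *(5) a(3) *(6)]] by simp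
  qed
qed

definition mv_total_basis :: "'i set \<Rightarrow> ('i \<Rightarrow> int \<Rightarrow> 'v set set) \<Rightarrow> int \<Rightarrow> ('v set \<times> 'i set) set" where
  "mv_total_basis \<Lambda> U n = (\<Union>i. mv_basis \<Lambda> U i (n - i))"

lemma mv_total_basis_iff:
  "(\<sigma>, I) \<in> mv_total_basis \<Lambda> U n \<longleftrightarrow> finite \<sigma> \<and> finite I \<and> \<sigma> \<noteq> {} \<and> I \<noteq> {} \<and> I \<subseteq> \<Lambda> \<and>
     int (card I) + int (card \<sigma>) = n + 2 \<and> \<sigma> \<in> total (cover_inter U I)"
proof
  assume "(\<sigma>, I) \<in> mv_total_basis \<Lambda> U n"
  then obtain i where i: "(\<sigma>, I) \<in> mv_basis \<Lambda> U i (n - i)" by (auto simp: mv_total_basis_def)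
  then show "finite \<sigma> \<and> finite I \<and> \<sigma> \<noteq> {} \<and> I \<noteq> {} \<and> I \<subseteq> \<Lambda> \<and>
     int (card I) + int (card \<sigma>) = n + 2 \<and> \<sigma> \<in> total (cover_inter U I)"
    using mv_basis_finite[OF i] by (simp add: mv_basis_iff)
next
  assume a: "finite \<sigma> \<and> finite I \<and> \<sigma> \<noteq> {} \<and> I \<noteq> {} \<and> I \<subseteq> \<Lambda> \<and>
     int (card I) + int (card \<sigma>) = n + 2 \<and> \<sigma> \<in> total (cover_inter U I)"
  then have "0 < card I" "0 < card \<sigma>" by auto
  then have "(\<sigma>, I) \<in> mv_basis \<Lambda> U (int (card I) - 1) (n - (int (card I) - 1))"
    using a by (simp add: mv_basis_iff)
  then show "(\<sigma>, I) \<in> mv_total_basis \<Lambda> U n" by (auto simp: mv_total_basis_def)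
qed

lemma mv_filt_iff:
  "x \<in> mv_filt \<Lambda> U p n \<longleftrightarrow>
    keys x \<subseteq> mv_total_basis \<Lambda> U n \<and> (\<forall>(\<sigma>, I)\<in>keys x. int (card I) \<le> p + 1)"
proof -
  have "b \<in> (\<Union>i\<in>{..p}. mv_basis \<Lambda> U i (n - i)) \<longleftrightarrow> b \<in> mv_total_basis \<Lambda> U n \<and> int (card (snd b)) \<le> p + 1" for b
    by (cases b) (auto simp: mv_total_basis_def mv_basis_iff)
  then have "keys x \<subseteq> (\<Union>i\<in>{..p}. mv_basis \<Lambda> U i (n - i)) \<longleftrightarrow>
      (\<forall>b\<in>keys x. b \<in> mv_total_basis \<Lambda> U n \<and> int (card (snd b)) \<le> p + 1)"
    by blast
  then show ?thesis by (auto simp: mv_filt_def split_beta)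
qed

lemma mv_differential_total:
  assumes "keys x \<subseteq> mv_total_basis \<Lambda> U n"
  shows "mv_differential U x = linear_extension (total_boundary (mv_degree U)) x"
proof (rule mv_differential_eq)
  fix \<sigma> I assume "(\<sigma>, I) \<in> keys x"
  then have "(\<sigma>, I) \<in> mv_total_basis \<Lambda> U n" using assms by blast
  then show "finite \<sigma> \<and> finite I" by (simp add: mv_total_basis_iff)
qed

lemma total_basis_monotone:
  assumes "filtered_cover X \<Lambda> U" "(\<sigma>, I) \<in> mv_total_basis \<Lambda> U n"
  shows "degree_monotone (mv_degree U) \<sigma> I"
    and "\<tau> \<subseteq> \<sigma> \<Longrightarrow> \<tau> \<noteq> {} \<Longrightarrow> J \<subseteq> I \<Longrightarrow> \<tau> \<in> total (cover_inter U J)"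
proof -
  obtain i where "(\<sigma>, I) \<in> mv_basis \<Lambda> U i (n - i)" using assms(2) by (auto simp: mv_total_basis_def)
  note m = mv_basis_monotone[OF assms(1) this]
  show "degree_monotone (mv_degree U) \<sigma> I" by (rule m(1))
  show "\<tau> \<subseteq> \<sigma> \<Longrightarrow> \<tau> \<noteq> {} \<Longrightarrow> J \<subseteq> I \<Longrightarrow> \<tau> \<in> total (cover_inter U J)" by (rule m(2))
qed

lemma total_boundary_keys:
  assumes U: "filtered_cover X \<Lambda> U" and b: "b \<in> mv_total_basis \<Lambda> U n"
  shows "keys (total_boundary deg b :: _ \<Rightarrow>\<^sub>0 'k::field poly) \<subseteq> mv_total_basis \<Lambda> U (n - 1)"
proof -
  obtain \<sigma> I where bI: "b = (\<sigma>, I)" by fastforce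
  note mem = b[unfolded bI mv_total_basis_iff]
  have "(\<sigma> - {v}, I) \<in> mv_total_basis \<Lambda> U (n - 1)" if "v \<in> \<sigma>" "\<not> card \<sigma> \<le> 1" for v
  proof -
    have "\<sigma> - {v} \<noteq> {}" by (rule card_ge_2_remove[OF _ that(2)]) (use mem in simp)
    moreover have "card \<sigma> = Suc (card (\<sigma> - {v}))" by (rule card.remove[OF _ that(1)]) (use mem in simp)
    ultimately show ?thesis
      using mem total_basis_monotone(2)[OF U b[unfolded bI], of "\<sigma> - {v}" I] by (simp add: mv_total_basis_iff)
  qed
  then have "keys (vertical_boundary deg (\<sigma>, I) :: _ \<Rightarrow>\<^sub>0 'k poly) \<subseteq> mv_total_basis \<Lambda> U (n - 1)"
    by (intro order_trans[OF keys_vertical_boundary]) auto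
  moreover have "(\<sigma>, I - {i}) \<in> mv_total_basis \<Lambda> U (n - 1)" if "i \<in> I" "\<not> card I \<le> 1" for i
  proof -
    have "I - {i} \<noteq> {}" by (rule card_ge_2_remove[OF _ that(2)]) (use mem in simp)
    moreover have "card I = Suc (card (I - {i}))" by (rule card.remove[OF _ that(1)]) (use mem in simp)
    ultimately show ?thesis
      using mem total_basis_monotone(2)[OF U b[unfolded bI], of \<sigma> "I - {i}"] by (auto simp: mv_total_basis_iff)
  qed
  then have "keys (horizontal_boundary deg (\<sigma>, I) :: _ \<Rightarrow>\<^sub>0 'k poly) \<subseteq> mv_total_basis \<Lambda> U (n - 1)"
    by (intro order_trans[OF keys_horizontal_boundary]) auto
  ultimately show ?thesis
    unfolding bI total_boundary_def by (intro keys_add_le keys_scale_le)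
qed

lemma mv_differential_keys:
  assumes U: "filtered_cover X \<Lambda> U" and x: "keys x \<subseteq> mv_total_basis \<Lambda> U n"
  shows "keys (mv_differential U x) \<subseteq> mv_total_basis \<Lambda> U (n - 1)"
  unfolding mv_differential_total[OF x] using x by (intro keys_linear_extension total_boundary_keys[OF U]) blast

lemma mv_differential_square:
  assumes U: "filtered_cover X \<Lambda> U" and x: "keys x \<subseteq> mv_total_basis \<Lambda> U n"
  shows "mv_differential U (mv_differential U x) = 0"
  unfolding mv_differential_total[OF mv_differential_keys[OF U x]]
  unfolding mv_differential_total[OF x] linear_extension_compose
proof (rule linear_extension_eq_0)
  fix b assume b: "b \<in> keys x"
  obtain \<sigma> I where bI: "b = (\<sigma>, I)" by fastforce
  have "(\<sigma>, I) \<in> mv_total_basis \<Lambda> U n" using b x bI by blast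
  then show "linear_extension (total_boundary (mv_degree U)) (total_boundary (mv_degree U) b) = 0"
    unfolding bI using total_basis_monotone(1)[OF U]
    by (intro total_boundary_total_boundary) (auto simp: mv_total_basis_iff)
qed

lemma mv_differential_linear:
  "mv_differential U (x + y) = mv_differential U x + mv_differential U y"
  "mv_differential U (x - y) = mv_differential U x - mv_differential U y"
  "mv_differential U (scale a x) = scale a (mv_differential U x)"
  "mv_differential U 0 = 0"
  by (simp_all add: mv_differential_def linear_extension_add linear_extension_diff linear_extension_scale)

lemma lookup_vertical_boundary:
  assumes "finite \<sigma>" "\<not> card \<sigma> \<le> 1" "v \<in> \<sigma>"
  shows "lookup (vertical_boundary deg (\<sigma>, I) :: _ \<Rightarrow>\<^sub>0 'k::field poly) (\<sigma> - {v}, I) =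
    monom (position_sign v \<sigma>) (nat (deg (\<sigma>, I) - deg (\<sigma> - {v}, I)))"
proof -
  have "lookup (vertical_boundary deg (\<sigma>, I) :: _ \<Rightarrow>\<^sub>0 'k poly) (\<sigma> - {v}, I) =
    (\<Sum>u\<in>\<sigma>. if u = v then monom (position_sign v \<sigma>) (nat (deg (\<sigma>, I) - deg (\<sigma> - {v}, I))) else 0)"
    unfolding vertical_boundary_def prod.case if_not_P[OF assms(2)] lookup_sum
    by (rule sum.cong) (use assms(3) in \<open>auto simp: lookup_single when_def\<close>)
  then show ?thesis using assms by simp
qed

lemma lookup_horizontal_boundary:
  assumes "finite I" "\<not> card I \<le> 1" "i \<in> I"
  shows "lookup (horizontal_boundary deg (\<sigma>, I) :: _ \<Rightarrow>\<^sub>0 'k::field poly) (\<sigma>, I - {i}) =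
    monom (position_sign i I) (nat (deg (\<sigma>, I) - deg (\<sigma>, I - {i})))"
proof -
  have "lookup (horizontal_boundary deg (\<sigma>, I) :: _ \<Rightarrow>\<^sub>0 'k poly) (\<sigma>, I - {i}) =
    (\<Sum>u\<in>I. if u = i then monom (position_sign i I) (nat (deg (\<sigma>, I) - deg (\<sigma>, I - {i}))) else 0)"
    unfolding horizontal_boundary_def prod.case if_not_P[OF assms(2)] lookup_sum
    by (rule sum.cong) (use assms(3) in \<open>auto simp: lookup_single when_def\<close>)
  then show ?thesis using assms by simp
qed

lemma lookup_total_boundary_other:
  assumes "\<And>v. v \<in> \<sigma> \<Longrightarrow> (\<tau>, J) \<noteq> (\<sigma> - {v}, I)" "\<And>i. i \<in> I \<Longrightarrow> (\<tau>, J) \<noteq> (\<sigma>, I - {i})"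
  shows "lookup (total_boundary deg (\<sigma>, I) :: _ \<Rightarrow>\<^sub>0 'k::field poly) (\<tau>, J) = 0"
proof -
  have "(\<tau>, J) \<notin> keys (vertical_boundary deg (\<sigma>, I) :: _ \<Rightarrow>\<^sub>0 'k poly)"
    using keys_vertical_boundary[of deg \<sigma> I, where 'k = 'k] assms(1) by (auto split: if_splits)
  moreover have "(\<tau>, J) \<notin> keys (horizontal_boundary deg (\<sigma>, I) :: _ \<Rightarrow>\<^sub>0 'k poly)"
    using keys_horizontal_boundary[of deg \<sigma> I, where 'k = 'k] assms(2) by (auto split: if_splits)
  ultimately show ?thesis by (simp add: total_boundary_def lookup_add in_keys_iff)
qed

lemma lookup_total_boundary_vertical:
  assumes "finite \<sigma>" "\<not> card \<sigma> \<le> 1" "v \<in> \<sigma>"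
  shows "lookup (total_boundary deg (\<sigma>, I) :: _ \<Rightarrow>\<^sub>0 'k::field poly) (\<sigma> - {v}, I) =
    (- 1) ^ (card I - 1) * monom (position_sign v \<sigma>) (nat (deg (\<sigma>, I) - deg (\<sigma> - {v}, I)))"
proof -
  have "(\<sigma> - {v}, I) \<notin> keys (horizontal_boundary deg (\<sigma>, I) :: _ \<Rightarrow>\<^sub>0 'k poly)"
    using keys_horizontal_boundary[of deg \<sigma> I, where 'k = 'k] assms(3) by (auto split: if_splits)
  then show ?thesis using lookup_vertical_boundary[OF assms, of deg I, where 'k = 'k]
    by (simp add: total_boundary_def lookup_add in_keys_iff)
qed

lemma lookup_total_boundary_horizontal:
  assumes "finite I" "\<not> card I \<le> 1" "i \<in> I"
  shows "lookup (total_boundary deg (\<sigma>, I) :: _ \<Rightarrow>\<^sub>0 'k::field poly) (\<sigma>, I - {i}) =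
    monom (position_sign i I) (nat (deg (\<sigma>, I) - deg (\<sigma>, I - {i})))"
proof -
  have "(\<sigma>, I - {i}) \<notin> keys (vertical_boundary deg (\<sigma>, I) :: _ \<Rightarrow>\<^sub>0 'k poly)"
    using keys_vertical_boundary[of deg \<sigma> I, where 'k = 'k] assms(3) by (auto split: if_splits)
  then show ?thesis using lookup_horizontal_boundary[OF assms, of deg \<sigma>, where 'k = 'k]
    by (simp add: total_boundary_def lookup_add in_keys_iff)
qed

section \<open>The total complex of the example\<close>

lemma ex_X_filt_top: "2 * int D + 2 \<le> m \<Longrightarrow> ex_X_filt D m = ex_X D"
  by (simp add: ex_X_filt_def)

lemma mem_ex_total:
  assumes "I \<noteq> {}"
  shows "\<sigma> \<in> total (cover_inter (ex_U_filt D) I) \<longleftrightarrow> \<sigma> \<in> ex_X D \<and>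
    (0 \<in> I \<longrightarrow> D + 2 \<notin> \<sigma>) \<and> (\<forall>i\<in>I. i \<noteq> 0 \<longrightarrow> D + 3 \<notin> \<sigma> \<and> i \<notin> \<sigma>)"
proof
  assume "\<sigma> \<in> total (cover_inter (ex_U_filt D) I)"
  then show "\<sigma> \<in> ex_X D \<and> (0 \<in> I \<longrightarrow> D + 2 \<notin> \<sigma>) \<and> (\<forall>i\<in>I. i \<noteq> 0 \<longrightarrow> D + 3 \<notin> \<sigma> \<and> i \<notin> \<sigma>)"
    unfolding total_def UN_iff mem_cover_inter[OF assms] mem_ex_X_filt by blast
next
  assume "\<sigma> \<in> ex_X D \<and> (0 \<in> I \<longrightarrow> D + 2 \<notin> \<sigma>) \<and> (\<forall>i\<in>I. i \<noteq> 0 \<longrightarrow> D + 3 \<notin> \<sigma> \<and> i \<notin> \<sigma>)"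
  then have "\<sigma> \<in> cover_inter (ex_U_filt D) I (2 * int D + 2)"
    unfolding mem_cover_inter[OF assms] by (simp add: ex_X_filt_top)
  then show "\<sigma> \<in> total (cover_inter (ex_U_filt D) I)" by (auto simp: total_def)
qed

definition ex_basis :: "nat \<Rightarrow> int \<Rightarrow> (nat set \<times> nat set) set" where
  "ex_basis D = mv_total_basis {0..D + 1} (ex_U_filt D)"

abbreviation ex_degree :: "nat \<Rightarrow> nat set \<times> nat set \<Rightarrow> int" where
  "ex_degree D \<equiv> mv_degree (ex_U_filt D)"

lemma mem_ex_basis:
  "(\<sigma>, I) \<in> ex_basis D n \<longleftrightarrow> I \<noteq> {} \<and> I \<subseteq> {0..D + 1} \<and> int (card I) + int (card \<sigma>) = n + 2 \<and>
     \<sigma> \<in> ex_X D \<and> (0 \<in> I \<longrightarrow> D + 2 \<notin> \<sigma>) \<and> (\<forall>i\<in>I. i \<noteq> 0 \<longrightarrow> D + 3 \<notin> \<sigma> \<and> i \<notin> \<sigma>)"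
proof (cases "I \<noteq> {} \<and> I \<subseteq> {0..D + 1}")
  case True
  then have "finite I" using finite_subset by blast
  moreover have "finite \<sigma> \<and> \<sigma> \<noteq> {}" if "\<sigma> \<in> ex_X D"
    using ex_X_finite[OF that] that by (simp add: ex_X_def)
  ultimately show ?thesis using True mem_ex_total[of I \<sigma> D]
    unfolding ex_basis_def mv_total_basis_iff by auto
next
  case False
  then show ?thesis unfolding ex_basis_def mv_total_basis_iff by blast
qed

lemma ex_basis_finite:
  assumes "(\<sigma>, I) \<in> ex_basis D n"
  shows "finite \<sigma>" "\<sigma> \<noteq> {}" "finite I" "I \<noteq> {}" "card \<sigma> \<noteq> 0"
proof -
  have "finite \<sigma> \<and> finite I \<and> \<sigma> \<noteq> {} \<and> I \<noteq> {}"
    using assms by (simp only: ex_basis_def mv_total_basis_iff simp_thms)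
  then show "finite \<sigma>" "\<sigma> \<noteq> {}" "finite I" "I \<noteq> {}" "card \<sigma> \<noteq> 0" by simp_all
qed

lemmas ex_differential_total = mv_differential_total[of _ "{0..D + 1}" "ex_U_filt D" for D, folded ex_basis_def]
lemmas ex_differential_keys = mv_differential_keys[OF ex_filtered_cover, folded ex_basis_def]
lemmas ex_differential_square = mv_differential_square[OF ex_filtered_cover, folded ex_basis_def]
lemmas ex_basis_monotone = total_basis_monotone[OF ex_filtered_cover, folded ex_basis_def]

lemma ex_basis_face:
  assumes "(\<sigma>, I) \<in> ex_basis D n" "\<tau> \<subseteq> \<sigma>" "\<tau> \<noteq> {}" "J \<subseteq> I" "J \<noteq> {}"
  shows "(\<tau>, J) \<in> ex_basis D (int (card J) + int (card \<tau>) - 2)"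
  using assms ex_X_face[of \<sigma> D \<tau>] unfolding mem_ex_basis by auto

lemma ex_degree_le_iff:
  assumes "(\<sigma>, I) \<in> ex_basis D n"
  shows "ex_degree D (\<sigma>, I) \<le> m \<longleftrightarrow> \<sigma> \<in> ex_X_filt D m"
proof -
  have I: "I \<subseteq> {0..D + 1}" "I \<noteq> {}" "\<sigma> \<in> total (cover_inter (ex_U_filt D) I)"
    using assms unfolding ex_basis_def by (simp_all only: mv_total_basis_iff not_False_eq_True)
  have "\<sigma> \<in> cover_inter (ex_U_filt D) I m \<longleftrightarrow> \<sigma> \<in> ex_X_filt D m"
    using I(3) unfolding mem_ex_total[OF I(2)] mem_cover_inter[OF I(2)] by blast
  then show ?thesis using mv_degree_le_iff[OF ex_filtered_cover I] by simp
qed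

lemma ex_degree_eqI:
  assumes "(\<sigma>, I) \<in> ex_basis D n" "\<sigma> \<in> ex_X_filt D m" "\<sigma> \<notin> ex_X_filt D (m - 1)"
  shows "ex_degree D (\<sigma>, I) = m"
  using ex_degree_le_iff[OF assms(1), of m] ex_degree_le_iff[OF assms(1), of "m - 1"] assms(2,3) by simp

lemma ex_degree_base:
  assumes b: "(\<sigma>, I) \<in> ex_basis D n" and "0 \<notin> \<sigma>"
  shows "ex_degree D (\<sigma>, I) = - 2 * int D"
  using assms by (intro ex_degree_eqI[OF b]) (auto simp: mem_ex_X_filt mem_ex_basis)

lemma ex_degree_zero:
  assumes b: "(\<sigma>, I) \<in> ex_basis D n" and "0 \<in> \<sigma>" "D + 2 \<notin> \<sigma>"
  shows "ex_degree D (\<sigma>, I) = 0"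
  using assms by (intro ex_degree_eqI[OF b]) (auto simp: mem_ex_X_filt mem_ex_basis)

lemma ex_degree_ge:
  assumes b: "(\<sigma>, I) \<in> ex_basis D n"
  shows "- 2 * int D \<le> ex_degree D (\<sigma>, I)"
proof -
  have "\<sigma> \<notin> ex_X_filt D (- 2 * int D - 1)" by (simp add: mem_ex_X_filt)
  then show ?thesis using ex_degree_le_iff[OF b, of "- 2 * int D - 1"] by linarith
qed

text \<open>The index sets that occur in filtration degree \<open>D\<close>.\<close>

definition omit :: "nat \<Rightarrow> nat \<Rightarrow> nat set" where
  "omit D a = {0..D + 1} - {a}"

lemma mem_omit [simp]: "i \<in> omit D a \<longleftrightarrow> i \<le> D + 1 \<and> i \<noteq> a"
  by (auto simp: omit_def)

lemma finite_omit [simp]: "finite (omit D a)"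
  by (simp add: omit_def)

lemma omit_inj: "a \<le> D + 1 \<Longrightarrow> omit D a = omit D b \<Longrightarrow> a = b"
  by (metis mem_omit)

lemma card_omit: "a \<le> D + 1 \<Longrightarrow> card (omit D a) = D + 1"
  by (simp add: omit_def)

lemma ex_basis_omit:
  assumes D: "D \<ge> 1" and b: "(\<sigma>, omit D a) \<in> ex_basis D n" and a: "a \<le> D + 1"
  shows "\<sigma> \<subseteq> {0, if a = 0 then D + 2 else a}"
proof
  fix x assume x: "x \<in> \<sigma>"
  note m = b[unfolded mem_ex_basis]
  obtain i where "i \<in> omit D a" "i \<noteq> 0"
    using D by (cases "a = 1") (auto intro: that[of 1] that[of 2])
  then have "x \<noteq> D + 3" "x \<le> D + 3" using m x by (auto simp: ex_X_def)
  moreover have "a \<noteq> 0 \<Longrightarrow> x \<noteq> D + 2" using m x by auto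
  moreover have "x = 0 \<or> x = a" if "x \<le> D + 1" using m x that by auto
  ultimately have "x = 0 \<or> x = a \<or> (a = 0 \<and> x = D + 2)" by (cases "x \<le> D + 1") auto
  then show "x \<in> {0, if a = 0 then D + 2 else a}" using m x by (auto simp: ex_X_def)
qed

lemma ex_X_small:
  assumes "D \<ge> 1" "\<sigma> \<noteq> {}" "\<sigma> \<subseteq> {0, a}" "a \<le> D + 3"
  shows "\<sigma> \<in> ex_X D"
proof -
  have "\<not> {1..D + 1} \<subseteq> \<sigma>"
  proof
    assume "{1..D + 1} \<subseteq> \<sigma>"
    moreover have "1 \<in> {1..D + 1}" "2 \<in> {1..D + 1}" using assms(1) by auto
    ultimately have "1 \<in> {0, a}" "2 \<in> {0, a}" using assms(3) by blast+
    then show False by auto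
  qed
  moreover have "\<not> {D + 2, D + 3} \<subseteq> \<sigma>"
  proof
    assume "{D + 2, D + 3} \<subseteq> \<sigma>"
    then have "D + 2 \<in> {0, a}" "D + 3 \<in> {0, a}" using assms(3) by blast+
    then show False by auto
  qed
  ultimately show ?thesis using assms(2-4) by (auto simp: ex_X_def)
qed

lemma ex_basis_omitI:
  assumes D: "D \<ge> 1" and a: "a \<le> D + 1" and \<sigma>: "\<sigma> \<noteq> {}" "\<sigma> \<subseteq> {0, if a = 0 then D + 2 else a}"
  shows "(\<sigma>, omit D a) \<in> ex_basis D (int D + int (card \<sigma>) - 1)"
proof -
  have "\<sigma> \<in> ex_X D" by (rule ex_X_small[OF D \<sigma>]) (use a in auto)
  moreover have "omit D a \<noteq> {}"
  proof
    assume "omit D a = {}"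
    then have "card (omit D a) = 0" by (simp only: card.empty)
    then show False using card_omit[OF a] by simp
  qed
  moreover have "0 \<in> omit D a \<longrightarrow> D + 2 \<notin> \<sigma>" "\<forall>i\<in>omit D a. i \<noteq> 0 \<longrightarrow> D + 3 \<notin> \<sigma> \<and> i \<notin> \<sigma>"
    using \<sigma>(2) a by (auto split: if_splits)
  moreover have "omit D a \<subseteq> {0..D + 1}" by (auto simp: omit_def)
  ultimately show ?thesis using card_omit[OF a] by (simp add: mem_ex_basis)
qed

lemma ex_basis_point_full: "D \<ge> 1 \<Longrightarrow> ({0}, {0..D + 1}) \<in> ex_basis D (int D + 1)"
  using ex_X_small[of D "{0}" 0] by (simp add: mem_ex_basis)

lemma ex_degree_edge:
  assumes D: "D \<ge> 1"
  shows "ex_degree D ({0, D + 2}, omit D 0) = 2"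
proof (rule ex_degree_eqI)
  show "({0, D + 2}, omit D 0) \<in> ex_basis D (int D + 1)"
    using ex_basis_omitI[OF D, of 0 "{0, D + 2}"] by (simp add: add.commute)
  have "{0, D + 2} \<in> ex_X D" by (rule ex_X_small[OF D]) auto
  then show "{0, D + 2} \<in> ex_X_filt D 2" using D by (auto simp: mem_ex_X_filt)
  show "{0, D + 2} \<notin> ex_X_filt D (2 - 1)" by (auto simp: mem_ex_X_filt)
qed

lemma minus_one_power_sq: "(- 1) ^ n * (- 1) ^ n = (1 :: 'r::comm_ring_1)"
  by (simp flip: power_mult_distrib)

lemma lookup_ex_edge:
  assumes D: "D \<ge> 1"
  shows "lookup (total_boundary (ex_degree D) ({0, D + 2}, omit D 0)) ({D + 2}, omit D 0) =
    ((- 1) ^ D * monom 1 (2 * D + 2) :: 'k::field poly)"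
proof -
  have "({D + 2}, omit D 0) \<in> ex_basis D (int D)" using ex_basis_omitI[OF D, of 0 "{D + 2}"] by simp
  then have "ex_degree D ({D + 2}, omit D 0) = - 2 * int D" by (rule ex_degree_base) simp
  moreover have "{0, D + 2} - {0} = {D + 2}" by auto
  moreover have "nat (2 - - 2 * int D) = 2 * D + 2" by simp
  moreover have "position_sign 0 {0, D + 2} = (1 :: 'k)" by (simp add: position_sign_def)
  moreover have "card (omit D 0) - 1 = D" by (simp add: card_omit)
  moreover have "lookup (total_boundary (ex_degree D) ({0, D + 2}, omit D 0) :: _ \<Rightarrow>\<^sub>0 'k poly) ({0, D + 2} - {0}, omit D 0) =
    (- 1) ^ (card (omit D 0) - 1) * monom (position_sign 0 {0, D + 2})
      (nat (ex_degree D ({0, D + 2}, omit D 0) - ex_degree D ({0, D + 2} - {0}, omit D 0)))"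
    by (rule lookup_total_boundary_vertical) simp_all
  ultimately show ?thesis using ex_degree_edge[OF D] by (simp only:)
qed

text \<open>The intersection of all \<open>U\<^sub>i\<close> with \<open>i \<ge> 1\<close> consists of the vertices \<open>0\<close> and \<open>D + 2\<close> and of the edge between
  them. This edge, which is born \<open>2 * D + 2\<close> degrees after \<open>D + 2\<close>, is the only basis element whose total
  boundary involves the vertex \<open>D + 2\<close> there: the intersection with \<open>U\<^sub>0\<close> does not contain it.\<close>

lemma ex_coefficient_boundary:
  assumes D: "D \<ge> 1" and y: "keys y \<subseteq> ex_basis D (int D + 1)"
  shows "monom 1 (2 * D + 2) dvd
    lookup (mv_differential (ex_U_filt D) y :: _ \<Rightarrow>\<^sub>0 'k::field poly) ({D + 2}, omit D 0)"
  unfolding ex_differential_total[OF y] lookup_linear_extension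
proof (intro dvd_sum dvd_mult)
  fix b assume "b \<in> keys y"
  then have b: "b \<in> ex_basis D (int D + 1)" using y by blast
  obtain \<sigma> I where bI: "b = (\<sigma>, I)" by fastforce
  show "monom 1 (2 * D + 2) dvd
    lookup (total_boundary (ex_degree D) b :: _ \<Rightarrow>\<^sub>0 'k poly) ({D + 2}, omit D 0)"
  proof (cases "b = ({0, D + 2}, omit D 0)")
    case True
    then show ?thesis using lookup_ex_edge[OF D, where 'k = 'k] by simp
  next
    case False
    have "lookup (total_boundary (ex_degree D) (\<sigma>, I) :: _ \<Rightarrow>\<^sub>0 'k poly) ({D + 2}, omit D 0) = 0"
    proof (rule lookup_total_boundary_other)
      fix v assume v: "v \<in> \<sigma>"
      show "({D + 2}, omit D 0) \<noteq> (\<sigma> - {v}, I)"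
      proof
        assume e: "({D + 2}, omit D 0) = (\<sigma> - {v}, I)"
        then have "\<sigma> = {v, D + 2}" "v \<noteq> D + 2" "I = omit D 0" using v by auto
        moreover from this have "v \<in> {0, D + 2}" using ex_basis_omit[OF D, of \<sigma> 0] b bI by auto
        ultimately show False using False bI by auto
      qed
    next
      fix i assume i: "i \<in> I"
      show "({D + 2}, omit D 0) \<noteq> (\<sigma>, I - {i})"
      proof
        assume e: "({D + 2}, omit D 0) = (\<sigma>, I - {i})"
        then have "omit D 0 = I - {i}" "\<sigma> = {D + 2}" by simp_all
        moreover have "I \<subseteq> {0..D + 1}" "0 \<notin> I" using b unfolding bI \<open>\<sigma> = {D + 2}\<close> mem_ex_basis by auto
        ultimately have "i \<in> I - {i}" using i by (metis atLeastAtMost_iff mem_omit subsetD)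
        then show False by blast
      qed
    qed
    then show ?thesis by (simp add: bI)
  qed
qed

section \<open>The page in degree (D, 0)\<close>

lemma ex_basis_filt:
  "x \<in> mv_filt {0..D + 1} (ex_U_filt D) (int D) (int D) \<longleftrightarrow> keys x \<subseteq> ex_basis D (int D)"
  "x \<in> mv_filt {0..D + 1} (ex_U_filt D) (2 * int D + 1) (int D + 1) \<longleftrightarrow> keys x \<subseteq> ex_basis D (int D + 1)"
proof -
  have "int (card I) \<le> n + 1" if "(\<sigma>, I) \<in> ex_basis D n" for \<sigma> I n
  proof -
    have "card \<sigma> \<noteq> 0" by (rule ex_basis_finite[OF that])
    then show ?thesis using that by (simp add: mem_ex_basis)
  qed
  then show "x \<in> mv_filt {0..D + 1} (ex_U_filt D) (int D) (int D) \<longleftrightarrow> keys x \<subseteq> ex_basis D (int D)"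
    "x \<in> mv_filt {0..D + 1} (ex_U_filt D) (2 * int D + 1) (int D + 1) \<longleftrightarrow> keys x \<subseteq> ex_basis D (int D + 1)"
    unfolding mv_filt_iff ex_basis_def[symmetric] by force+
qed

text \<open>On the page \<open>r = D + 2\<close> the filtration has run out on both sides, so that the page consists of the cycles of the
  total complex modulo boundaries and cycles of lower filtration.\<close>

lemma ex_page_cycles:
  "mv_Z {0..D + 1} (ex_U_filt D) (int (D + 2)) (int D) 0 =
    {x :: _ \<Rightarrow>\<^sub>0 'k::field poly. keys x \<subseteq> ex_basis D (int D) \<and> mv_differential (ex_U_filt D) x = 0}"
  unfolding mv_Z_def add_0_right ex_basis_filt by (simp add: mv_filt_neg)

lemma ex_page_boundaries:
  "mv_B {0..D + 1} (ex_U_filt D) (int (D + 2)) (int D) 0 =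
    {x + mv_differential (ex_U_filt D) y | (x :: _ \<Rightarrow>\<^sub>0 'k::field poly) y.
      x \<in> mv_filt {0..D + 1} (ex_U_filt D) (int D - 1) (int D) \<and> mv_differential (ex_U_filt D) x = 0 \<and>
      keys y \<subseteq> ex_basis D (int D + 1)}"
proof -
  have 1: "mv_Z {0..D + 1} (ex_U_filt D) (int (D + 2) - 1) (int D - 1) (0 + 1) =
    {x :: _ \<Rightarrow>\<^sub>0 'k poly. x \<in> mv_filt {0..D + 1} (ex_U_filt D) (int D - 1) (int D) \<and> mv_differential (ex_U_filt D) x = 0}"
    by (simp add: mv_Z_def mv_filt_neg)
  have 2: "mv_Z {0..D + 1} (ex_U_filt D) (int (D + 2) - 1) (int D + int (D + 2) - 1) (0 - int (D + 2) + 2) =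
    {y :: _ \<Rightarrow>\<^sub>0 'k poly. keys y \<subseteq> ex_basis D (int D + 1)}"
  proof -
    have e: "int D + int (D + 2) - 1 = 2 * int D + 1" "0 - int (D + 2) + 2 = - int D" "int (D + 2) - 1 = int D + 1"
      "2 * int D + 1 + - int D = int D + 1" "2 * int D + 1 - (int D + 1) = int D" "int D + 1 - 1 = int D" by simp_all
    show ?thesis unfolding mv_Z_def e ex_basis_filt
      using ex_differential_keys[where n = "int D + 1"] by auto
  qed
  show ?thesis unfolding mv_B_def 1 2 by blast
qed

text \<open>The augmentation of the column over \<open>K\<close>. Shifting degrees by \<open>2 * D\<close>, where the first simplices are
  born, makes all exponents of \<open>t\<close> nonnegative.\<close>

definition vertex_augmentation ::
    "nat \<Rightarrow> nat set \<Rightarrow> nat set \<times> nat set \<Rightarrow> (unit \<Rightarrow>\<^sub>0 'k::field poly)" where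
  "vertex_augmentation D K = (\<lambda>(\<sigma>, I). if card \<sigma> = 1 \<and> I = K
     then single () (monom 1 (nat (ex_degree D (\<sigma>, I) + 2 * int D))) else 0)"

lemma vertex_augmentation_vertical:
  assumes b: "(\<sigma>, I) \<in> ex_basis D n"
  shows "linear_extension (vertex_augmentation D K) (vertical_boundary (ex_degree D) (\<sigma>, I)) = (0 :: _ \<Rightarrow>\<^sub>0 'k::field poly)"
proof (cases "card \<sigma> = 2 \<and> I = K")
  case False
  have fin: "finite \<sigma>" by (rule ex_basis_finite[OF b])
  show ?thesis
  proof (rule linear_extension_eq_0)
    fix c assume "c \<in> keys (vertical_boundary (ex_degree D) (\<sigma>, I) :: _ \<Rightarrow>\<^sub>0 'k poly)"
    then obtain v where v: "v \<in> \<sigma>" "c = (\<sigma> - {v}, I)" "\<not> card \<sigma> \<le> 1"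
      using keys_vertical_boundary[of "ex_degree D" \<sigma> I, where 'k = 'k] by (auto split: if_splits)
    have "card (\<sigma> - {v}) = 1 \<Longrightarrow> card \<sigma> = 2" using v(1) fin by simp
    then show "vertex_augmentation D K c = (0 :: _ \<Rightarrow>\<^sub>0 'k poly)" using False v by (auto simp: vertex_augmentation_def)
  qed
next
  case True
  then obtain u w where uw: "\<sigma> = {u, w}" "u < w"
    by (metis card_2_iff insert_commute linorder_neqE)
  then have "{u, w} - {u} = {w}" "{u, w} - {w} = {u}" "u \<noteq> w" "\<not> card {u, w} \<le> 1" by auto
  moreover have "{x \<in> {u, w}. x < u} = {}" "{x \<in> {u, w}. x < w} = {u}" using uw(2) by auto
  then have "position_sign u {u, w} = (1 :: 'k)" "position_sign w {u, w} = (- 1 :: 'k)"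
    by (simp_all only: position_sign_def) simp_all
  moreover have m: "degree_monotone (ex_degree D) \<sigma> I" by (rule ex_basis_monotone(1)[OF b])
  have "I \<noteq> {}" by (rule ex_basis_finite[OF b])
  have "nat (ex_degree D ({u, w}, I) - ex_degree D ({x}, I)) + nat (ex_degree D ({x}, I) + 2 * int D) =
      nat (ex_degree D ({u, w}, I) + 2 * int D)" if "x \<in> {u, w}" for x
  proof -
    have "({x}, I) \<in> ex_basis D (int (card I) + int (card {x}) - 2)"
      by (rule ex_basis_face[OF b]) (use that uw \<open>I \<noteq> {}\<close> in auto)
    then have "- 2 * int D \<le> ex_degree D ({x}, I)" by (rule ex_degree_ge)
    moreover have "ex_degree D ({x}, I) \<le> ex_degree D ({u, w}, I)"
      using degree_monotoneD[OF m, of "{x}" "{u, w}" I I] that uw \<open>I \<noteq> {}\<close> by simp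
    ultimately show ?thesis by simp
  qed
  ultimately show ?thesis
    using True uw(1) by (simp add: vertical_boundary_def vertex_augmentation_def linear_extension_add linear_extension_diff mult_monom
        minus_monom[symmetric] single_uminus)
qed

lemma vertex_augmentation_horizontal:
  assumes fin: "finite I" and "\<And>i. i \<in> I \<Longrightarrow> card \<sigma> \<noteq> 1 \<or> I - {i} \<noteq> K"
  shows "linear_extension (vertex_augmentation D K) (horizontal_boundary (ex_degree D) (\<sigma>, I)) = (0 :: _ \<Rightarrow>\<^sub>0 'k::field poly)"
proof (rule linear_extension_eq_0)
  fix c assume "c \<in> keys (horizontal_boundary (ex_degree D) (\<sigma>, I) :: _ \<Rightarrow>\<^sub>0 'k poly)"
  then obtain i where v: "i \<in> I" "c = (\<sigma>, I - {i})"
    using keys_horizontal_boundary[of "ex_degree D" \<sigma> I, where 'k = 'k] by (auto split: if_splits)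
  then show "vertex_augmentation D K c = (0 :: _ \<Rightarrow>\<^sub>0 'k poly)" using assms(2)[OF v(1)] by (auto simp: vertex_augmentation_def)
qed

lemma vertex_augmentation_top:
  assumes D: "D \<ge> 1" and a: "a \<in> {1..D + 1}"
  shows "linear_extension (vertex_augmentation D (omit D a - {0})) (horizontal_boundary (ex_degree D) ({a}, omit D a)) =
    (single () 1 :: _ \<Rightarrow>\<^sub>0 'k::field poly)"
proof -
  let ?K = "omit D a - {0}"
  have b: "({a}, omit D a) \<in> ex_basis D (int D)" using ex_basis_omitI[OF D, of a "{a}"] a by auto
  have c: "\<not> card (omit D a) \<le> 1" using card_omit[of a D] a D by simp
  have zero: "0 \<in> omit D a" using a by simp
  have "omit D a - {i} = ?K \<longleftrightarrow> i = 0" if "i \<in> omit D a" for i using that zero by blast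
  then have "linear_extension (vertex_augmentation D ?K) (horizontal_boundary (ex_degree D) ({a}, omit D a)) =
    (\<Sum>i\<in>omit D a. if i = 0 then single () (monom (position_sign 0 (omit D a))
        (nat (ex_degree D ({a}, omit D a) - ex_degree D ({a}, ?K))) * monom 1 (nat (ex_degree D ({a}, ?K) + 2 * int D))) else (0 :: _ \<Rightarrow>\<^sub>0 'k poly))"
    unfolding horizontal_boundary_def prod.case if_not_P[OF c] linear_extension_sum linear_extension_single
    by (intro sum.cong refl) (simp add: vertex_augmentation_def)
  also have "\<dots> = single () (monom (position_sign 0 (omit D a))
        (nat (ex_degree D ({a}, omit D a) - ex_degree D ({a}, ?K))) * monom 1 (nat (ex_degree D ({a}, ?K) + 2 * int D)))"
    using zero by (subst sum.delta) auto
  also have "ex_degree D ({a}, omit D a) = - 2 * int D" using a by (intro ex_degree_base[OF b]) auto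
  also have "ex_degree D ({a}, ?K) = - 2 * int D"
  proof (rule ex_degree_base)
    have "card (omit D a) = Suc (card ?K)" by (rule card.remove[OF _ zero]) simp
    then have "card ?K = D" using card_omit[of a D] a by simp
    then have "?K \<noteq> {}" using D by (metis card.empty not_one_le_zero)
    then show "({a}, ?K) \<in> ex_basis D (int (card ?K) + int (card {a}) - 2)"
      by (intro ex_basis_face[OF b]) auto
  qed (use a in auto)
  also have "position_sign 0 (omit D a) = (1 :: 'k)" by (simp add: position_sign_def)
  finally show ?thesis by (simp add: mult_monom one_pCons monom_0)
qed

text \<open>The part of filtration degree \<open>D\<close> has two vertices in each column, of which one is excluded by assumption.
  Augmentation over \<open>{1..D + 1} - {a}\<close> kills the vertical boundary and thus relates the columns that omit \<open>0\<close>
  and \<open>a\<close>. As nothing is left in the former, the remaining coefficient in the latter vanishes.\<close>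

lemma ex_kernel_reduced:
  fixes x :: "_ \<Rightarrow>\<^sub>0 'k::field poly"
  assumes D: "D \<ge> 1" and x: "keys x \<subseteq> ex_basis D (int D)" "mv_differential (ex_U_filt D) x = 0"
    and b0: "lookup x ({D + 2}, omit D 0) = 0"
    and zero: "\<And>a. a \<le> D + 1 \<Longrightarrow> lookup x ({0}, omit D a) = 0"
  shows "x \<in> mv_filt {0..D + 1} (ex_U_filt D) (int D - 1) (int D)"
proof -
  have top: "\<exists>a\<le>D + 1. I = omit D a \<and> (\<sigma> = {0} \<or> \<sigma> = {if a = 0 then D + 2 else a})"
    if b: "(\<sigma>, I) \<in> ex_basis D (int D)" and c: "card I = D + 1" for \<sigma> I
  proof -
    have I: "I \<subseteq> {0..D + 1}" "card \<sigma> = 1" using b c unfolding mem_ex_basis by simp_all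
    have "card ({0..D + 1} - I) = 1"
      using I(1) c finite_subset[OF I(1)] by (subst card_Diff_subset) simp_all
    then obtain a where "{0..D + 1} - I = {a}" by (auto simp: card_1_singleton_iff)
    then have "a \<in> {0..D + 1}" "I = {0..D + 1} - {a}" using I(1) by blast+
    then have a: "a \<le> D + 1" "I = omit D a" by (simp_all add: omit_def)
    moreover obtain u where "\<sigma> = {u}" using I(2) by (auto simp: card_1_singleton_iff)
    ultimately show ?thesis using ex_basis_omit[OF D, of \<sigma> a] b by (intro exI[of _ a]) auto
  qed
  have apex: "lookup x ({a}, omit D a) = 0" if a: "a \<in> {1..D + 1}" for a
  proof -
    let ?K = "omit D a - {0}"
    have aug: "linear_extension (vertex_augmentation D ?K) (total_boundary (ex_degree D) b) =
        (if b = ({a}, omit D a) then single () 1 else (0 :: _ \<Rightarrow>\<^sub>0 'k poly))" if b: "b \<in> keys x" for b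
    proof -
      obtain \<sigma> I where bI: "b = (\<sigma>, I)" by fastforce
      have bb: "(\<sigma>, I) \<in> ex_basis D (int D)" using b x(1) bI by blast
      have "linear_extension (vertex_augmentation D ?K) (total_boundary (ex_degree D) b) =
          (linear_extension (vertex_augmentation D ?K) (horizontal_boundary (ex_degree D) (\<sigma>, I)) :: _ \<Rightarrow>\<^sub>0 'k poly)"
        by (simp add: bI total_boundary_def linear_extension_add linear_extension_scale vertex_augmentation_vertical[OF bb])
      also have "\<dots> = (if b = ({a}, omit D a) then single () 1 else 0)"
      proof (cases "b = ({a}, omit D a)")
        case True
        then show ?thesis using vertex_augmentation_top[OF D a, where 'k = 'k] bI by simp
      next
        case False
        have "card \<sigma> \<noteq> 1 \<or> I - {i} \<noteq> ?K" if i: "i \<in> I" for i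
        proof (rule ccontr)
          assume "\<not> (card \<sigma> \<noteq> 1 \<or> I - {i} \<noteq> ?K)"
          then have c: "card \<sigma> = 1" "I - {i} = ?K" by simp_all
          then have cI: "card I = D + 1" using bb unfolding mem_ex_basis by simp
          obtain a' where a': "a' \<le> D + 1" "I = omit D a'" "\<sigma> = {0} \<or> \<sigma> = {if a' = 0 then D + 2 else a'}"
            using top[OF bb cI] by blast
          have "a' = 0 \<or> a' = a"
          proof (rule ccontr)
            assume "\<not> (a' = 0 \<or> a' = a)"
            then have "a' \<in> ?K" using a'(1) by simp
            then have "a' \<in> omit D a'" using c(2) a'(2) by blast
            then show False by simp
          qed
          then have "\<sigma> = {0} \<or> (a' = 0 \<and> \<sigma> = {D + 2})" using a'(3) False bI a'(2) by auto
          then have "lookup x b = 0" using zero[OF a'(1)] b0 bI a'(2) by auto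
          then show False using b by (simp add: in_keys_iff)
        qed
        then have "linear_extension (vertex_augmentation D ?K) (horizontal_boundary (ex_degree D) (\<sigma>, I)) =
            (0 :: _ \<Rightarrow>\<^sub>0 'k poly)"
          by (intro vertex_augmentation_horizontal ex_basis_finite(3)[OF bb])
        then show ?thesis using False by simp
      qed
      finally show ?thesis .
    qed
    have "0 = linear_extension (vertex_augmentation D ?K) (mv_differential (ex_U_filt D) x)" by (simp add: x(2))
    also have "\<dots> = linear_extension (\<lambda>b. if b = ({a}, omit D a) then single () 1 else 0) x"
      unfolding ex_differential_total[OF x(1)] linear_extension_compose by (rule linear_extension_cong[OF aug])
    also have "\<dots> = single () (lookup x ({a}, omit D a))"
      by (subst linear_extension_superset[of "insert ({a}, omit D a) (keys x)"])
        (auto simp: if_distrib[of "scale _"] sum.delta cong: if_cong)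
    finally show ?thesis by (metis lookup_single_eq lookup_zero)
  qed
  have "int (card I) \<le> int D - 1 + 1" if k: "(\<sigma>, I) \<in> keys x" for \<sigma> I
  proof -
    have b: "(\<sigma>, I) \<in> ex_basis D (int D)" using k x(1) by blast
    have "card \<sigma> \<noteq> 0" by (rule ex_basis_finite[OF b])
    then have le: "card I \<le> D + 1" using b unfolding mem_ex_basis by simp
    have "card I \<noteq> D + 1"
    proof
      assume "card I = D + 1"
      then obtain a where a: "a \<le> D + 1" "I = omit D a" "\<sigma> = {0} \<or> \<sigma> = {if a = 0 then D + 2 else a}"
        using top[OF b] by blast
      then have "lookup x (\<sigma>, I) = 0"
        using zero[OF a(1)] b0 apex[of a] by (cases "a = 0") auto
      then show False using k by (simp add: in_keys_iff)
    qed
    then show ?thesis using le by simp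
  qed
  then show ?thesis unfolding mv_filt_iff ex_basis_def[symmetric] using x(1) by auto
qed

text \<open>Three kinds of boundaries clear the coefficients in filtration degree \<open>D\<close>: the edge over \<open>{1..D + 1}\<close> removes
  the vertex \<open>D + 2\<close>, which is possible exactly because of the divisibility; the vertex \<open>0\<close> over all indices
  then removes the vertex \<open>0\<close> over \<open>{1..D + 1}\<close>; and in each other column the edge \<open>{0, a}\<close> removes the vertex \<open>0\<close>.\<close>

lemma ex_kernel:
  fixes x :: "_ \<Rightarrow>\<^sub>0 'k::field poly"
  assumes D: "D \<ge> 1" and x: "keys x \<subseteq> ex_basis D (int D)" "mv_differential (ex_U_filt D) x = 0"
    and dvd: "monom 1 (2 * D + 2) dvd lookup x ({D + 2}, omit D 0)"
  obtains y where "keys y \<subseteq> ex_basis D (int D + 1)"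
    "x - mv_differential (ex_U_filt D) y \<in> mv_filt {0..D + 1} (ex_U_filt D) (int D - 1) (int D)"
proof -
  let ?d = "mv_differential (ex_U_filt D) :: (_ \<Rightarrow>\<^sub>0 'k poly) \<Rightarrow> _"
  let ?t = "total_boundary (ex_degree D) :: _ \<Rightarrow> (_ \<Rightarrow>\<^sub>0 'k poly)"
  let ?s = "(- 1) ^ D :: 'k poly"
  obtain p where p: "lookup x ({D + 2}, omit D 0) = monom 1 (2 * D + 2) * p" using dvd by (rule dvdE)
  define y1 :: "nat set \<times> nat set \<Rightarrow>\<^sub>0 'k poly" where "y1 = single ({0, D + 2}, omit D 0) (?s * p)"
  have y1: "keys y1 \<subseteq> ex_basis D (int D + 1)"
    using ex_basis_omitI[OF D, of 0 "{0, D + 2}"] by (simp add: y1_def add.commute)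
  have d1: "?d y1 = scale (?s * p) (?t ({0, D + 2}, omit D 0))"
    unfolding ex_differential_total[OF y1] by (simp add: y1_def)
  define y2 :: "nat set \<times> nat set \<Rightarrow>\<^sub>0 'k poly" where
    "y2 = single ({0}, {0..D + 1}) (lookup (x - ?d y1) ({0}, omit D 0))"
  have y2: "keys y2 \<subseteq> ex_basis D (int D + 1)"
    using ex_basis_point_full[OF D] by (simp add: y2_def)
  have d2: "?d y2 = scale (lookup (x - ?d y1) ({0}, omit D 0)) (?t ({0}, {0..D + 1}))"
    unfolding ex_differential_total[OF y2] by (simp add: y2_def)
  define c where "c a = lookup (x - ?d y1 - ?d y2) ({0}, omit D a)" for a
  define y3 :: "nat set \<times> nat set \<Rightarrow>\<^sub>0 'k poly" where
    "y3 = (\<Sum>a\<in>{1..D + 1}. single ({0, a}, omit D a) (- ?s * c a))"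
  have y3: "keys y3 \<subseteq> ex_basis D (int D + 1)"
    unfolding y3_def
  proof (rule keys_sum_le)
    fix a assume a: "a \<in> {1..D + 1}"
    then have "({0, a}, omit D a) \<in> ex_basis D (int D + int (card {0, a}) - 1)"
      by (intro ex_basis_omitI[OF D]) auto
    then show "keys (single ({0, a}, omit D a) (- ?s * c a)) \<subseteq> ex_basis D (int D + 1)"
      using a by (simp add: add.commute)
  qed
  have d3: "?d y3 = (\<Sum>a\<in>{1..D + 1}. scale (- ?s * c a) (?t ({0, a}, omit D a)))"
    unfolding ex_differential_total[OF y3] unfolding y3_def linear_extension_sum linear_extension_single ..
  have t2: "lookup (?t ({0}, {0..D + 1})) ({0}, omit D 0) = 1"
  proof -
    have "ex_degree D ({0}, {0..D + 1}) = 0" by (rule ex_degree_zero[OF ex_basis_point_full[OF D]]) auto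
    moreover have "ex_degree D ({0}, omit D 0) = 0"
      by (rule ex_degree_zero[OF ex_basis_omitI[OF D]]) auto
    moreover have "lookup (?t ({0}, {0..D + 1})) ({0}, {0..D + 1} - {0}) =
        monom (position_sign 0 {0..D + 1}) (nat (ex_degree D ({0}, {0..D + 1}) - ex_degree D ({0}, {0..D + 1} - {0})))"
      by (rule lookup_total_boundary_horizontal) auto
    moreover have "position_sign 0 {0..D + 1} = (1 :: 'k)" by (simp add: position_sign_def)
    moreover have om: "{0..D + 1} - {0} = omit D 0" by (simp add: omit_def)
    ultimately show ?thesis unfolding om by (simp add: monom_0 one_pCons)
  qed
  have t2': "lookup (?t ({0}, {0..D + 1})) ({D + 2}, omit D 0) = 0"
    by (rule lookup_total_boundary_other) auto
  have t3: "lookup (?t ({0, a}, omit D a)) ({0}, omit D a) = - ?s" if a: "a \<in> {1..D + 1}" for a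
  proof -
    have "ex_degree D ({0, a}, omit D a) = 0"
      using a by (intro ex_degree_zero[OF ex_basis_omitI[OF D]]) auto
    moreover have "ex_degree D ({0}, omit D a) = 0"
      using a by (intro ex_degree_zero[OF ex_basis_omitI[OF D]]) auto
    moreover have "{0, a} - {a} = {0}" using a by auto
    moreover have "{u \<in> {0, a}. u < a} = {0}" using a by auto
    then have "position_sign a {0, a} = (- 1 :: 'k)" by (simp only: position_sign_def) simp
    moreover have "card (omit D a) - 1 = D" using a by (simp add: card_omit)
    moreover have "lookup (?t ({0, a}, omit D a)) ({0, a} - {a}, omit D a) =
       (- 1) ^ (card (omit D a) - 1) * monom (position_sign a {0, a})
         (nat (ex_degree D ({0, a}, omit D a) - ex_degree D ({0, a} - {a}, omit D a)))"
      by (rule lookup_total_boundary_vertical) (use a in auto)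
    ultimately show ?thesis by (simp add: monom_0 one_pCons minus_monom[symmetric])
  qed
  have t3': "lookup (?t ({0, a}, omit D a)) (\<tau>, omit D a') = 0"
    if a: "a \<in> {1..D + 1}" "a' \<le> D + 1" "a' \<noteq> a" "card \<tau> = 1" for a a' \<tau>
  proof (rule lookup_total_boundary_other)
    show "(\<tau>, omit D a') \<noteq> ({0, a} - {v}, omit D a)" for v
      using omit_inj[OF a(2), of a] a(3) by auto
    have "\<tau> \<noteq> {0, a}" using a by auto
    then show "(\<tau>, omit D a') \<noteq> ({0, a}, omit D a - {i})" for i by auto
  qed
  define y where "y = y1 + y2 + y3"
  have y: "keys y \<subseteq> ex_basis D (int D + 1)"
    unfolding y_def by (intro keys_add_le y1 y2 y3)
  let ?x = "x - ?d y"
  have x': "?x = x - ?d y1 - ?d y2 - ?d y3" by (simp add: y_def mv_differential_linear)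
  have keys: "keys ?x \<subseteq> ex_basis D (int D)"
    using ex_differential_keys[OF y] by (intro keys_diff_le x) simp
  have cycle: "?d ?x = 0"
    using ex_differential_square[OF y] by (simp add: mv_differential_linear x(2))
  have "lookup (?d y3) ({D + 2}, omit D 0) = 0"
    unfolding d3 lookup_sum by (intro sum.neutral ballI) (simp add: t3')
  then have b0: "lookup ?x ({D + 2}, omit D 0) = 0"
  proof -
    have "?s * p * (?s * monom 1 (2 * D + 2)) = (?s * ?s) * (monom 1 (2 * D + 2) * p)" by (simp only: ac_simps)
    then have "?s * p * (?s * monom 1 (2 * D + 2)) = monom 1 (2 * D + 2) * p"
      by (simp only: minus_one_power_sq mult_1)
    then show ?thesis using \<open>lookup (?d y3) ({D + 2}, omit D 0) = 0\<close>
      unfolding x' by (simp only: lookup_minus d1 d2 lookup_scale t2' lookup_ex_edge[OF D] p diff_self mult_zero_right)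
  qed
  have zero: "lookup ?x ({0}, omit D a) = 0" if a: "a \<le> D + 1" for a
  proof (cases "a = 0")
    case True
    have "lookup (?d y3) ({0}, omit D 0) = 0"
      unfolding d3 lookup_sum by (intro sum.neutral ballI) (simp add: t3')
    then show ?thesis unfolding x' d2 using True t2 by (simp add: lookup_minus)
  next
    case False
    then have a1: "a \<in> {1..D + 1}" using a by auto
    have "lookup (?d y3) ({0}, omit D a) = (\<Sum>b\<in>{1..D + 1}. if b = a then c a else 0)"
      unfolding d3 lookup_sum
    proof (rule sum.cong[OF refl])
      fix b assume b: "b \<in> {1..D + 1}"
      show "lookup (scale (- ?s * c b) (?t ({0, b}, omit D b))) ({0}, omit D a) = (if b = a then c a else 0)"
      proof (cases "b = a")
        case True
        have "- ?s * c a * - ?s = (?s * ?s) * c a" by (simp add: ac_simps)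
        then show ?thesis using True t3[OF a1] minus_one_power_sq[of D, where 'r = "'k poly"] by simp
      qed (use t3'[OF b a, of "{0}"] in auto)
    qed
    then have "lookup (?d y3) ({0}, omit D a) = c a" using a1 by simp
    then show ?thesis unfolding x' by (simp add: lookup_minus[of _ "?d y3"] c_def)
  qed
  show ?thesis by (rule that[OF y ex_kernel_reduced[OF D keys cycle b0 zero]])
qed

section \<open>The generating cycle\<close>

text \<open>Passing from an index to its vertex, \<open>0\<close> being replaced by \<open>D + 2\<close>, and to complements assigns to \<open>I\<close> a simplex
  that lies in \<open>U\<^sub>I\<close> if \<open>I \<noteq> {0}\<close>. Removing the vertex of \<open>i\<close> from it has the same effect as adding \<open>i\<close> to \<open>I\<close>, so the vertical and
  the horizontal faces of these pairs match. With suitable signs their sum is therefore a cycle.\<close>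

definition dual_vertex :: "nat \<Rightarrow> nat \<Rightarrow> nat" where
  "dual_vertex D i = (if i = 0 then D + 2 else i)"

definition dual_simplex :: "nat \<Rightarrow> nat set \<Rightarrow> nat set" where
  "dual_simplex D I = dual_vertex D ` ({0..D + 1} - I)"

text \<open>The signs are forced up to a common factor: a matching pair of faces cancels only if the signs of \<open>I\<close> and
  \<open>insert i I\<close> have a prescribed ratio, and this is the solution of the resulting recursion.\<close>

definition dual_sign :: "nat \<Rightarrow> nat set \<Rightarrow> 'k::field" where
  "dual_sign D I = (- 1) ^ ((card I choose 2) + \<Sum>I + (if 0 \<in> I then D + 1 else card I))"

lemma dual_vertex_inj: "inj_on (dual_vertex D) {0..D + 1}"
  by (auto simp: inj_on_def dual_vertex_def split: if_splits)

lemma finite_dual_simplex [simp]: "finite (dual_simplex D I)"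
  by (simp add: dual_simplex_def)

lemma card_dual_simplex: "card (dual_simplex D I) = card ({0..D + 1} - I)"
  unfolding dual_simplex_def by (rule card_image, rule inj_on_subset[OF dual_vertex_inj]) auto

lemma dual_simplex_insert:
  assumes "i \<in> {0..D + 1}" "i \<notin> I"
  shows "dual_simplex D I - {dual_vertex D i} = dual_simplex D (insert i I)"
proof -
  have "dual_vertex D ` ({0..D + 1} - I) - dual_vertex D ` {i} = dual_vertex D ` (({0..D + 1} - I) - {i})"
    by (rule inj_on_image_set_diff[OF dual_vertex_inj, symmetric]) (use assms in auto)
  moreover have "{0..D + 1} - I - {i} = {0..D + 1} - insert i I" by auto
  ultimately show ?thesis by (simp add: dual_simplex_def)
qed

lemma mem_dual_simplex:
  "v \<in> dual_simplex D I \<longleftrightarrow> (v \<in> {1..D + 1} \<and> v \<notin> I) \<or> (v = D + 2 \<and> 0 \<notin> I)"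
  unfolding dual_simplex_def dual_vertex_def by (force simp: image_iff)

lemma neg_one_power_cong: "even (m + n) \<Longrightarrow> (- 1) ^ m = ((- 1) ^ n :: 'r::comm_ring_1)"
  by (cases "even m") simp_all

text \<open>The signs compare the positions of \<open>i\<close> in \<open>insert i I\<close> and of the vertex of \<open>i\<close> in the complementary
  simplex: together, the elements before them exhaust \<open>{0..<i}\<close>, up to the exceptional index \<open>0\<close>.\<close>

lemma dual_sign_insert:
  assumes I: "I \<subseteq> {0..D + 1}" and i: "i \<in> {0..D + 1}" "i \<notin> I"
  shows "dual_sign D (insert i I) * position_sign i (insert i I) =
    ((- 1) ^ card I * dual_sign D I * position_sign (dual_vertex D i) (dual_simplex D I) :: 'k::field)"
proof -
  let ?E = "\<lambda>I. (card I choose 2) + \<Sum>I + (if 0 \<in> I then D + 1 else card I)"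
  have fin: "finite I" using I finite_subset by blast
  have cI: "card (insert i I) = Suc (card I)" using fin i by simp
  have ch: "Suc (card I) choose 2 = card I + (card I choose 2)" by (simp add: numeral_2_eq_2)
  have sum: "\<Sum>(insert i I) = i + \<Sum>I" using fin i by simp
  let ?P = "{u \<in> insert i I. u < i}" and ?Q = "{u \<in> dual_simplex D I. u < dual_vertex D i}"
  have parity: "even (?E (insert i I) + card ?P + (card I + ?E I + card ?Q))"
  proof (cases "i = 0")
    case True
    have "?Q = {1..D + 1} - I" using True by (auto simp: mem_dual_simplex dual_vertex_def)
    moreover have "I \<subseteq> {1..D + 1}"
    proof
      fix x assume "x \<in> I"
      then have "x \<in> {0..D + 1}" "x \<noteq> i" using subsetD[OF I] i(2) by metis+
      then show "x \<in> {1..D + 1}" using True by simp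
    qed
    then have "card ({1..D + 1} - I) + card I = D + 1"
      using card_Diff_subset[OF fin, of "{1..D + 1}"] card_mono[of "{1..D + 1}" I] by simp
    ultimately have Q: "card ?Q + card I = D + 1" by simp
    have "?P = {}" using True by auto
    then have P: "card ?P = 0" by (simp only: card.empty)
    have E': "?E (insert i I) = card I + ((card I choose 2) + \<Sum>I) + (D + 1)"
      unfolding cI ch sum using True by simp
    have E: "?E I = ((card I choose 2) + \<Sum>I) + card I" using True i by simp
    have arith: "q + n = d \<Longrightarrow> p = 0 \<Longrightarrow> e' = n + b + d \<Longrightarrow> e = b + n \<Longrightarrow> e' + p + (n + e + q) = 2 * (n + b + d)"
      for b d e e' n p q :: nat by simp
    have "?E (insert i I) + card ?P + (card I + ?E I + card ?Q) =
        2 * (card I + ((card I choose 2) + \<Sum>I) + (D + 1))" by (rule arith[OF Q P E' E])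
    then show ?thesis by (simp only: dvd_triv_left)
  next
    case False
    have "?P \<union> ?Q = (if 0 \<in> I then {0..<i} else {1..<i})"
    proof -
      have "u \<in> ?P \<union> ?Q \<longleftrightarrow> u \<in> (if 0 \<in> I then {0..<i} else {1..<i})" for u
        using False i by (cases "u = 0") (auto simp: mem_dual_simplex dual_vertex_def)
      then show ?thesis by blast
    qed
    moreover have "?P \<inter> ?Q = {}" using False i by (auto simp: mem_dual_simplex dual_vertex_def)
    then have "card (?P \<union> ?Q) = card ?P + card ?Q" using fin by (intro card_Un_disjoint) auto
    ultimately have PQ: "card ?P + card ?Q = (if 0 \<in> I then i else i - 1)" by (simp split: if_splits)
    show ?thesis
    proof (cases "0 \<in> I")
      case True
      have E': "?E (insert i I) = card I + (card I choose 2) + (i + \<Sum>I) + (D + 1)"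
        unfolding cI ch sum using True by simp
      have E: "?E I = (card I choose 2) + \<Sum>I + (D + 1)" using True by simp
      have arith: "p + q = m \<Longrightarrow> e' = n + b + (m + s) + d \<Longrightarrow> e = b + s + d \<Longrightarrow>
          e' + p + (n + e + q) = 2 * (n + b + s + d + m)" for b d e e' m n p q s :: nat by simp
      have "?E (insert i I) + card ?P + (card I + ?E I + card ?Q) =
          2 * (card I + (card I choose 2) + \<Sum>I + (D + 1) + i)"
        by (rule arith[OF PQ[unfolded if_P[OF True]] E' E])
      then show ?thesis by (simp only: dvd_triv_left)
    next
      case zero: False
      have E': "?E (insert i I) = card I + (card I choose 2) + (i + \<Sum>I) + Suc (card I)"
        unfolding cI ch sum using zero False by simp
      have E: "?E I = (card I choose 2) + \<Sum>I + card I" using zero by simp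
      have PQ': "card ?P + card ?Q + 1 = i" using PQ False unfolding if_not_P[OF zero] by linarith
      have arith: "p + q + 1 = m \<Longrightarrow> e' = n + b + (m + s) + Suc n \<Longrightarrow> e = b + s + n \<Longrightarrow>
          e' + p + (n + e + q) = 2 * (n + b + s + n + m)" for b e e' m n p q s :: nat by simp
      have "?E (insert i I) + card ?P + (card I + ?E I + card ?Q) =
          2 * (card I + (card I choose 2) + \<Sum>I + card I + i)"
        by (rule arith[OF PQ' E' E])
      then show ?thesis by (simp only: dvd_triv_left)
    qed
  qed
  have "dual_sign D (insert i I) * position_sign i (insert i I) = ((- 1) ^ (?E (insert i I) + card ?P) :: 'k)"
    unfolding dual_sign_def position_sign_def by (simp only: power_add)
  also have "\<dots> = (- 1) ^ (card I + ?E I + card ?Q)"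
    by (rule neg_one_power_cong[OF parity])
  also have "\<dots> = (- 1) ^ card I * dual_sign D I * position_sign (dual_vertex D i) (dual_simplex D I)"
    unfolding dual_sign_def position_sign_def by (simp only: power_add)
  finally show ?thesis .
qed

abbreviation proper_index_sets :: "nat \<Rightarrow> nat set set" where
  "proper_index_sets D \<equiv> {I. I \<subseteq> {0..D + 1} \<and> I \<noteq> {} \<and> I \<noteq> {0..D + 1}}"

text \<open>The pair for \<open>I = {0..D + 1}\<close> is absent because its simplex would be empty.\<close>

definition dual_chain :: "nat \<Rightarrow> (nat set \<times> nat set \<Rightarrow>\<^sub>0 'k::field poly)" where
  "dual_chain D = (\<Sum>I\<in>proper_index_sets D. single (dual_simplex D I, I) (monom (dual_sign D I) 0))"

lemma finite_proper_index_sets: "finite (proper_index_sets D)"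
  by (rule finite_subset[of _ "Pow {0..D + 1}"]) auto

lemma neg_one_power_monom: "(- 1) ^ n * monom c m = monom ((- 1) ^ n * c :: 'k::field) m"
  by (cases "even n") (simp_all add: minus_monom)

text \<open>A vertical face of the summand for \<open>I\<close> and a horizontal face of the summand for \<open>insert i I\<close> cancel; the
  cases without a boundary, vertices and single indices, correspond to the excluded index sets.\<close>

lemma dual_chain_cycle: "linear_extension (total_boundary (\<lambda>_. 0)) (dual_chain D) = (0 :: _ \<Rightarrow>\<^sub>0 'k::field poly)"
proof -
  let ?L = "{0..D + 1}"
  let ?S = "proper_index_sets D"
  let ?e = "\<lambda>I. monom (dual_sign D I) 0 :: 'k poly"
  let ?v = "\<lambda>I i. single (dual_simplex D (insert i I), I)
      (monom ((- 1) ^ (card I - 1) * dual_sign D I * position_sign (dual_vertex D i) (dual_simplex D I) :: 'k) 0)"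
  let ?h = "\<lambda>I i. single (dual_simplex D I, I - {i}) (monom (dual_sign D I * position_sign i I :: 'k) 0)"
  have fin: "finite I" if "I \<in> ?S" for I using that finite_subset[of I ?L] by simp
  have V: "scale (?e I) (scale ((- 1) ^ (card I - 1)) (vertical_boundary (\<lambda>_. 0) (dual_simplex D I, I))) =
      (if card (?L - I) \<le> 1 then 0 else \<Sum>i\<in>?L - I. ?v I i)" for I
  proof (cases "card (?L - I) \<le> 1")
    case False
    have "vertical_boundary (\<lambda>_. 0) (dual_simplex D I, I) =
        (\<Sum>v\<in>dual_simplex D I. single (dual_simplex D I - {v}, I) (monom (position_sign v (dual_simplex D I) :: 'k) 0))"
      using False by (simp add: vertical_boundary_def card_dual_simplex)
    also have "\<dots> = (\<Sum>i\<in>?L - I. single (dual_simplex D I - {dual_vertex D i}, I)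
        (monom (position_sign (dual_vertex D i) (dual_simplex D I)) 0))"
    proof -
      have "inj_on (dual_vertex D) (?L - I)" by (rule inj_on_subset[OF dual_vertex_inj]) auto
      then show ?thesis unfolding dual_simplex_def[of D I] by (subst sum.reindex) (simp_all add: o_def)
    qed
    also have "\<dots> = (\<Sum>i\<in>?L - I. single (dual_simplex D (insert i I), I)
        (monom (position_sign (dual_vertex D i) (dual_simplex D I)) 0))"
      by (intro sum.cong refl) (simp add: dual_simplex_insert)
    finally show ?thesis
      using False by (simp add: scale_sum mult_monom neg_one_power_monom ac_simps)
  qed (simp add: vertical_boundary_def card_dual_simplex)
  have H: "scale (?e I) (horizontal_boundary (\<lambda>_. 0) (dual_simplex D I, I)) =
      (if card I \<le> 1 then 0 else \<Sum>i\<in>I. ?h I i)" for I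
    by (simp add: horizontal_boundary_def scale_sum mult_monom)
  have "linear_extension (total_boundary (\<lambda>_. 0)) (dual_chain D) =
      (\<Sum>I\<in>?S. if card (?L - I) \<le> 1 then 0 else \<Sum>i\<in>?L - I. ?v I i) + (\<Sum>I\<in>?S. if card I \<le> 1 then 0 else \<Sum>i\<in>I. ?h I i)"
    unfolding dual_chain_def linear_extension_sum linear_extension_single total_boundary_def scale_add snd_conv V H sum.distrib ..
  also have "(\<Sum>I\<in>?S. if card (?L - I) \<le> 1 then 0 else \<Sum>i\<in>?L - I. ?v I i) =
      (\<Sum>I\<in>{I \<in> ?S. \<not> card (?L - I) \<le> 1}. \<Sum>i\<in>?L - I. ?v I i)"
    by (subst sum.inter_filter[OF finite_proper_index_sets]) (intro sum.cong refl, simp)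
  also have "\<dots> = (\<Sum>(I, i)\<in>(SIGMA I:{I \<in> ?S. \<not> card (?L - I) \<le> 1}. ?L - I). ?v I i)"
    by (rule sum.Sigma) (use finite_proper_index_sets in auto)
  also have "\<dots> = (\<Sum>(I, i)\<in>(SIGMA I:{I \<in> ?S. \<not> card I \<le> 1}. I). - ?h I i)"
  proof (rule sum.reindex_bij_witness[where i = "\<lambda>(I, i). (I - {i}, i)" and j = "\<lambda>(I, i). (insert i I, i)"])
    fix a assume "a \<in> (SIGMA I:{I \<in> ?S. \<not> card (?L - I) \<le> 1}. ?L - I)"
    moreover obtain I i where ai: "a = (I, i)" by fastforce
    ultimately have "I \<in> {I \<in> ?S. \<not> card (?L - I) \<le> 1} \<and> i \<in> ?L - I" by (simp only: mem_Sigma_iff)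
    then have a: "a = (I, i)" "I \<in> ?S" "\<not> card (?L - I) \<le> 1" "i \<in> ?L" "i \<notin> I" using ai by simp_all
    show "(case case a of (I, i) \<Rightarrow> (insert i I, i) of (I, i) \<Rightarrow> (I - {i}, i)) = a" using a by simp
    have "?L \<noteq> insert i I"
    proof
      assume "?L = insert i I"
      then have "?L - I = {i}" using a(5) by blast
      then have "card (?L - I) = 1" by (simp only: card.empty card_insert_if finite.emptyI) simp
      then show False using a(3) by simp
    qed
    moreover have "card (insert i I) \<ge> 2"
      using a fin[OF a(2)] by (simp add: Suc_le_eq card_gt_0_iff)
    ultimately show "(case a of (I, i) \<Rightarrow> (insert i I, i)) \<in> (SIGMA I:{I \<in> ?S. \<not> card I \<le> 1}. I)"
      using a by auto
    have "card I \<noteq> 0" using a fin[OF a(2)] by auto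
    then have "(- 1) ^ card I = - ((- 1) ^ (card I - 1) :: 'k)" by (cases "card I") simp_all
    then have "dual_sign D (insert i I) * position_sign i (insert i I) =
        - ((- 1) ^ (card I - 1) * dual_sign D I * position_sign (dual_vertex D i) (dual_simplex D I) :: 'k)"
      using dual_sign_insert[of I D i, where 'k = 'k] a by simp
    then have "?v I i = - ?h (insert i I) i"
      using a by (simp add: minus_monom[symmetric] single_uminus)
    then show "(case case a of (I, i) \<Rightarrow> (insert i I, i) of (I, i) \<Rightarrow> - ?h I i) = (case a of (I, i) \<Rightarrow> ?v I i)"
      by (simp add: a(1))
  next
    fix b assume "b \<in> (SIGMA I:{I \<in> ?S. \<not> card I \<le> 1}. I)"
    moreover obtain I i where bi: "b = (I, i)" by fastforce
    ultimately have "I \<in> {I \<in> ?S. \<not> card I \<le> 1} \<and> i \<in> I" by (simp only: mem_Sigma_iff)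
    then have b: "b = (I, i)" "I \<in> ?S" "\<not> card I \<le> 1" "i \<in> I" using bi by simp_all
    show "(case case b of (I, i) \<Rightarrow> (I - {i}, i) of (I, i) \<Rightarrow> (insert i I, i)) = b" using b by (auto simp: insert_absorb)
    have ne: "I - {i} \<noteq> {}" by (rule card_ge_2_remove[OF fin[OF b(2)] b(3)])
    obtain l where l: "l \<in> ?L" "l \<notin> I" using b(2) by blast
    then have "{i, l} \<subseteq> ?L - (I - {i})" "i \<noteq> l" using b by auto
    then have "card {i, l} \<le> card (?L - (I - {i}))" by (intro card_mono) auto
    then have "\<not> card (?L - (I - {i})) \<le> 1" using \<open>i \<noteq> l\<close> by simp
    moreover have "I - {i} \<noteq> ?L" using l by blast
    ultimately show "(case b of (I, i) \<Rightarrow> (I - {i}, i)) \<in> (SIGMA I:{I \<in> ?S. \<not> card (?L - I) \<le> 1}. ?L - I)"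
      using b ne by auto
  qed
  also have "\<dots> = (\<Sum>I\<in>{I \<in> ?S. \<not> card I \<le> 1}. \<Sum>i\<in>I. - ?h I i)"
    by (rule sum.Sigma[symmetric]) (use finite_proper_index_sets fin in auto)
  also have "\<dots> = (\<Sum>I\<in>?S. if card I \<le> 1 then 0 else \<Sum>i\<in>I. - ?h I i)"
    by (subst sum.inter_filter[OF finite_proper_index_sets]) (intro sum.cong refl, simp)
  also have "\<dots> = - (\<Sum>I\<in>?S. if card I \<le> 1 then 0 else \<Sum>i\<in>I. ?h I i)"
    unfolding sum_negf[symmetric] by (intro sum.cong refl) (simp add: sum_negf)
  finally show ?thesis by simp
qed

lemma lookup_dual_chain:
  "lookup (dual_chain D :: _ \<Rightarrow>\<^sub>0 'k::field poly) (\<sigma>, K) =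
    (if K \<in> proper_index_sets D \<and> \<sigma> = dual_simplex D K then monom (dual_sign D K) 0 else 0)"
proof -
  have "lookup (dual_chain D :: _ \<Rightarrow>\<^sub>0 'k poly) (\<sigma>, K) =
      (\<Sum>I\<in>proper_index_sets D. if I = K then if \<sigma> = dual_simplex D K then monom (dual_sign D K) 0 else 0 else 0)"
    unfolding dual_chain_def lookup_sum by (rule sum.cong) (auto simp: lookup_single when_def)
  also have "\<dots> = (if K \<in> proper_index_sets D then if \<sigma> = dual_simplex D K then monom (dual_sign D K) 0 else 0 else 0)"
    by (subst sum.delta[OF finite_proper_index_sets]) (rule refl)
  finally show ?thesis by simp
qed

text \<open>For \<open>I = {0}\<close> the complementary simplex \<open>{1..D + 1}\<close> does not belong to \<open>X\<close>; subtracting a boundary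
  replaces it by the cone of its boundary with apex \<open>D + 3\<close>.\<close>

definition ex_generator :: "nat \<Rightarrow> (nat set \<times> nat set \<Rightarrow>\<^sub>0 'k::field poly)" where
  "ex_generator D = dual_chain D - linear_extension (total_boundary (\<lambda>_. 0))
     (single (insert (D + 3) {1..D + 1}, {0}) (monom ((- 1) ^ (D + 1) * dual_sign D {0}) 0))"

lemma cone_boundary_eq:
  fixes D :: nat
  shows "total_boundary (\<lambda>_. 0) (insert (D + 3) {1..D + 1}, {0 :: nat}) =
    (vertical_boundary (\<lambda>_. 0) (insert (D + 3) {1..D + 1}, {0}) :: _ \<Rightarrow>\<^sub>0 'k::field poly)"
  by (simp add: total_boundary_def horizontal_boundary_def)

lemma lookup_cone_boundary:
  fixes D :: nat
  assumes "v \<in> insert (D + 3) {1..D + 1}" and D: "D \<ge> 1"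
  shows "lookup (vertical_boundary (\<lambda>_. 0) (insert (D + 3) {1..D + 1}, {0 :: nat})) (insert (D + 3) {1..D + 1} - {v}, {0}) =
    (monom (position_sign v (insert (D + 3) {1..D + 1})) 0 :: 'k::field poly)"
proof -
  have "card (insert (D + 3) {1..D + 1}) = D + 2" by simp
  then show ?thesis using lookup_vertical_boundary[OF _ _ assms(1), of "\<lambda>_. 0" "{0 :: nat}", where 'k = 'k] by simp
qed

lemma keys_cone_boundary:
  fixes D :: nat
  assumes "b \<in> keys (vertical_boundary (\<lambda>_. 0) (insert (D + 3) {1..D + 1}, {0 :: nat}) :: _ \<Rightarrow>\<^sub>0 'k::field poly)"
  obtains v where "v \<in> insert (D + 3) {1..D + 1}" "b = (insert (D + 3) {1..D + 1} - {v}, {0})"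
  using subsetD[OF keys_vertical_boundary assms] by (auto simp only: if_split_mem2 empty_iff split: if_splits)

lemma ex_generator_keys:
  assumes D: "D \<ge> 1" and b: "(\<sigma>, I) \<in> keys (ex_generator D :: _ \<Rightarrow>\<^sub>0 'k::field poly)"
  shows "(\<sigma>, I) \<in> ex_basis D (int D) \<and> 0 \<notin> \<sigma>"
proof -
  let ?\<tau> = "{1..D + 1}" and ?\<rho> = "insert (D + 3) {1..D + 1}"
  let ?a = "monom ((- 1) ^ (D + 1) * dual_sign D {0}) 0 :: 'k poly"
  let ?V = "vertical_boundary (\<lambda>_. 0) (?\<rho>, {0 :: nat}) :: _ \<Rightarrow>\<^sub>0 'k poly"
  have gen: "ex_generator D = dual_chain D - scale ?a ?V"
    unfolding ex_generator_def linear_extension_single cone_boundary_eq ..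
  have dual0: "dual_simplex D {0} = ?\<tau>" by (auto simp: mem_dual_simplex)
  have not_whole: "(\<sigma>, I) \<noteq> (?\<tau>, {0})"
  proof
    assume e: "(\<sigma>, I) = (?\<tau>, {0})"
    have "?\<rho> - {D + 3} = ?\<tau>" by auto
    then have "lookup ?V (?\<tau>, {0}) = monom (position_sign (D + 3) ?\<rho>) 0"
      using lookup_cone_boundary[OF _ D, of "D + 3", where 'k = 'k] by simp
    moreover have "{u \<in> ?\<rho>. u < D + 3} = ?\<tau>" by auto
    then have "position_sign (D + 3) ?\<rho> = ((- 1) ^ (D + 1) :: 'k)" by (simp only: position_sign_def) simp
    moreover have "{0} \<in> proper_index_sets D"
    proof -
      have "1 \<in> {0..D + 1}" by simp
      then have "{0} \<noteq> {0..D + 1}" by (metis singletonD zero_neq_one)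
      then show ?thesis by simp
    qed
    then have "lookup (dual_chain D :: _ \<Rightarrow>\<^sub>0 'k poly) (?\<tau>, {0}) = monom (dual_sign D {0}) 0"
      by (simp only: lookup_dual_chain dual0 simp_thms if_True)
    moreover have "((- 1) ^ (D + 1) * dual_sign D {0}) * (- 1) ^ (D + 1) = (dual_sign D {0} :: 'k)"
      using minus_one_power_sq[of "D + 1", where 'r = 'k] by (simp only: ac_simps mult_1_left mult_1_right)
    ultimately have "lookup (ex_generator D :: _ \<Rightarrow>\<^sub>0 'k poly) (?\<tau>, {0}) = 0"
      by (simp only: gen lookup_minus lookup_scale mult_monom add_0 diff_self)
    then show False using b e by (simp add: in_keys_iff)
  qed
  have "(\<sigma>, I) \<in> keys (dual_chain D :: _ \<Rightarrow>\<^sub>0 'k poly) \<or> (\<sigma>, I) \<in> keys ?V"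
    using b unfolding gen using Poly_Mapping.keys_diff[of "dual_chain D" "scale ?a ?V"] keys_scale_subset[of ?a ?V] by blast
  then show ?thesis
  proof
    assume "(\<sigma>, I) \<in> keys (dual_chain D :: _ \<Rightarrow>\<^sub>0 'k poly)"
    then have I: "I \<subseteq> {0..D + 1}" "I \<noteq> {}" "I \<noteq> {0..D + 1}" and \<sigma>: "\<sigma> = dual_simplex D I"
      by (simp_all add: in_keys_iff lookup_dual_chain split: if_splits)
    have "I \<noteq> {0}" using not_whole \<sigma> dual0 by auto
    then obtain i where i: "i \<in> I" "i \<noteq> 0" using I(2) by (metis subset_singletonD subsetI singletonI)
    have fin: "finite I" using I(1) finite_subset by blast
    have "card ({0..D + 1} - I) + card I = D + 2"
      using card_Diff_subset[OF fin I(1)] card_mono[OF _ I(1)] by simp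
    then have card: "card \<sigma> + card I = D + 2" by (simp add: \<sigma> card_dual_simplex)
    have "i \<in> {1..D + 1}" "i \<notin> \<sigma>" using i subsetD[OF I(1) i(1)] by (auto simp: \<sigma> mem_dual_simplex)
    then have "\<not> {1..D + 1} \<subseteq> \<sigma>" by blast
    moreover have "\<sigma> \<subseteq> {0..D + 3}" "D + 3 \<notin> \<sigma>" "0 \<notin> \<sigma>" by (auto simp: \<sigma> mem_dual_simplex)
    moreover have "\<sigma> \<noteq> {}"
    proof -
      have "{0..D + 1} - I \<noteq> {}" using I by blast
      then show ?thesis by (simp add: \<sigma> dual_simplex_def)
    qed
    moreover have "0 \<in> I \<longrightarrow> D + 2 \<notin> \<sigma>" "\<forall>i\<in>I. i \<noteq> 0 \<longrightarrow> i \<notin> \<sigma>"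
      using subsetD[OF I(1)] by (fastforce simp: \<sigma> mem_dual_simplex)+
    ultimately show ?thesis using I card unfolding mem_ex_basis ex_X_def by auto
  next
    assume "(\<sigma>, I) \<in> keys ?V"
    then obtain v where v: "v \<in> ?\<rho>" "\<sigma> = ?\<rho> - {v}" "I = {0}" by (rule keys_cone_boundary) simp
    have "v \<noteq> D + 3"
    proof
      assume "v = D + 3"
      then have "\<sigma> = ?\<tau>" using v(2) by auto
      then show False using not_whole v(3) by simp
    qed
    then have vt: "v \<in> {1..D + 1}" using v(1) by simp
    have "v \<notin> \<sigma>" using v(2) by simp
    then have "\<not> {1..D + 1} \<subseteq> \<sigma>" using vt by blast
    moreover have "D + 3 \<in> \<sigma>" "D + 2 \<notin> \<sigma>" "0 \<notin> \<sigma>" "\<sigma> \<subseteq> {0..D + 3}" using v(2) \<open>v \<noteq> D + 3\<close> by auto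
    moreover have "card \<sigma> = D + 1" unfolding v(2) using v(1) by simp
    ultimately show ?thesis unfolding mem_ex_basis ex_X_def v(3) by auto
  qed
qed

text \<open>All simplices without the vertex \<open>0\<close> are born in degree \<open>- 2 * D\<close>, where no powers of \<open>t\<close> intervene.\<close>

lemma total_boundary_base:
  assumes b: "(\<sigma>, I) \<in> ex_basis D n" and "0 \<notin> \<sigma>"
  shows "total_boundary (ex_degree D) (\<sigma>, I) = (total_boundary (\<lambda>_. 0) (\<sigma>, I) :: _ \<Rightarrow>\<^sub>0 'k::field poly)"
proof -
  note fin = ex_basis_finite[OF b]
  have deg: "ex_degree D (\<tau>, J) = - 2 * int D" if "\<tau> \<subseteq> \<sigma>" "\<tau> \<noteq> {}" "J \<subseteq> I" "J \<noteq> {}" for \<tau> J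
    by (rule ex_degree_base[OF ex_basis_face[OF b that]]) (use that assms(2) in blast)
  have "vertical_boundary (ex_degree D) (\<sigma>, I) = (vertical_boundary (\<lambda>_. 0) (\<sigma>, I) :: _ \<Rightarrow>\<^sub>0 'k poly)"
  proof (cases "card \<sigma> \<le> 1")
    case False
    then have "\<sigma> - {v} \<noteq> {}" for v by (rule card_ge_2_remove[OF fin(1)])
    then show ?thesis using fin
      unfolding vertical_boundary_def prod.case if_not_P[OF False] by (intro sum.cong refl) (simp add: deg Diff_subset)
  qed (simp add: vertical_boundary_def)
  moreover have "horizontal_boundary (ex_degree D) (\<sigma>, I) = (horizontal_boundary (\<lambda>_. 0) (\<sigma>, I) :: _ \<Rightarrow>\<^sub>0 'k poly)"
  proof (cases "card I \<le> 1")
    case False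
    then have "I - {v} \<noteq> {}" for v by (rule card_ge_2_remove[OF fin(3)])
    then show ?thesis using fin
      unfolding horizontal_boundary_def prod.case if_not_P[OF False] by (intro sum.cong refl) (simp add: deg Diff_subset)
  qed (simp add: horizontal_boundary_def)
  ultimately show ?thesis by (simp add: total_boundary_def)
qed

lemma ex_generator_cycle:
  assumes D: "D \<ge> 1"
  shows "mv_differential (ex_U_filt D) (ex_generator D) = (0 :: _ \<Rightarrow>\<^sub>0 'k::field poly)"
proof -
  have keys: "keys (ex_generator D :: _ \<Rightarrow>\<^sub>0 'k poly) \<subseteq> ex_basis D (int D)"
    using ex_generator_keys[OF D, where 'k = 'k] by auto
  have "mv_differential (ex_U_filt D) (ex_generator D) =
      linear_extension (total_boundary (\<lambda>_. 0)) (ex_generator D :: _ \<Rightarrow>\<^sub>0 'k poly)"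
    unfolding ex_differential_total[OF keys]
  proof (rule linear_extension_cong)
    fix b assume "b \<in> keys (ex_generator D :: _ \<Rightarrow>\<^sub>0 'k poly)"
    moreover obtain \<sigma> I where b: "b = (\<sigma>, I)" by fastforce
    ultimately have "(\<sigma>, I) \<in> ex_basis D (int D) \<and> 0 \<notin> \<sigma>" by (intro ex_generator_keys[OF D, where 'k = 'k]) simp
    then show "total_boundary (ex_degree D) b = (total_boundary (\<lambda>_. 0) b :: _ \<Rightarrow>\<^sub>0 'k poly)"
      unfolding b by (intro total_boundary_base[of \<sigma> I]) auto
  qed
  also have "\<dots> = 0"
  proof -
    have "linear_extension (total_boundary (\<lambda>_. 0)) (total_boundary (\<lambda>_. 0) (insert (D + 3) {1..D + 1}, {0 :: nat})) =
        (0 :: _ \<Rightarrow>\<^sub>0 'k poly)"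
      by (rule total_boundary_total_boundary) (auto simp: degree_monotone_def)
    then show ?thesis
      unfolding ex_generator_def linear_extension_diff dual_chain_cycle linear_extension_single linear_extension_scale by simp
  qed
  finally show ?thesis .
qed

lemma ex_generator_constant:
  assumes D: "D \<ge> 1"
  shows "\<exists>c. lookup (ex_generator D :: _ \<Rightarrow>\<^sub>0 'k::field poly) b = monom c 0"
proof -
  let ?V = "vertical_boundary (\<lambda>_. 0) (insert (D + 3) {1..D + 1}, {0 :: nat}) :: _ \<Rightarrow>\<^sub>0 'k poly"
  obtain \<sigma> I where b: "b = (\<sigma>, I)" by fastforce
  have "\<exists>c. lookup (dual_chain D :: _ \<Rightarrow>\<^sub>0 'k poly) b = monom c 0"
  proof (cases "I \<in> proper_index_sets D \<and> \<sigma> = dual_simplex D I")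
    case True
    show ?thesis unfolding b lookup_dual_chain if_P[OF True] by blast
  next
    case False
    show ?thesis unfolding b lookup_dual_chain if_not_P[OF False] by (rule exI[of _ 0]) simp
  qed
  moreover have "\<exists>c. lookup ?V b = monom c 0"
  proof (cases "b \<in> keys ?V")
    case True
    then obtain v where "v \<in> insert (D + 3) {1..D + 1}" "b = (insert (D + 3) {1..D + 1} - {v}, {0})"
      by (rule keys_cone_boundary)
    then show ?thesis using lookup_cone_boundary[OF _ D, of v, where 'k = 'k] by (intro exI) simp
  next
    case False
    then show ?thesis by (intro exI[of _ 0]) (simp add: in_keys_iff)
  qed
  ultimately obtain c c' where "lookup (dual_chain D :: _ \<Rightarrow>\<^sub>0 'k poly) b = monom c 0" "lookup ?V b = monom c' 0"
    by blast
  then have "lookup (ex_generator D :: _ \<Rightarrow>\<^sub>0 'k poly) b =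
      monom (c - (- 1) ^ (D + 1) * dual_sign D {0} * c') 0"
    unfolding ex_generator_def linear_extension_single cone_boundary_eq
    by (simp only: lookup_minus lookup_scale mult_monom add_0 diff_monom)
  then show ?thesis by blast
qed

lemma ex_generator_coefficient:
  assumes D: "D \<ge> 1"
  shows "lookup (ex_generator D :: _ \<Rightarrow>\<^sub>0 'k::field poly) ({D + 2}, omit D 0) = monom (dual_sign D (omit D 0)) 0"
proof -
  let ?V = "vertical_boundary (\<lambda>_. 0) (insert (D + 3) {1..D + 1}, {0 :: nat}) :: _ \<Rightarrow>\<^sub>0 'k poly"
  have "1 \<in> omit D 0" "0 \<notin> omit D 0" by simp_all
  moreover have "0 \<in> {0..D + 1}" by simp
  ultimately have ne: "omit D 0 \<noteq> {0}" "omit D 0 \<noteq> {}" "omit D 0 \<noteq> {0..D + 1}" by blast+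
  have "({D + 2}, omit D 0) \<notin> keys ?V"
  proof
    assume "({D + 2}, omit D 0) \<in> keys ?V"
    then show False by (rule keys_cone_boundary) (use ne(1) in simp)
  qed
  moreover have "omit D 0 \<in> proper_index_sets D" using ne by (auto simp: omit_def)
  moreover have "dual_simplex D (omit D 0) = {D + 2}" by (auto simp: mem_dual_simplex)
  ultimately show ?thesis
    unfolding ex_generator_def linear_extension_single cone_boundary_eq
    by (simp only: lookup_minus lookup_scale lookup_dual_chain in_keys_iff not_not mult_zero_right diff_zero simp_thms if_True)
qed

lemma dual_sign_nonzero: "dual_sign D I \<noteq> (0 :: 'k::field)"
  by (simp add: dual_sign_def)

section \<open>The limit page\<close>

lemma mv_complex_simps:
  "add (mv_complex k \<Lambda> U) = (+)"
  "p \<odot>\<^bsub>mv_complex k \<Lambda> U\<^esub> x = scale p x"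
  "grade (mv_complex k \<Lambda> U) j = {x. keys x \<subseteq> (\<Union>p q. mv_basis \<Lambda> U p q) \<and>
     (\<forall>b\<in>keys x. \<exists>c n. lookup x b = monom c n \<and> mv_degree U b + int n = j)}"
  by (simp_all add: mv_complex_def free_gmodule_def free_module_def module.defs gmodule.defs scale_def)

lemma graded_submodule_simps:
  "carrier (graded_submodule M S) = S" "add (graded_submodule M S) = add M"
  "p \<odot>\<^bsub>graded_submodule M S\<^esub> x = p \<odot>\<^bsub>M\<^esub> x" "grade (graded_submodule M S) j = grade M j \<inter> S"
  by (simp_all add: graded_submodule_def)

lemma keys_shifted_laurent:
  "keys (single (- int m) 1 * laurent_of_poly p) \<subseteq> {int n - int m..} \<longleftrightarrow> monom (1 :: 'k::field) n dvd p"
proof -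
  have "keys (single (- int m) 1 * laurent_of_poly p) \<subseteq> {int n - int m..} \<longleftrightarrow>
      (\<forall>j. j < int n \<longrightarrow> 0 \<le> j \<longrightarrow> coeff p (nat j) = 0)"
    unfolding keys_le_iff_lookup lookup_single_mult lookup_laurent_of_poly
  proof (intro iffI allI impI)
    fix j assume "\<forall>b. b \<notin> {int n - int m..} \<longrightarrow> 1 * (if 0 \<le> b - - int m then coeff p (nat (b - - int m)) else 0) = 0"
      "j < int n" "0 \<le> j"
    then show "coeff p (nat j) = 0" by (auto dest!: spec[of _ "j - int m"])
  qed auto
  also have "\<dots> \<longleftrightarrow> (\<forall>k<n. coeff p k = 0)"
    by (metis nat_int nat_less_iff of_nat_0_le_iff of_nat_less_iff)
  finally show ?thesis by (simp add: monom_1_dvd_iff')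
qed

lemma laurent_of_poly_surj:
  fixes w :: "int \<Rightarrow>\<^sub>0 'k::field"
  assumes "keys w \<subseteq> {- int m..}"
  obtains p where "w = single (- int m) 1 * laurent_of_poly p"
proof
  let ?p = "\<Sum>j\<in>keys w. monom (lookup w j) (nat (j + int m))"
  show "w = single (- int m) 1 * laurent_of_poly ?p"
  proof (rule poly_mapping_eqI)
    fix i
    show "lookup w i = lookup (single (- int m) 1 * laurent_of_poly ?p) i"
    proof (cases "0 \<le> i + int m")
      case True
      have "(\<Sum>j\<in>keys w. coeff (monom (lookup w j) (nat (j + int m))) (nat (i + int m))) =
          (\<Sum>j\<in>keys w. if j = i then lookup w i else 0)"
        by (rule sum.cong) (use True assms in \<open>auto simp: nat_eq_iff2\<close>)
      also have "\<dots> = lookup w i" by (simp add: in_keys_iff)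
      finally show ?thesis using True by (simp add: lookup_single_mult lookup_laurent_of_poly coeff_sum)
    next
      case False
      then have "lookup w i = 0" using assms by (auto simp: keys_le_iff_lookup)
      then show ?thesis using False by (simp add: lookup_single_mult lookup_laurent_of_poly)
    qed
  qed
qed

lemma mv_filt_closed:
  "x \<in> mv_filt \<Lambda> U p n \<Longrightarrow> y \<in> mv_filt \<Lambda> U p n \<Longrightarrow> x - y \<in> mv_filt \<Lambda> U p n"
  "x \<in> mv_filt \<Lambda> U p n \<Longrightarrow> scale a x \<in> mv_filt \<Lambda> U p n"
  "0 \<in> mv_filt \<Lambda> U p n"
  by (simp_all add: mv_filt_def keys_diff_le keys_scale_le)

text \<open>The isomorphism takes a cycle to its coefficient at the vertex \<open>D + 2\<close> over \<open>{1..D + 1}\<close>, multiplied by \<open>t\<^bsup>-2D\<^esup>\<close>.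
  It vanishes on lower filtration, is well defined and injective by the divisibility criterion, and onto because the
  generating cycle has a nonzero constant there.\<close>

theorem ex_limit_page:
  fixes k :: "'k::field itself"
  assumes D: "D \<ge> 1"
  shows "mv_limit k {0..D + 1} (ex_U_filt D) (int D) 0 \<cong>\<^sub>g interval_module k (- 2 * int D) 2"
    and "closed_gmodule (mv_limit k {0..D + 1} (ex_U_filt D) (int D) 0)"
proof -
  let ?d = "mv_differential (ex_U_filt D) :: (_ \<Rightarrow>\<^sub>0 'k poly) \<Rightarrow> _"
  let ?b = "({D + 2}, omit D 0)"
  let ?F = "mv_filt {0..D + 1} (ex_U_filt D) (int D - 1) (int D) :: (_ \<Rightarrow>\<^sub>0 'k poly) set"
  define Z :: "(_ \<Rightarrow>\<^sub>0 'k poly) set" where "Z = mv_Z {0..D + 1} (ex_U_filt D) (int (D + 2)) (int D) 0" 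
  define B :: "(_ \<Rightarrow>\<^sub>0 'k poly) set" where "B = mv_B {0..D + 1} (ex_U_filt D) (int (D + 2)) (int D) 0"
  define M where "M = graded_submodule (mv_complex k {0..D + 1} (ex_U_filt D)) Z"
  have Z: "Z = {x. keys x \<subseteq> ex_basis D (int D) \<and> ?d x = 0}" unfolding Z_def ex_page_cycles ..
  have B: "B = {x + ?d y | x y. x \<in> ?F \<and> ?d x = 0 \<and> keys y \<subseteq> ex_basis D (int D + 1)}"
    unfolding B_def ex_page_boundaries ..
  have limit: "mv_limit k {0..D + 1} (ex_U_filt D) (int D) 0 = graded_quotient M B"
    unfolding M_def Z_def B_def by (subst mv_limit_eq[of "int D" 0 "D + 2"]) (simp_all add: mv_page_def)
  note simps = graded_submodule_simps mv_complex_simps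
  have M: "plus_module M" by (simp add: M_def plus_module_def simps scale_add)
  have B_sub: "plus_submodule M B"
    unfolding plus_submodule_def plus_subgroup_def
  proof (intro conjI ballI allI)
    show "0 \<in> B" unfolding B
      by (rule CollectI, rule exI[of _ 0], rule exI[of _ 0]) (simp add: mv_differential_linear mv_filt_closed(3))
    fix x assume "x \<in> B"
    then obtain x1 y1 where x: "x = x1 + ?d y1" "x1 \<in> ?F" "?d x1 = 0" "keys y1 \<subseteq> ex_basis D (int D + 1)"
      unfolding B by blast
    show "a \<odot>\<^bsub>M\<^esub> x \<in> B" for a
      unfolding B M_def simps
      by (rule CollectI, rule exI[of _ "scale a x1"], rule exI[of _ "scale a y1"])
        (use x in \<open>simp add: mv_differential_linear scale_add mv_filt_closed keys_scale_le\<close>)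
    fix y assume "y \<in> B"
    then obtain x2 y2 where y: "y = x2 + ?d y2" "x2 \<in> ?F" "?d x2 = 0" "keys y2 \<subseteq> ex_basis D (int D + 1)"
      unfolding B by blast
    show "x - y \<in> B"
      unfolding B
      by (rule CollectI, rule exI[of _ "x1 - x2"], rule exI[of _ "y1 - y2"])
        (use x y in \<open>simp add: mv_differential_linear mv_filt_closed keys_diff_le\<close>)
  qed
  have Z_closed: "x + y \<in> Z" "x - y \<in> Z" "scale a x \<in> Z" if "x \<in> Z" "y \<in> Z" for x y a
    using that by (simp_all add: Z mv_differential_linear keys_add_le keys_diff_le keys_scale_le)
  have closed: "closed_gmodule M"
    using Z_closed by (auto simp: closed_gmodule_def M_def simps)
  show "closed_gmodule (mv_limit k {0..D + 1} (ex_U_filt D) (int D) 0)"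
    unfolding limit by (rule closed_graded_quotient[OF M B_sub closed])
  let ?N = "{w :: int \<Rightarrow>\<^sub>0 'k. keys w \<subseteq> {2..}}"
  define g where "g x = single (- 2 * int D) 1 * laurent_of_poly (lookup x ?b)"
    for x :: "_ \<Rightarrow>\<^sub>0 'k poly"
  have g_add: "g (x + y) = g x + g y" for x y by (simp add: g_def lookup_add laurent_of_poly_add algebra_simps)
  have g_diff: "g x - g y = g (x - y)" for x y using g_add[of "x - y" y] by simp
  have g_scale: "g (scale p x) = laurent_of_poly p * g x" for p x
    by (simp add: g_def laurent_of_poly_mult ac_simps)
  have m: "- 2 * int D = - int (2 * D)" by simp
  have g_keys: "keys (g x) \<subseteq> {- 2 * int D..}" for x
    using keys_shifted_laurent[of "2 * D" "lookup x ?b" 0] by (simp add: g_def m monom_0 one_pCons[symmetric])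
  have base: "ex_degree D ?b = - 2 * int D"
    using ex_basis_omitI[OF D, of 0 "{D + 2}"] by (intro ex_degree_base) auto
  have gen: "ex_generator D \<in> Z"
    using ex_generator_keys[OF D, where 'k = 'k] ex_generator_cycle[OF D, where 'k = 'k] by (auto simp: Z)
  let ?c = "dual_sign D (omit D 0) :: 'k"
  have g_gen: "g (scale (Polynomial.smult (inverse ?c) p) (ex_generator D)) =
      single (- int (2 * D)) 1 * laurent_of_poly p" for p
  proof -
    have "Polynomial.smult (inverse ?c) p * monom ?c 0 = p" using dual_sign_nonzero[of D "omit D 0", where 'k = 'k] by (simp add: monom_0)
    then show ?thesis unfolding g_def lookup_scale ex_generator_coefficient[OF D] m by simp
  qed
  have "graded_quotient M B \<cong>\<^sub>g interval_module k (- 2 * int D) 2"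
  proof (rule graded_quotient_iso[OF M B_sub closed, where f = "\<lambda>x. coset ?N (g x)"])
    show "eta_morphism 0 M (interval_module k (- 2 * int D) 2) (\<lambda>x. coset ?N (g x))"
      unfolding eta_morphism_def
    proof (intro conjI ballI allI funcsetI subsetI)
      show "coset ?N (g x) \<in> carrier (interval_module k (- 2 * int D) 2)" for x
        unfolding interval_module_simps using g_keys by blast
      show "coset ?N (g (x \<oplus>\<^bsub>M\<^esub> y)) = coset ?N (g x) \<oplus>\<^bsub>interval_module k (- 2 * int D) 2\<^esub> coset ?N (g y)" for x y
        by (simp add: interval_module_simps M_def simps g_add)
      show "coset ?N (g (p \<odot>\<^bsub>M\<^esub> x)) = p \<odot>\<^bsub>interval_module k (- 2 * int D) 2\<^esub> coset ?N (g x)" for p x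
        by (simp add: interval_module_simps M_def simps g_scale)
      fix j S assume "S \<in> (\<lambda>x. coset ?N (g x)) ` grade M j"
      then obtain x where S: "S = coset ?N (g x)" and x: "x \<in> grade M j" by blast
      have "keys (g x) \<subseteq> {j}"
      proof (cases "?b \<in> keys x")
        case True
        have "\<forall>b\<in>keys x. \<exists>c n. lookup x b = monom c n \<and> ex_degree D b + int n = j"
          using x unfolding M_def simps by blast
        then obtain c n where c: "lookup x ?b = monom c n" and n: "ex_degree D ?b + int n = j"
          using True by blast
        have "j = - 2 * int D + int n" using n unfolding base by simp
        then show ?thesis by (simp only: g_def c laurent_of_poly_monom mult_single) simp
      next
        case False
        then have "lookup x ?b = 0" by (simp only: in_keys_iff not_not)
        then show ?thesis by (simp add: g_def)
      qed
      then show "S \<in> grade (interval_module k (- 2 * int D) 2) (j + int 0)"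
        unfolding S interval_module_simps using g_keys[of x] by auto
    qed
    show "carrier (interval_module k (- 2 * int D) 2) \<subseteq> (\<lambda>x. coset ?N (g x)) ` carrier M"
    proof
      fix S assume "S \<in> carrier (interval_module k (- 2 * int D) 2)"
      then obtain w where w: "S = coset ?N w" "keys w \<subseteq> {- int (2 * D)..}"
        by (auto simp: interval_module_simps)
      obtain p where "w = single (- int (2 * D)) 1 * laurent_of_poly p" by (rule laurent_of_poly_surj[OF w(2)])
      then have "S = coset ?N (g (scale (Polynomial.smult (inverse ?c) p) (ex_generator D)))" by (simp only: w(1) g_gen)
      then show "S \<in> (\<lambda>x. coset ?N (g x)) ` carrier M"
        using Z_closed(3)[OF gen gen] by (auto simp: M_def simps)
    qed
    show "grade (interval_module k (- 2 * int D) 2) j \<subseteq> (\<lambda>x. coset ?N (g x)) ` grade M j" for j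
    proof
      fix S assume "S \<in> grade (interval_module k (- 2 * int D) 2) j"
      then obtain w where w: "S = coset ?N w" "keys w \<subseteq> {- 2 * int D..}" "keys w \<subseteq> {j}"
        by (auto simp: interval_module_simps)
      define a where "a = lookup w j"
      have w': "w = single j a"
        by (rule poly_mapping_eqI) (use w(3) in \<open>auto simp: a_def lookup_single when_def keys_le_iff_lookup\<close>)
      define n where "n = nat (j + 2 * int D)"
      define x where "x = (scale (Polynomial.smult (inverse ?c) (monom a n)) (ex_generator D) :: _ \<Rightarrow>\<^sub>0 'k poly)"
      have jn: "a = 0 \<or> j = - 2 * int D + int n" using w(2) unfolding w' n_def by (auto split: if_splits)
      then have "w = single (- int (2 * D)) 1 * laurent_of_poly (monom a n)"
        unfolding w' by (auto simp: laurent_of_poly_monom mult_single)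
      then have "S = coset ?N (g x)" by (simp only: w(1) g_gen x_def)
      moreover have "x \<in> grade M j"
      proof -
        have keys: "keys x \<subseteq> ex_basis D (int D)"
          using Z_closed(3)[OF gen gen] by (simp add: x_def Z)
        have "\<exists>c n. lookup x b = monom c n \<and> ex_degree D b + int n = j" if b: "b \<in> keys x" for b
        proof -
          obtain e where e: "lookup (ex_generator D :: _ \<Rightarrow>\<^sub>0 'k poly) b = monom e 0"
            using ex_generator_constant[OF D] by blast
          have l: "lookup x b = monom (inverse ?c * a * e) n"
            by (simp add: x_def e smult_monom mult_monom)
          then have "a \<noteq> 0" using b by (auto simp: in_keys_iff)
          then have "j = - 2 * int D + int n" using jn by simp
          moreover have "b \<in> keys (ex_generator D :: _ \<Rightarrow>\<^sub>0 'k poly)"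
            by (rule subsetD[OF keys_scale_subset b[unfolded x_def]])
          then have "(fst b, snd b) \<in> ex_basis D (int D) \<and> 0 \<notin> fst b" by (intro ex_generator_keys[OF D]) simp
          then have "ex_degree D (fst b, snd b) = - 2 * int D" by (intro ex_degree_base) auto
          ultimately show ?thesis using l by (intro exI[of _ "inverse ?c * a * e"] exI[of _ n]) simp
        qed
        moreover have "ex_basis D (int D) \<subseteq> (\<Union>p q. mv_basis {0..D + 1} (ex_U_filt D) p q)"
          by (auto simp: ex_basis_def mv_total_basis_def)
        moreover have "x \<in> Z" unfolding x_def by (rule Z_closed(3)[OF gen gen])
        ultimately show ?thesis using keys unfolding M_def simps by blast
      qed
      ultimately show "S \<in> (\<lambda>x. coset ?N (g x)) ` grade M j" by blast
    qed
    fix x y assume "x \<in> carrier M" "y \<in> carrier M"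
    then have xy: "x - y \<in> Z" using Z_closed(2) by (simp add: M_def simps)
    have "coset ?N (g x) = coset ?N (g y) \<longleftrightarrow> keys (g (x - y)) \<subseteq> {2..}"
      by (simp add: coset_eq_iff[OF plus_subgroup_keys] g_diff)
    also have "\<dots> \<longleftrightarrow> monom 1 (2 * D + 2) dvd lookup (x - y) ?b"
      using keys_shifted_laurent[of "2 * D" "lookup (x - y) ?b" "2 * D + 2"] unfolding g_def m by simp
    also have "\<dots> \<longleftrightarrow> x - y \<in> B"
    proof
      assume "monom 1 (2 * D + 2) dvd lookup (x - y) ?b"
      then obtain w where w: "keys w \<subseteq> ex_basis D (int D + 1)" "(x - y) - ?d w \<in> ?F"
        using xy ex_kernel[OF D, of "x - y"] by (auto simp: Z)
      have "?d ((x - y) - ?d w) = 0"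
        using xy ex_differential_square[OF w(1)] by (simp add: Z mv_differential_linear(2)[of _ "x - y"])
      then show "x - y \<in> B" unfolding B using w by (intro CollectI exI[of _ "(x - y) - ?d w"] exI[of _ w]) simp
    next
      assume "x - y \<in> B"
      then obtain u w where u: "x - y = u + ?d w" "u \<in> ?F" "keys w \<subseteq> ex_basis D (int D + 1)"
        unfolding B by blast
      have "?b \<notin> keys u"
      proof
        assume "?b \<in> keys u"
        then have "int (card (omit D 0)) \<le> int D - 1 + 1" using u(2) by (auto simp: mv_filt_iff)
        then show False by (simp add: card_omit)
      qed
      then have "lookup u ?b = 0" by (simp only: in_keys_iff not_not)
      then show "monom 1 (2 * D + 2) dvd lookup (x - y) ?b"
        unfolding u(1) lookup_add using ex_coefficient_boundary[OF D u(3)] by simp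
    qed
    finally show "coset ?N (g x) = coset ?N (g y) \<longleftrightarrow> x - y \<in> B" .
  qed
  then show "mv_limit k {0..D + 1} (ex_U_filt D) (int D) 0 \<cong>\<^sub>g interval_module k (- 2 * int D) 2"
    unfolding limit .
qed

section \<open>Comparison of homology and limit page\<close>

theorem mainTheorem3:
  fixes D :: nat
  assumes "D \<ge> 1"
  shows "acyclic_cover TYPE('k::field) 1 (ex_X_filt D) {0..D + 1} (ex_U_filt D) \<and>
    persistent_homology TYPE('k) D (ex_X_filt D)
           \<cong>\<^sub>g interval_module TYPE('k) (- 2 * int D) (2 * int D + 2) \<and>
    mv_limit TYPE('k) {0..D + 1} (ex_U_filt D) (int D) 0
           \<cong>\<^sub>g interval_module TYPE('k) (- 2 * int D) 2 \<and>
    interleaved (2 * D) (persistent_homology TYPE('k) D (ex_X_filt D))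
           (mv_limit TYPE('k) {0..D + 1} (ex_U_filt D) (int D) 0) \<and>
    (\<forall>\<eta> < 2 * D. \<not> interleaved \<eta> (persistent_homology TYPE('k) D (ex_X_filt D))
           (mv_limit TYPE('k) {0..D + 1} (ex_U_filt D) (int D) 0))"
proof -
  let ?a = "- 2 * int D" and ?k = "TYPE('k)"
  let ?I = "interval_module ?k ?a (2 * int D + 2)" and ?J = "interval_module ?k ?a 2"
  note E = ex_limit_page[OF assms, of ?k]
  note H = ex_persistent_homology[OF assms, of ?k]
  have transfer: "interleaved \<eta> ?I ?J \<longleftrightarrow> interleaved \<eta> (persistent_homology ?k D (ex_X_filt D))
      (mv_limit ?k {0..D + 1} (ex_U_filt D) (int D) 0)" for \<eta>
    by (rule interleaved_iso[OF H interval_module_closed gmodule_iso_sym[OF E] interval_module_closed])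
  have "interleaved (2 * D) ?I ?J" by (rule interval_modules_interleaved) simp_all
  moreover have "\<not> interleaved \<eta> ?I ?J" if "\<eta> < 2 * D" for \<eta>
    by (rule interval_modules_not_interleaved) (use that in simp_all)
  ultimately show ?thesis
    using ex_acyclic_cover[OF assms, of ?k] gmodule_iso_sym[OF H interval_module_closed] E(1)
    by (simp only: transfer) blast
qed

end
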